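(* Let $W_n^u$ be the $n\times n$ triangular Wigner matrix with real input random variables $\{x_{ij}\}$ that are independent with mean $0$ and variance $1$ and are uniformly bounded. Then, almost surely, for every $k\ge1$, $$\lim_{n\to\infty}\frac1n\operatorname{Tr}\left(\frac{W_n^u}{\sqrt n}\right)^{2k}=\frac{k^k}{(k+1)!}.$$ Hence the limiting spectral distribution (LSD) of $W_n^u/\sqrt n$ has density $|x|\,\psi(x^2)$, where $\psi:(0,e)\to\mathbb R^+$ is the unique function satisfying $$\psi\left(\frac{\sin v}{v}\exp(v\cot v)\right)=\frac1\pi\sin v\,\exp(-v\cot v),\qquad 0<v<\pi,$$ and the support of the LSD is contained in $[-\sqrt e,\sqrt e]$.
   Context: The triangular Wigner matrix $W_n^u$ is the symmetric $n\times n$ matrix with $(i,j)$ entry $x_{\min(i,j),\max(i,j)}$ if $i+j\le n+1$ and $0$ otherwise. The LSD is the (almost sure, nonrandom) weak limit, as $n\to\infty$, of the empirical distribution of the eigenvalues of $W_n^u/\sqrt n$. The density $|x|\psi(x^2)$ is understood to be $0$ where $x^2\notin(0,e)$. *)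

theory Defs
  imports
    "HOL-Probability.Probability"
    "Jordan_Normal_Form.Char_Poly"
begin

text \<open>
  The input array \<open>X\<close> is indexed from 1, whereas matrix positions start at 0;
  only the entries \<open>X a b\<close> with \<open>1 \<le> a \<le> b\<close> occur.
\<close>

definition triangular_wigner :: "nat \<Rightarrow> (nat \<Rightarrow> nat \<Rightarrow> real) \<Rightarrow> real mat" where
  "triangular_wigner n X = Matrix.mat n n
     (\<lambda>(i, j). if Suc i + Suc j \<le> n + 1
               then X (min (Suc i) (Suc j)) (max (Suc i) (Suc j)) else 0)"

definition mat_trace :: "'a :: comm_monoid_add mat \<Rightarrow> 'a" where
  "mat_trace A = (\<Sum>i<dim_row A. A $$ (i, i))"

text \<open>
  Empirical distribution of the eigenvalues of a real symmetric matrix, counted with algebraic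
  multiplicity. All eigenvalues of such a matrix are real, so for size \<open>n \<ge> 1\<close> the multiset of
  real roots of the characteristic polynomial has exactly \<open>n\<close> elements, each of which receives
  mass \<open>1/n\<close>. The outer \<open>distr\<close> only changes the sigma-algebra to the Borel sets.
\<close>

definition esd :: "real mat \<Rightarrow> real measure" where
  "esd A = distr (measure_pmf (pmf_of_multiset (proots (char_poly A)))) borel (\<lambda>x. x)"

definition is_lsd :: "'w measure \<Rightarrow> (nat \<Rightarrow> 'w \<Rightarrow> real mat) \<Rightarrow> real measure \<Rightarrow> bool" where
  "is_lsd M A \<mu> \<longleftrightarrow> real_distribution \<mu> \<and> (AE \<omega> in M. weak_conv_m (\<lambda>n. esd (A n \<omega>)) \<mu>)"

definition measure_support :: "'a :: topological_space measure \<Rightarrow> 'a set" where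
  "measure_support \<mu> = {x. \<forall>U. open U \<longrightarrow> x \<in> U \<longrightarrow> emeasure \<mu> U > 0}"

text \<open>
  Functions from \<open>(0,e)\<close> to the positive reals are represented extensionally, i.e. with the fixed
  value \<open>undefined\<close> outside \<open>(0,e)\<close>, so that uniqueness is plain equality.
\<close>

definition triangular_psi :: "(real \<Rightarrow> real) \<Rightarrow> bool" where
  "triangular_psi \<psi> \<longleftrightarrow>
     \<psi> \<in> {0<..<exp 1} \<rightarrow>\<^sub>E {0<..} \<and>
     (\<forall>v. 0 < v \<and> v < pi \<longrightarrow>
        \<psi> (sin v / v * exp (v * cot v)) = 1 / pi * sin v * exp (- (v * cot v)))"

definition lsd_density :: "(real \<Rightarrow> real) \<Rightarrow> real \<Rightarrow> real" where
  "lsd_density \<psi> x = (if x\<^sup>2 \<in> {0<..<exp 1} then \<bar>x\<bar> * \<psi> (x\<^sup>2) else 0)"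

end

theory Submission
  imports Defs "Jordan_Normal_Form.Schur_Decomposition"
begin

text \<open>
  The trace of the \<open>m\<close>-th power of the matrix is a sum over closed walks of length \<open>m\<close> on the vertices
  \<open>0, ..., n - 1\<close> in which a step between \<open>a\<close> and \<open>b\<close> is allowed when \<open>a + b < n\<close>. By independence and
  centring, a walk contributes to the expected trace only if it uses each of its edges at least twice.
  A connected graph has at most one vertex more than it has edges, so such a walk has at most
  \<open>m div 2 + 1\<close> vertices. For odd \<open>m\<close> this makes the expectation negligible. For \<open>m = 2k\<close> the walks that
  matter have \<open>k + 1\<close> vertices; they run around a tree, use each edge exactly twice and
  have expectation 1 (\<open>expectation_odd\<close>, \<open>expectation_even\<close>). In the variance only pairs of walks with a
  common edge survive, and they have at most \<open>m\<close> vertices together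
  (\<open>card_vertices_two_closed_walks\<close>). The normalised traces therefore have variance \<open>O(n\<^sup>-\<^sup>2)\<close>, which is
  summable, and they converge almost surely (\<open>walk_sum_limit\<close>).

  It remains to count tree walks. Cutting such a walk at its first return to the root \<open>i\<close> splits it into a
  tree walk at the first neighbour \<open>j\<close> and a tree walk at \<open>i\<close>, with disjoint vertex sets
  (\<open>tree_walks_split\<close>). Up to an error \<open>O(n\<^sup>k\<^sup>-\<^sup>1)\<close>, the number of tree walks with \<open>k\<close> edges at
  \<open>i = (1 - a) n\<close> is thus \<open>n\<^sup>k A\<^sub>k(a)\<close>, where \<open>A\<^sub>0 = 1\<close> and
  \<open>A\<^sub>k\<^sub>+\<^sub>1(a) = \<Sum>l\<le>k. (\<integral> A\<^sub>l(1 - t) dt over 0 \<le> t \<le> a) A\<^sub>k\<^sub>-\<^sub>l(a)\<close>.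
  The solution is the Abel polynomial \<open>A\<^sub>k(a) = a (a + k)\<^sup>k\<^sup>-\<^sup>1 / k!\<close>: since \<open>A\<^sub>l\<^sub>+\<^sub>1'(a) = A\<^sub>l(a + 1)\<close>, the
  integral equals \<open>- A\<^sub>l\<^sub>+\<^sub>1(-a)\<close>, and the recursion is Abel's identity
  \<open>\<Sum>l. A\<^sub>l(-a) A\<^sub>n\<^sub>-\<^sub>l(a) = A\<^sub>n(0) = 0\<close> (\<open>abel_identity\<close>, \<open>abel_poly_recursion\<close>). Integrating \<open>A\<^sub>k\<close> over
  the unit interval gives \<open>- A\<^sub>k\<^sub>+\<^sub>1(-1) = k\<^sup>k / (k + 1)!\<close>.

  On the side of the limit law, write \<open>s(v) = sin v / v * exp (v cot v)\<close> and
  \<open>q(v) = sin v * exp (- v cot v) / \<pi>\<close>, so that \<open>\<psi>(s(v)) = q(v)\<close>. As \<open>s\<close> decreases from \<open>e\<close> to 0 on \<open>(0, \<pi>)\<close>,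
  the function \<open>\<psi>\<close> exists and is unique. Moreover \<open>q' = 1 / (\<pi> s)\<close>, and integration by parts reduces the moments
  of \<open>\<psi>\<close> to the integrals of \<open>s\<^sup>k\<close>, which equal \<open>\<pi> k\<^sup>k / k!\<close>. The latter is a residue: along the curve
  \<open>\<zeta>(v) = v cot v + \<i> v\<close> one has \<open>exp \<zeta> / \<zeta> = s(v)\<close>, and \<open>s\<^sup>k\<close> is the imaginary part of
  \<open>exp (k \<zeta>) \<zeta>\<^sup>-\<^sup>k\<^sup>-\<^sup>1 \<zeta>'\<close>. Subtracting the residue term \<open>k\<^sup>k / k! / \<zeta>\<close> leaves a function with a
  single-valued primitive that is real on the real axis (\<open>DERIV_residue_free_prim\<close>,
  \<open>Im_residue_free_prim_of_real\<close>).

  Finally, a real symmetric matrix has real eigenvalues, so the moments of its spectral distribution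
  are normalised traces (\<open>esd_moment\<close>). The limit moments grow slowly enough for Taylor expansions to
  control characteristic functions, and Levy's continuity theorem turns convergence of
  moments into weak convergence (\<open>weak_conv_from_moments\<close>).
\<close>

section \<open>Abel polynomials\<close>

definition abel_poly :: "nat \<Rightarrow> real \<Rightarrow> real" where
  "abel_poly k x = (if k = 0 then 1 else x * (x + real k) ^ (k - 1) / fact k)"

lemma abel_poly_0 [simp]: "abel_poly 0 x = 1"
  by (simp add: abel_poly_def)

lemma abel_poly_Suc: "abel_poly (Suc k) x = x * (x + real k + 1) ^ k / fact (Suc k)"
  by (simp add: abel_poly_def algebra_simps)

lemma abel_poly_at_0: "abel_poly k 0 = (if k = 0 then 1 else 0)"
  by (simp add: abel_poly_def)

lemma DERIV_abel_poly: "(abel_poly (Suc k) has_real_derivative abel_poly k (x + 1)) (at x)"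
proof (cases k)
  case 0
  have "abel_poly (Suc 0) = (\<lambda>x. x)" by (rule ext) (simp add: abel_poly_Suc)
  then show ?thesis using 0 by simp
next
  case (Suc m)
  define c where "c = x + real m + 2"
  have "((\<lambda>x. x + real m + 2) has_real_derivative 1) (at x)"
    by (auto intro!: derivative_eq_intros)
  from DERIV_power[OF this, of "Suc m"]
  have "((\<lambda>x. (x + real m + 2) ^ Suc m) has_real_derivative real (Suc m) * c ^ m) (at x)"
    by (simp add: c_def)
  from DERIV_cdivide[OF DERIV_mult[OF DERIV_ident this], of "fact (m + 2)"]
  have "((\<lambda>x. x * (x + real m + 2) ^ Suc m / fact (m + 2)) has_real_derivative
      (c ^ Suc m + x * (real (Suc m) * c ^ m)) / fact (m + 2)) (at x)"
    by (simp add: c_def mult.commute del: fact_Suc power_Suc)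
  also have "(\<lambda>x. x * (x + real m + 2) ^ Suc m / fact (m + 2)) = abel_poly (Suc k)"
    by (rule ext) (simp add: abel_poly_Suc Suc algebra_simps)
  also have "c ^ Suc m + x * (real (Suc m) * c ^ m) = (real m + 2) * ((x + 1) * c ^ m)"
    by (simp add: c_def algebra_simps)
  also have "(real m + 2) * ((x + 1) * c ^ m) / fact (m + 2) = abel_poly k (x + 1)"
  proof -
    have "fact (m + 2) = (real m + 2) * fact (m + 1)" by (simp add: algebra_simps)
    then have "(real m + 2) * ((x + 1) * c ^ m) / fact (m + 2) = (x + 1) * c ^ m / fact (m + 1)"
      by (simp del: fact_Suc)
    then show ?thesis unfolding Suc abel_poly_Suc by (simp add: c_def algebra_simps)
  qed
  finally show ?thesis .
qed

lemma isCont_abel_poly: "isCont (abel_poly k) x"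
proof (cases k)
  case (Suc m) then show ?thesis using DERIV_abel_poly DERIV_isCont by blast
qed (simp add: abel_poly_def[abs_def])

text \<open>
  Both sides agree at \<open>a = 0\<close>, and by induction they have the same derivative in \<open>a\<close>, because
  differentiation lowers the index of every factor \<open>A\<^sub>l(a)\<close> and shifts its argument by 1.
\<close>

theorem abel_identity:
  "(\<Sum>l\<le>n. abel_poly l a * abel_poly (n - l) b) = abel_poly n (a + b)"
proof (induction n arbitrary: a)
  case (Suc n)
  let ?F = "\<lambda>a. (\<Sum>l\<le>Suc n. abel_poly l a * abel_poly (Suc n - l) b) - abel_poly (Suc n) (a + b)"
  have split: "(\<Sum>l\<le>Suc n. abel_poly l a * abel_poly (Suc n - l) b) =
      abel_poly (Suc n) b + (\<Sum>l\<le>n. abel_poly (Suc l) a * abel_poly (n - l) b)" for a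
    by (subst sum.atMost_Suc_shift) simp
  have "(?F has_real_derivative 0) (at a)" for a
  proof -
    have "((\<lambda>a. abel_poly (Suc n) (a + b)) has_real_derivative abel_poly n (a + b + 1)) (at a)"
      using DERIV_abel_poly[of n "a + b"] by (simp add: DERIV_shift)
    moreover have "((\<lambda>a. abel_poly (Suc n) b + (\<Sum>l\<le>n. abel_poly (Suc l) a * abel_poly (n - l) b))
        has_real_derivative 0 + (\<Sum>l\<le>n. abel_poly l (a + 1) * abel_poly (n - l) b)) (at a)"
      by (intro DERIV_add DERIV_const DERIV_sum DERIV_cmult_right DERIV_abel_poly)
    ultimately have "(?F has_real_derivative
        0 + (\<Sum>l\<le>n. abel_poly l (a + 1) * abel_poly (n - l) b) - abel_poly n (a + b + 1)) (at a)"
      unfolding split by (rule DERIV_diff[rotated])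
    then show ?thesis using Suc[of "a + 1"] by (simp add: algebra_simps)
  qed
  then have "\<forall>x. (?F has_real_derivative 0) (at x)" by blast
  from DERIV_isconst_all[OF this, of a 0] have "?F a = ?F 0" .
  moreover have "?F 0 = 0" unfolding split by (simp add: abel_poly_at_0)
  ultimately show ?case by linarith
qed (simp)

text \<open>
  The case \<open>b = -a\<close> of Abel's identity: the sum is \<open>A\<^sub>k\<^sub>+\<^sub>1(0) = 0\<close>, and its term for \<open>l = 0\<close> is the
  left-hand side. The factor \<open>- A\<^sub>l\<^sub>+\<^sub>1(-a)\<close> is the integral of \<open>A\<^sub>l(1 - t)\<close> over \<open>0 \<le> t \<le> a\<close>, which is
  how the recursion arises from counting.
\<close>

lemma abel_poly_recursion:
  "abel_poly (Suc k) a = (\<Sum>l\<le>k. - abel_poly (Suc l) (- a) * abel_poly (k - l) a)"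
proof -
  have "(\<Sum>l\<le>Suc k. abel_poly l (- a) * abel_poly (Suc k - l) a) = 0"
    by (simp add: abel_identity abel_poly_at_0)
  then show ?thesis by (subst (asm) sum.atMost_Suc_shift) (simp add: sum_negf)
qed

lemma abel_poly_at_minus_1: "- abel_poly (Suc k) (-1) = real k ^ k / fact (k + 1)"
  by (simp add: abel_poly_Suc)

lemma abel_poly_bounded: "\<exists>K. \<forall>x. \<bar>x\<bar> \<le> 1 \<longrightarrow> \<bar>abel_poly k x\<bar> \<le> K"
proof -
  have "continuous_on {-1..1} (abel_poly k)"
    by (intro continuous_at_imp_continuous_on ballI isCont_abel_poly)
  then have "bounded (abel_poly k ` {-1..1})"
    by (intro compact_imp_bounded compact_continuous_image) auto
  then obtain K where "\<forall>x\<in>{-1..1}. \<bar>abel_poly k x\<bar> \<le> K"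
    by (auto simp: bounded_iff)
  then show ?thesis by (intro exI[of _ K]) (simp add: abs_le_iff)
qed

lemma abel_poly_Lipschitz:
  "\<exists>L\<ge>0. \<forall>x\<in>{0..1}. \<forall>y\<in>{0..1}. \<bar>abel_poly k x - abel_poly k y\<bar> \<le> L * \<bar>x - y\<bar>"
proof (cases k)
  case (Suc m)
  have "continuous_on {0..1} (\<lambda>x. abel_poly m (x + 1))"
    by (intro continuous_at_imp_continuous_on ballI isCont_o2[OF _ isCont_abel_poly]) auto
  then have "bounded ((\<lambda>x. abel_poly m (x + 1)) ` {0..1})"
    by (intro compact_imp_bounded compact_continuous_image) auto
  then obtain L where L: "\<forall>x\<in>{0..1}. \<bar>abel_poly m (x + 1)\<bar> \<le> L" by (auto simp: bounded_iff)
  have "\<bar>abel_poly k x - abel_poly k y\<bar> \<le> L * \<bar>x - y\<bar>" if "x \<in> {0..1}" "y \<in> {0..1}" for x y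
  proof -
    have "norm (abel_poly k x - abel_poly k y) \<le> L * norm (x - y)"
      by (rule field_differentiable_bound[of "{0..1}" _ "\<lambda>x. abel_poly m (x + 1)"])
         (use that L Suc in \<open>auto intro: DERIV_abel_poly DERIV_subset\<close>)
    then show ?thesis by simp
  qed
  moreover have "L \<ge> 0" using L[rule_format, of 0] by auto
  ultimately show ?thesis by blast
qed (auto intro!: exI[of _ 0])

text \<open>
  The function \<open>t \<mapsto> - A\<^sub>l\<^sub>+\<^sub>1(-t)\<close> is a primitive of \<open>A\<^sub>l(1 - t)\<close> that vanishes at 0, so the left-hand side is
  the error of a Riemann sum of a Lipschitz function with mesh \<open>1/n\<close>.
\<close>

lemma abel_poly_Riemann_sum:
  "\<exists>D. \<forall>n J. 0 < n \<longrightarrow> J \<le> n \<longrightarrow>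
     \<bar>(\<Sum>j<J. abel_poly l (1 - real j / real n)) / real n + abel_poly (Suc l) (- (real J / real n))\<bar>
       \<le> D / real n"
proof -
  obtain L where L: "L \<ge> 0"
    "\<And>x y. x \<in> {0..1} \<Longrightarrow> y \<in> {0..1} \<Longrightarrow> \<bar>abel_poly l x - abel_poly l y\<bar> \<le> L * \<bar>x - y\<bar>"
    using abel_poly_Lipschitz[of l] by blast
  have bound: "\<bar>(\<Sum>j<J. abel_poly l (1 - real j / real n)) / real n
      + abel_poly (Suc l) (- (real J / real n))\<bar> \<le> real J * (L / real n ^ 2)"
    if n: "0 < n" and J: "J \<le> n" for n J
    using J
  proof (induction J)
    case (Suc J)
    define a where "a = - (real (Suc J) / real n)"
    define b where "b = - (real J / real n)"
    have ab: "a < b" "b - a = 1 / real n" using n by (auto simp: a_def b_def field_simps)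
    have "a \<ge> -1" "b \<le> 0" using n Suc.prems by (auto simp: a_def b_def field_simps)
    obtain z where z: "a < z" "z < b"
      "abel_poly (Suc l) b - abel_poly (Suc l) a = (b - a) * abel_poly l (z + 1)"
      using MVT2[OF ab(1), of "abel_poly (Suc l)" "\<lambda>z. abel_poly l (z + 1)"] DERIV_abel_poly by auto
    have "\<bar>abel_poly l (1 + b) - abel_poly l (z + 1)\<bar> \<le> L * \<bar>1 + b - (z + 1)\<bar>"
      using z \<open>a \<ge> -1\<close> \<open>b \<le> 0\<close> by (intro L(2)) auto
    also have "\<dots> \<le> L * (1 / real n)" using z ab by (intro mult_left_mono L(1)) auto
    finally have 1: "\<bar>abel_poly l (1 + b) - abel_poly l (z + 1)\<bar> / real n \<le> L / real n ^ 2"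
      using n by (simp add: field_simps power2_eq_square)
    have "(\<Sum>j<Suc J. abel_poly l (1 - real j / real n)) / real n + abel_poly (Suc l) a =
       ((\<Sum>j<J. abel_poly l (1 - real j / real n)) / real n + abel_poly (Suc l) b)
       + (abel_poly l (1 + b) - abel_poly l (z + 1)) / real n"
    proof -
      have "abel_poly (Suc l) b - abel_poly (Suc l) a = abel_poly l (z + 1) / real n"
        using z(3) ab(2) by simp
      then show ?thesis by (simp add: add_divide_distrib diff_divide_distrib b_def)
    qed
    also have "\<bar>\<dots>\<bar> \<le> real J * (L / real n ^ 2) + L / real n ^ 2"
    proof -
      have "\<bar>(\<Sum>j<J. abel_poly l (1 - real j / real n)) / real n + abel_poly (Suc l) b\<bar>
          \<le> real J * (L / real n ^ 2)"
        using Suc.IH Suc.prems unfolding b_def by linarith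
      moreover have "\<bar>(abel_poly l (1 + b) - abel_poly l (z + 1)) / real n\<bar> \<le> L / real n ^ 2"
        using 1 by (simp add: abs_divide)
      ultimately show ?thesis by linarith
    qed
    also have "\<dots> = real (Suc J) * (L / real n ^ 2)" by (simp add: distrib_right add_divide_distrib)
    finally show ?case unfolding a_def .
  qed (simp add: abel_poly_at_0)
  show ?thesis
  proof (intro exI[of _ L] allI impI)
    fix n J :: nat assume nJ: "0 < n" "J \<le> n"
    have "real J * (L / real n ^ 2) \<le> real n * (L / real n ^ 2)"
      using nJ L by (intro mult_right_mono) auto
    also have "\<dots> = L / real n" using nJ by (simp add: field_simps power2_eq_square)
    finally show "\<bar>(\<Sum>j<J. abel_poly l (1 - real j / real n)) / real n
      + abel_poly (Suc l) (- (real J / real n))\<bar> \<le> L / real n"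
      using bound[OF nJ] by linarith
  qed
qed

section \<open>Uniform approximation up to order 1/n\<close>

text \<open>
  Index \<open>i < n\<close> stands for the point \<open>i/n\<close> of the unit interval; the constant is uniform in both \<open>n\<close> and \<open>i\<close>.
\<close>

definition uniformly_near :: "(nat \<Rightarrow> nat \<Rightarrow> real) \<Rightarrow> (nat \<Rightarrow> nat \<Rightarrow> real) \<Rightarrow> bool" where
  "uniformly_near f g \<longleftrightarrow> (\<exists>C. \<forall>n i. i < n \<longrightarrow> \<bar>f n i - g n i\<bar> \<le> C / real n)"

lemma uniformly_nearE:
  assumes "uniformly_near f g"
  obtains C where "C \<ge> 0" "\<And>n i. i < n \<Longrightarrow> \<bar>f n i - g n i\<bar> \<le> C / real n"
proof -
  obtain C where C: "\<And>n i. i < n \<Longrightarrow> \<bar>f n i - g n i\<bar> \<le> C / real n"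
    using assms unfolding uniformly_near_def by blast
  have "C \<ge> 0" using C[of 0 1] by simp
  then show thesis using C that by blast
qed

lemma uniformly_near_trans: 
  assumes "uniformly_near f g" "uniformly_near g h" shows "uniformly_near f h"
proof -
  obtain C D where C: "\<And>n i. i < n \<Longrightarrow> \<bar>f n i - g n i\<bar> \<le> C / real n"
    and D: "\<And>n i. i < n \<Longrightarrow> \<bar>g n i - h n i\<bar> \<le> D / real n"
    using assms unfolding uniformly_near_def by blast
  have "\<bar>f n i - h n i\<bar> \<le> (C + D) / real n" if "i < n" for n i
    using C[OF that] D[OF that] by (simp add: add_divide_distrib)
  then show ?thesis unfolding uniformly_near_def by blast
qed

lemma uniformly_near_sum:
  assumes "finite S" "\<And>l. l \<in> S \<Longrightarrow> uniformly_near (f l) (g l)"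
  shows "uniformly_near (\<lambda>n i. \<Sum>l\<in>S. f l n i) (\<lambda>n i. \<Sum>l\<in>S. g l n i)"
  using assms
proof (induction S rule: finite_induct)
  case (insert a S)
  obtain C where C: "\<And>n i. i < n \<Longrightarrow> \<bar>f a n i - g a n i\<bar> \<le> C / real n"
    using insert unfolding uniformly_near_def by blast
  obtain D where D: "\<And>n i. i < n \<Longrightarrow> \<bar>(\<Sum>l\<in>S. f l n i) - (\<Sum>l\<in>S. g l n i)\<bar> \<le> D / real n"
    using insert unfolding uniformly_near_def by blast
  have "\<bar>(\<Sum>l\<in>insert a S. f l n i) - (\<Sum>l\<in>insert a S. g l n i)\<bar> \<le> (C + D) / real n"
    if "i < n" for n i
    using C[OF that] D[OF that] insert(1,2) by (simp add: add_divide_distrib)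
  then show ?case unfolding uniformly_near_def by blast
qed (auto simp: uniformly_near_def intro!: exI[of _ 0])

lemma uniformly_near_mult:
  assumes "uniformly_near f g" "uniformly_near f' g'"
    and "\<And>n i. i < n \<Longrightarrow> \<bar>g n i\<bar> \<le> K" "\<And>n i. i < n \<Longrightarrow> \<bar>g' n i\<bar> \<le> K'"
  shows "uniformly_near (\<lambda>n i. f n i * f' n i) (\<lambda>n i. g n i * g' n i)"
proof -
  obtain C where C: "C \<ge> 0" "\<And>n i. i < n \<Longrightarrow> \<bar>f n i - g n i\<bar> \<le> C / real n"
    using assms(1) uniformly_nearE by metis
  obtain C' where C': "C' \<ge> 0" "\<And>n i. i < n \<Longrightarrow> \<bar>f' n i - g' n i\<bar> \<le> C' / real n"
    using assms(2) uniformly_nearE by metis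
  have "\<bar>f n i * f' n i - g n i * g' n i\<bar> \<le> (C * (K' + C') + K * C') / real n" if i: "i < n" for n i
  proof -
    have "C' / real n \<le> C'" using i C' by (simp add: field_simps mult_le_cancel_left1)
    then have f': "\<bar>f' n i\<bar> \<le> K' + C'" using C'(2)[OF i] assms(4)[OF i] by linarith
    have "f n i * f' n i - g n i * g' n i = (f n i - g n i) * f' n i + g n i * (f' n i - g' n i)"
      by (simp add: algebra_simps)
    also have "\<bar>\<dots>\<bar> \<le> \<bar>f n i - g n i\<bar> * \<bar>f' n i\<bar> + \<bar>g n i\<bar> * \<bar>f' n i - g' n i\<bar>"
      by (metis abs_mult abs_triangle_ineq)
    also have "\<dots> \<le> C / real n * (K' + C') + K * (C' / real n)"
      using C C' f' assms(3)[OF i] i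
      by (intro add_mono mult_mono) (auto intro: order_trans[OF abs_ge_zero])
    finally show ?thesis by (simp add: add_divide_distrib)
  qed
  then show ?thesis unfolding uniformly_near_def by blast
qed

text \<open>
  The sum over \<open>j < n - i\<close> is the sum over the vertices \<open>j\<close> that may follow \<open>i\<close> in a walk.
\<close>

lemma uniformly_near_average:
  assumes "uniformly_near f g"
  shows "uniformly_near (\<lambda>n i. (\<Sum>j<n - i. f n j) / real n) (\<lambda>n i. (\<Sum>j<n - i. g n j) / real n)"
proof -
  obtain C where C: "C \<ge> 0" "\<And>n i. i < n \<Longrightarrow> \<bar>f n i - g n i\<bar> \<le> C / real n"
    using assms uniformly_nearE by metis
  have "\<bar>(\<Sum>j<n - i. f n j) / real n - (\<Sum>j<n - i. g n j) / real n\<bar> \<le> C / real n" if i: "i < n" for n i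
  proof -
    have "\<bar>(\<Sum>j<n - i. f n j) - (\<Sum>j<n - i. g n j)\<bar> \<le> (\<Sum>j<n - i. \<bar>f n j - g n j\<bar>)"
      by (simp add: sum_subtractf[symmetric])
    also have "\<dots> \<le> (\<Sum>j<n - i. C / real n)" using C by (intro sum_mono) auto
    also have "\<dots> \<le> C" using i C(1) by (simp add: field_simps mult_left_mono)
    finally show ?thesis using i by (simp add: diff_divide_distrib[symmetric] divide_right_mono)
  qed
  then show ?thesis unfolding uniformly_near_def by blast
qed

section \<open>Vertices and edges of walks\<close>

text \<open>
  The edges are undirected, hence listed as sorted pairs, in the order of traversal and with repetitions.
\<close>

fun walk_edges :: "nat list \<Rightarrow> (nat \<times> nat) list" where
  "walk_edges (a # b # xs) = (min a b, max a b) # walk_edges (b # xs)"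
| "walk_edges _ = []"

lemma walk_edges_append: "walk_edges (xs @ v # ys) = walk_edges (xs @ [v]) @ walk_edges (v # ys)"
proof (induction xs)
  case (Cons a xs) then show ?case by (cases xs) auto
qed simp

lemma walk_edges_append2: "xs \<noteq> [] \<Longrightarrow> ys \<noteq> [] \<Longrightarrow>
  walk_edges (xs @ ys) = walk_edges xs @ (min (last xs) (hd ys), max (last xs) (hd ys)) # walk_edges ys"
proof (induction xs)
  case (Cons a xs)
  then show ?case by (cases xs; cases ys) auto
qed simp

lemma length_walk_edges: "length (walk_edges xs) = length xs - 1"
  by (induction xs rule: walk_edges.induct) auto

lemma walk_edges_rev: "walk_edges (rev xs) = rev (walk_edges xs)"
proof (induction xs rule: walk_edges.induct)
  case (1 a b xs)
  have "walk_edges (rev (a # b # xs)) = walk_edges (rev xs @ b # [a])" by simp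
  also have "\<dots> = walk_edges (rev xs @ [b]) @ walk_edges [b, a]" by (rule walk_edges_append)
  also have "\<dots> = rev (walk_edges (b # xs)) @ walk_edges [b, a]" using 1 by simp
  finally show ?case by (simp add: min.commute max.commute)
qed auto

lemma walk_edges_subset: "set (walk_edges xs) \<subseteq> set xs \<times> set xs"
  by (induction xs rule: walk_edges.induct) (auto simp: min_def max_def)

lemma walk_edges_le: "(a, b) \<in> set (walk_edges xs) \<Longrightarrow> a \<le> b"
  by (induction xs rule: walk_edges.induct) (auto simp: min_def max_def)

text \<open>
  Every edge of a walk occurs at some position; cutting there leaves two walks.
\<close>

lemma walk_edges_split:
  assumes "e \<in> set (walk_edges xs)"
  obtains as a b bs where "xs = as @ [a] @ b # bs" "e = (min a b, max a b)"
proof -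
  have "\<exists>as a b bs. xs = as @ [a] @ b # bs \<and> e = (min a b, max a b)"
    using assms
  proof (induction xs rule: walk_edges.induct)
    case (1 a b xs)
    show ?case
    proof (cases "e = (min a b, max a b)")
      case True then show ?thesis by (intro exI[of _ "[]"]) auto
    next
      case False
      then have "e \<in> set (walk_edges (b # xs))" using "1.prems" by simp
      then obtain as c d bs where *: "b # xs = as @ [c] @ d # bs" "e = (min c d, max c d)"
        using "1.IH" by blast
      then have "a # b # xs = (a # as) @ [c] @ d # bs" by simp
      with *(2) show ?thesis by blast
    qed
  qed auto
  then show thesis using that by blast
qed

text \<open>
  The property of connected graphs that the counting needs, in a form that is preserved when walks are attached.
  That the edges join vertices of \<open>V\<close> guarantees that an edge to a new vertex is itself new.
\<close>

definition spanned :: "nat set \<Rightarrow> (nat \<times> nat) set \<Rightarrow> bool" where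
  "spanned V E \<longleftrightarrow> finite V \<and> finite E \<and> E \<subseteq> V \<times> V \<and> card V \<le> card E + 1"

lemma spanned_singleton: "spanned {a} {}"
  by (simp add: spanned_def)

lemma spanned_insert:
  assumes "spanned V E" "a \<in> V"
  shows "spanned (insert b V) (insert (min a b, max a b) E)"
proof (cases "b \<in> V")
  case True
  then have "insert b V = V" by auto
  moreover have "card E \<le> card (insert (min a b, max a b) E)"
    using assms by (intro card_mono) (auto simp: spanned_def)
  ultimately show ?thesis using assms True by (auto simp: spanned_def min_def max_def)
next
  case False
  then have "(min a b, max a b) \<notin> E" using assms by (auto simp: spanned_def min_def max_def)
  then show ?thesis using assms False by (auto simp: spanned_def min_def max_def)
qed

lemma spanned_union_hd:
  "spanned V E \<Longrightarrow> a \<in> V \<Longrightarrow> spanned (V \<union> set (a # ys)) (E \<union> set (walk_edges (a # ys)))"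
proof (induction ys arbitrary: a V E)
  case (Cons b ys)
  have "spanned (insert b V \<union> set (b # ys)) (insert (min a b, max a b) E \<union> set (walk_edges (b # ys)))"
    by (rule Cons.IH[OF spanned_insert[OF Cons.prems]]) simp
  moreover have "insert b V \<union> set (b # ys) = V \<union> set (a # b # ys)" using Cons.prems by auto
  moreover have "insert (min a b, max a b) E \<union> set (walk_edges (b # ys)) = E \<union> set (walk_edges (a # b # ys))"
    by auto
  ultimately show ?case by metis
next
  case Nil
  then have "V \<union> set [a] = V" by auto
  then show ?case using Nil by simp
qed

text \<open>
  The walk may touch \<open>V\<close> in its middle: then its second half is attached forwards and its first half backwards.
\<close>

lemma spanned_union_walk:
  assumes "spanned V E" "v \<in> V" "v \<in> set ys"
  shows "spanned (V \<union> set ys) (E \<union> set (walk_edges ys))"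
proof -
  obtain as bs where ys: "ys = as @ v # bs" using assms(3) split_list by metis
  have "spanned (V \<union> set (v # bs)) (E \<union> set (walk_edges (v # bs)))"
    using spanned_union_hd assms by blast
  from spanned_union_hd[OF this, of v "rev as"]
  have "spanned (V \<union> set (v # bs) \<union> set (v # rev as))
     (E \<union> set (walk_edges (v # bs)) \<union> set (walk_edges (rev (as @ [v]))))"
    by simp
  moreover have "V \<union> set (v # bs) \<union> set (v # rev as) = V \<union> set ys" by (auto simp: ys)
  moreover have "E \<union> set (walk_edges (v # bs)) \<union> set (walk_edges (rev (as @ [v]))) = E \<union> set (walk_edges ys)"
    unfolding walk_edges_rev ys walk_edges_append[of as v bs] by auto
  ultimately show ?thesis by simp
qed

lemma spanned_walk: "xs \<noteq> [] \<Longrightarrow> spanned (set xs) (set (walk_edges xs))"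
  using spanned_union_walk[OF spanned_singleton, of "hd xs" "hd xs" xs]
  by (simp add: insert_absorb)

lemma card_vertices_le:
  assumes "xs \<noteq> []" shows "card (set xs) \<le> card (set (walk_edges xs)) + 1"
  using spanned_walk[OF assms] by (simp add: spanned_def)

lemma sum_count_list: "finite S \<Longrightarrow> set es \<subseteq> S \<Longrightarrow> (\<Sum>e\<in>S. count_list es e) = length es"
  by (simp add: sum_count_set)

lemma card_edges_le:
  assumes "\<forall>e\<in>set es. 2 \<le> count_list es e"
  shows "2 * card (set es) \<le> length es"
proof -
  have "2 * card (set es) = (\<Sum>e\<in>set es. 2)" by simp
  also have "\<dots> \<le> (\<Sum>e\<in>set es. count_list es e)" using assms by (intro sum_mono) auto
  also have "\<dots> = length es" by (simp add: sum_count_list)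
  finally show ?thesis .
qed

lemma remove_single_edge:
  assumes "count_list (walk_edges xs) e = 1"
  obtains as a b bs where "xs = as @ [a] @ b # bs" "e = (min a b, max a b)"
    "set (walk_edges (as @ [a])) \<union> set (walk_edges (b # bs)) = set (walk_edges xs) - {e}"
proof -
  have "e \<in> set (walk_edges xs)" using assms by (metis count_list_0_iff zero_neq_one)
  then obtain as a b bs where *: "xs = as @ [a] @ b # bs" "e = (min a b, max a b)"
    by (rule walk_edges_split)
  have w: "walk_edges xs = walk_edges (as @ [a]) @ e # walk_edges (b # bs)"
    using walk_edges_append2[of "as @ [a]" "b # bs"] * by simp
  have "e \<notin> set (walk_edges (as @ [a]))" "e \<notin> set (walk_edges (b # bs))"
    using assms unfolding w by (auto simp: count_list_0_iff)
  then have "set (walk_edges (as @ [a])) \<union> set (walk_edges (b # bs)) = set (walk_edges xs) - {e}"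
    unfolding w by auto
  then show thesis by (rule that[OF *])
qed

text \<open>
  Removing an edge that a closed walk uses only once cuts the walk into two pieces, which still
  meet in its end point. So the remaining graph is connected.
\<close>

lemma spanned_closed_minus_edge:
  assumes xs: "hd xs = last xs" and e: "count_list (walk_edges xs) e = 1"
  shows "spanned (set xs) (set (walk_edges xs) - {e})"
proof -
  obtain as a b bs where *: "xs = as @ [a] @ b # bs" "e = (min a b, max a b)"
    and edges: "set (walk_edges (as @ [a])) \<union> set (walk_edges (b # bs)) = set (walk_edges xs) - {e}"
    by (rule remove_single_edge[OF e])
  have "hd (as @ [a]) = last (b # bs)" using xs * by (cases as) auto
  then have v: "last (b # bs) \<in> set (as @ [a])" by (metis hd_in_set snoc_eq_iff_butlast)
  have "spanned (set (as @ [a])) (set (walk_edges (as @ [a])))" by (rule spanned_walk) simp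
  then have "spanned (set (as @ [a]) \<union> set (b # bs)) (set (walk_edges xs) - {e})"
    unfolding edges[symmetric]
    by (rule spanned_union_walk[OF _ v]) (metis last_in_set list.distinct(1))
  moreover have "set (as @ [a]) \<union> set (b # bs) = set xs" using * by auto
  ultimately show ?thesis by simp
qed

text \<open>
  The two pieces of the cut walk start and end in the end points of the removed edge, so each of them touches \<open>V\<close>.
\<close>

lemma spanned_union_walk_minus_edge:
  assumes V: "spanned V E" and e: "count_list (walk_edges xs) e = 1"
  and ends: "fst e \<in> V" "snd e \<in> V"
  shows "spanned (V \<union> set xs) (E \<union> (set (walk_edges xs) - {e}))"
proof -
  obtain as a b bs where *: "xs = as @ [a] @ b # bs" "e = (min a b, max a b)"
    and edges: "set (walk_edges (as @ [a])) \<union> set (walk_edges (b # bs)) = set (walk_edges xs) - {e}"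
    by (rule remove_single_edge[OF e])
  have ab: "a \<in> V" "b \<in> V" using ends * by (auto simp: min_def max_def split: if_splits)
  have "spanned (V \<union> set (as @ [a])) (E \<union> set (walk_edges (as @ [a])))"
    by (rule spanned_union_walk[OF V ab(1)]) simp
  then have "spanned (V \<union> set (as @ [a]) \<union> set (b # bs))
     (E \<union> set (walk_edges (as @ [a])) \<union> set (walk_edges (b # bs)))"
    by (rule spanned_union_walk[where v = b]) (use ab in auto)
  moreover have "V \<union> set (as @ [a]) \<union> set (b # bs) = V \<union> set xs" using * by auto
  ultimately show ?thesis unfolding edges[symmetric] by (simp add: Un_assoc)
qed

text \<open>
  If the common edge is used at least three times in total, the \<open>2 m\<close> steps cover at most \<open>m - 1\<close> edges and the union of
  the walks has at most \<open>m\<close> vertices. Otherwise each walk uses it exactly once, and the union stays connected without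
  that edge. So it has at most as many vertices as edges, that is, at most \<open>m\<close>.
\<close>

lemma card_vertices_two_closed_walks:
  assumes "hd xs = last xs" "hd ys = last ys" "length xs = Suc m" "length ys = Suc m"
    and e: "e \<in> set (walk_edges xs)" "e \<in> set (walk_edges ys)"
    and two: "\<forall>e\<in>set (walk_edges xs @ walk_edges ys). 2 \<le> count_list (walk_edges xs @ walk_edges ys) e"
  shows "card (set xs \<union> set ys) \<le> m"
proof -
  let ?es = "walk_edges xs @ walk_edges ys"
  have len: "length ?es = 2 * m" using assms by (simp add: length_walk_edges)
  have ev: "fst e \<in> set xs" "snd e \<in> set xs"
    using e(1) walk_edges_subset[of xs] by (cases e; auto)+
  have ev': "fst e \<in> set ys" using e(2) walk_edges_subset[of ys] by (cases e; auto)
  have pos: "0 < count_list (walk_edges xs) e" "0 < count_list (walk_edges ys) e"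
    using e by (metis count_list_0_iff gr0I)+
  show ?thesis
  proof (cases "count_list (walk_edges xs) e = 1 \<and> count_list (walk_edges ys) e = 1")
    case True
    have "spanned (set xs \<union> set ys) (set (walk_edges xs) - {e} \<union> (set (walk_edges ys) - {e}))"
      using True assms ev by (intro spanned_union_walk_minus_edge spanned_closed_minus_edge) auto
    then have "card (set xs \<union> set ys) \<le> card (set ?es - {e}) + 1"
      by (simp add: spanned_def Un_Diff)
    also have "\<dots> = card (set ?es)"
      using e card_Suc_Diff1[of "set ?es" e] by simp
    also have "\<dots> \<le> m" using card_edges_le[OF two] len by simp
    finally show ?thesis .
  next
    case False
    have "xs \<noteq> []" using assms(3) by auto
    have "spanned (set xs \<union> set ys) (set (walk_edges xs) \<union> set (walk_edges ys))"
      by (rule spanned_union_walk[OF spanned_walk ev(1) ev']) fact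
    then have 1: "card (set xs \<union> set ys) \<le> card (set ?es) + 1" by (simp add: spanned_def)
    have "2 * card (set ?es) + 1 = (\<Sum>f\<in>set ?es. 2) + (\<Sum>f\<in>set ?es. if f = e then 1 else 0)"
      using e by (simp add: sum.delta)
    also have "\<dots> = (\<Sum>f\<in>set ?es. 2 + (if f = e then 1 else 0))"
      by (rule sum.distrib[symmetric])
    also have "\<dots> \<le> (\<Sum>f\<in>set ?es. count_list ?es f)"
    proof (intro sum_mono)
      fix f assume f: "f \<in> set ?es"
      show "2 + (if f = e then 1 else 0) \<le> count_list ?es f"
      proof (cases "f = e")
        case True then show ?thesis using pos False by auto
      next
        case False then show ?thesis using bspec[OF two f] by simp
      qed
    qed
    also have "\<dots> = 2 * m" using len by (subst sum_count_list) auto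
    finally show ?thesis using 1 by linarith
  qed
qed

section \<open>Closed walks along trees\<close>

text \<open>
  A walk that uses each of its edges at least twice has at most \<open>k + 1\<close> vertices. In the case of equality
  its edges form a tree and are used exactly twice (\<open>tree_walk_counts\<close>).
\<close>

definition tree_walks :: "nat \<Rightarrow> nat \<Rightarrow> nat \<Rightarrow> nat list set" where
  "tree_walks n k i = {xs. length xs = 2 * k + 1 \<and> hd xs = i \<and> last xs = i \<and> set xs \<subseteq> {..<n} \<and>
     (\<forall>(a, b)\<in>set (walk_edges xs). a + b < n) \<and> (\<forall>e\<in>set (walk_edges xs). 2 \<le> count_list (walk_edges xs) e) \<and>
     card (set xs) = k + 1}"

lemma tree_walks_0: "i < n \<Longrightarrow> tree_walks n 0 i = {[i]}"
  by (auto simp: tree_walks_def length_Suc_conv)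

lemma finite_tree_walks: "finite (tree_walks n k i)"
  by (rule finite_subset[OF _ finite_lists_length_eq[of "{..<n}" "2 * k + 1"]])
     (auto simp: tree_walks_def)

text \<open>
  There are at least \<open>k\<close> edges by connectedness and at most \<open>k\<close> by counting steps, so equality holds throughout.
\<close>

lemma tree_walk_counts:
  assumes len: "length xs = 2 * k + 1" and two: "\<forall>e\<in>set (walk_edges xs). 2 \<le> count_list (walk_edges xs) e"
    and card: "card (set xs) = k + 1"
  shows "card (set (walk_edges xs)) = k" and "e \<in> set (walk_edges xs) \<Longrightarrow> count_list (walk_edges xs) e = 2"
proof -
  have "xs \<noteq> []" using len by auto
  have l: "length (walk_edges xs) = 2 * k" using len by (simp add: length_walk_edges)
  have "k \<le> card (set (walk_edges xs))" using card_vertices_le[OF \<open>xs \<noteq> []\<close>] card by simp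
  with card_edges_le[OF two] l show c: "card (set (walk_edges xs)) = k" by simp
  have "(\<Sum>e\<in>set (walk_edges xs). count_list (walk_edges xs) e) = (\<Sum>e\<in>set (walk_edges xs). 2)"
    using l c by (simp add: sum_count_list)
  then show "count_list (walk_edges xs) e = 2" if "e \<in> set (walk_edges xs)"
    using sum_mono_inv[of "\<lambda>_. 2" "set (walk_edges xs)" "count_list (walk_edges xs)" e] two that by simp
qed

lemma closed_tree_part:
  assumes "\<forall>e\<in>set (walk_edges u). count_list (walk_edges u) e = 2" "length u > 0"
  obtains l where "length u = 2 * l + 1" "card (set (walk_edges u)) = l"
proof -
  have "2 * card (set (walk_edges u)) = (\<Sum>e\<in>set (walk_edges u). count_list (walk_edges u) e)"
    using assms by simp
  also have "\<dots> = length u - 1" by (simp add: sum_count_list length_walk_edges)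
  finally have "length u = 2 * card (set (walk_edges u)) + 1" using assms(2) by simp
  then show thesis using that by blast
qed

lemma walk_edges_join:
  assumes "u \<noteq> []" "w \<noteq> []" "hd u = j" "last u = j" "hd w = i"
  shows "walk_edges (i # u @ w) = (min i j, max i j) # walk_edges u @ (min i j, max i j) # walk_edges w"
proof -
  have "walk_edges (i # u @ w) = (min i j, max i j) # walk_edges (u @ w)"
    using assms by (cases u) auto
  then show ?thesis using walk_edges_append2[OF assms(1,2)] assms
    by (simp add: min.commute max.commute)
qed

lemma tree_walks_join:
  assumes u: "u \<in> tree_walks n l j" and w: "w \<in> tree_walks n m i"
    and disj: "set u \<inter> set w = {}" and ij: "i + j < n"
  shows "i # u @ w \<in> tree_walks n (Suc (l + m)) i"
proof -
  let ?e = "(min i j, max i j)"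
  have ne: "u \<noteq> []" "w \<noteq> []" using u w by (auto simp: tree_walks_def)
  have hd: "hd u = j" "last u = j" "hd w = i" "last w = i" using u w by (auto simp: tree_walks_def)
  have "i \<in> set w" using ne hd by (metis hd_in_set)
  have W: "walk_edges (i # u @ w) = ?e # walk_edges u @ ?e # walk_edges w" by (rule walk_edges_join) fact+
  have "card (set (i # u @ w)) = card (set u \<union> set w)"
    using \<open>i \<in> set w\<close> by (simp add: insert_absorb)
  also have "\<dots> = card (set u) + card (set w)" using disj by (intro card_Un_disjoint) auto
  finally have c: "card (set (i # u @ w)) = Suc (l + m) + 1" using u w by (simp add: tree_walks_def)
  have "\<forall>e\<in>set (walk_edges (i # u @ w)). 2 \<le> count_list (walk_edges (i # u @ w)) e"
    using u w unfolding W by (fastforce simp: tree_walks_def)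
  then show ?thesis using c W u w ij ne hd
    by (auto simp: tree_walks_def min_def max_def)
qed

text \<open>
  The edge \<open>e\<close> of the first step is used exactly once more. The walk minus these two steps consists of pieces
  \<open>P\<close> and \<open>Q\<close> that do not use \<open>e\<close>; they cannot meet, since otherwise the remaining \<open>k\<close> edges would connect \<open>k + 2\<close>
  vertices. As \<open>Q\<close> ends at \<open>i\<close>, the piece \<open>P\<close> avoids \<open>i\<close>, so \<open>P\<close> is closed at \<open>j\<close> and \<open>Q\<close> at \<open>i\<close>. Counting vertices and
  edges shows that each of them is again a tree walk.
\<close>

lemma tree_walks_split:
  assumes xs: "xs \<in> tree_walks n (Suc k) i"
  obtains l j u w where "l \<le> k" "i + j < n" "u \<in> tree_walks n l j" "w \<in> tree_walks n (k - l) i"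
    "set u \<inter> set w = {}" "xs = i # u @ w"
proof -
  have props: "length xs = 2 * Suc k + 1" "hd xs = i" "last xs = i" "set xs \<subseteq> {..<n}"
    "\<forall>(a, b)\<in>set (walk_edges xs). a + b < n" "\<forall>e\<in>set (walk_edges xs). 2 \<le> count_list (walk_edges xs) e"
    "card (set xs) = Suc k + 1"
    using xs unfolding tree_walks_def by blast+
  note counts = tree_walk_counts[OF props(1,6,7)]
  \<comment> \<open>The rest of the walk uses the first edge exactly once more; cutting there gives \<open>P\<close> and \<open>Q\<close>.\<close>
  obtain j rest where xs_eq: "xs = i # j # rest"
    using props(1,2) by (cases xs; cases "tl xs") auto
  let ?e = "(min i j, max i j)"
  have w0: "walk_edges xs = ?e # walk_edges (j # rest)" by (simp add: xs_eq)
  have "count_list (walk_edges xs) ?e = 2" by (intro counts) (simp add: w0)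
  then have c1: "count_list (walk_edges (j # rest)) ?e = 1" by (simp add: w0)
  then have "?e \<in> set (walk_edges (j # rest))" by (metis count_list_0_iff zero_neq_one)
  then obtain as c d bs where split: "j # rest = as @ [c] @ d # bs" "?e = (min c d, max c d)"
    by (rule walk_edges_split)
  define P where "P = as @ [c]"
  define Q where "Q = d # bs"
  have PQ: "j # rest = P @ Q" "P \<noteq> []" "Q \<noteq> []" "last P = c" "hd Q = d"
    using split by (auto simp: P_def Q_def)
  have hdP: "hd P = j" using PQ by (metis hd_append2 list.sel(1))
  have lastQ: "last Q = i" using PQ props(3) xs_eq by (metis last_ConsR last_append list.distinct(1))
  have w1: "walk_edges (j # rest) = walk_edges P @ ?e # walk_edges Q"
    using walk_edges_append2[of P Q] PQ split by simp
  have ne: "?e \<notin> set (walk_edges P)" "?e \<notin> set (walk_edges Q)"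
    using c1 unfolding w1 by (auto simp: count_list_0_iff)
  have xsPQ: "xs = i # P @ Q" using xs_eq PQ by simp
  have "i \<in> set Q" using lastQ PQ(3) last_in_set by metis
  then have sx: "set xs = set P \<union> set Q" using xsPQ by auto
  have E: "set (walk_edges xs) = insert ?e (set (walk_edges P) \<union> set (walk_edges Q))" unfolding w0 w1 by auto
  have cE: "card (set (walk_edges P) \<union> set (walk_edges Q)) = k"
    using counts(1) ne unfolding E by simp
  have disj: "set P \<inter> set Q = {}"
  proof (rule ccontr)
    assume "set P \<inter> set Q \<noteq> {}"
    then obtain v where "v \<in> set P" "v \<in> set Q" by auto
    then have "spanned (set P \<union> set Q) (set (walk_edges P) \<union> set (walk_edges Q))"
      using spanned_union_walk spanned_walk PQ(2) by blast
    then show False using cE props(7) sx by (simp add: spanned_def)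
  qed
  have "c \<in> set P" using PQ last_in_set by metis
  have "c \<noteq> i" using \<open>i \<in> set Q\<close> \<open>c \<in> set P\<close> disj by auto
  then have cd: "c = j" "d = i" using split(2) by (auto simp: min_def max_def split: if_splits)
  have disjE: "set (walk_edges P) \<inter> set (walk_edges Q) = {}"
    using walk_edges_subset[of P] walk_edges_subset[of Q] disj by blast
  have cP: "\<forall>e\<in>set (walk_edges P). count_list (walk_edges P) e = 2"
  proof
    fix e assume e: "e \<in> set (walk_edges P)"
    have "count_list (walk_edges xs) e = 2" by (rule counts) (use e E in auto)
    moreover have "e \<noteq> ?e" "count_list (walk_edges Q) e = 0"
      using e ne disjE by (auto simp: count_list_0_iff)
    ultimately show "count_list (walk_edges P) e = 2" unfolding w0 w1 by auto
  qed
  have cQ: "\<forall>e\<in>set (walk_edges Q). count_list (walk_edges Q) e = 2"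
  proof
    fix e assume e: "e \<in> set (walk_edges Q)"
    have "count_list (walk_edges xs) e = 2" by (rule counts) (use e E in auto)
    moreover have "e \<noteq> ?e" "count_list (walk_edges P) e = 0"
      using e ne disjE by (auto simp: count_list_0_iff)
    ultimately show "count_list (walk_edges Q) e = 2" unfolding w0 w1 by auto
  qed
  obtain l where l: "length P = 2 * l + 1" "card (set (walk_edges P)) = l"
    by (rule closed_tree_part[OF cP]) (use PQ in auto)
  obtain m where m: "length Q = 2 * m + 1" "card (set (walk_edges Q)) = m"
    by (rule closed_tree_part[OF cQ]) (use PQ in auto)
  have k: "k = l + m" using props(1) l m xsPQ by simp
  have "card (set P) \<le> l + 1" "card (set Q) \<le> m + 1"
    using card_vertices_le PQ l m by metis+
  moreover have "card (set P) + card (set Q) = k + 2"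
    using card_Un_disjoint[OF _ _ disj] props(7) sx by simp
  ultimately have cards: "card (set P) = l + 1" "card (set Q) = m + 1" using k by auto
  have ij: "i + j < n" using props(5) unfolding w0 by (auto simp: min_def max_def split: if_splits)
  have "P \<in> tree_walks n l j"
    unfolding tree_walks_def using l cards cP hdP PQ(4) cd props(4,5) sx E by auto
  moreover have "Q \<in> tree_walks n (k - l) i"
    unfolding tree_walks_def using k m cards cQ lastQ PQ(5) cd props(4,5) sx E by auto
  ultimately show thesis using that[of l j P Q] k ij disj xsPQ by simp
qed

text \<open>
  The decomposition is unique: \<open>i\<close> lies in \<open>w\<close> and hence not in \<open>u\<close>, so \<open>u\<close> is the stretch up to the first
  return to \<open>i\<close>, and \<open>u\<close> determines \<open>l\<close> and \<open>j\<close>.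
\<close>

lemma card_tree_walks_Suc:
  assumes "i < n"
  shows "card (tree_walks n (Suc k) i) = (\<Sum>l\<le>k. \<Sum>j<n - i.
    card {(u, w). u \<in> tree_walks n l j \<and> w \<in> tree_walks n (k - l) i \<and> set u \<inter> set w = {}})"
proof -
  define D where "D l j = {(u, w). u \<in> tree_walks n l j \<and> w \<in> tree_walks n (k - l) i \<and> set u \<inter> set w = {}}"
    for l j
  define S where "S = (SIGMA l:{..k}. SIGMA j:{..<n - i}. D l j)"
  define f where "f = (\<lambda>(l::nat, j::nat, u, w). i # u @ w :: nat list)"
  have finD: "finite (D l j)" for l j
    by (rule finite_subset[of _ "tree_walks n l j \<times> tree_walks n (k - l) i"])
       (auto simp: D_def finite_tree_walks)
  have "f ` S = tree_walks n (Suc k) i"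
  proof
    show "f ` S \<subseteq> tree_walks n (Suc k) i"
    proof
      fix xs assume "xs \<in> f ` S"
      then obtain l j u w where *: "l \<le> k" "j < n - i" "u \<in> tree_walks n l j"
        "w \<in> tree_walks n (k - l) i" "set u \<inter> set w = {}" "xs = i # u @ w"
        by (auto simp: S_def D_def f_def)
      with tree_walks_join[of u n l j w "k - l" i] show "xs \<in> tree_walks n (Suc k) i" by simp
    qed
    show "tree_walks n (Suc k) i \<subseteq> f ` S"
    proof
      fix xs assume "xs \<in> tree_walks n (Suc k) i"
      then obtain l j u w where *: "l \<le> k" "i + j < n" "u \<in> tree_walks n l j"
        "w \<in> tree_walks n (k - l) i" "set u \<inter> set w = {}" "xs = i # u @ w"
        by (rule tree_walks_split)
      then have "(l, j, u, w) \<in> S" by (auto simp: S_def D_def)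
      moreover have "xs = f (l, j, u, w)" using * by (simp add: f_def)
      ultimately show "xs \<in> f ` S" by blast
    qed
  qed
  moreover have "inj_on f S"
  proof (rule inj_onI)
    fix p q assume p: "p \<in> S" and q: "q \<in> S" and eq: "f p = f q"
    obtain l j u w where p': "p = (l, j, u, w)" by (metis prod_cases4)
    obtain l' j' u' w' where q': "q = (l', j', u', w')" by (metis prod_cases4)
    have *: "takeWhile (\<lambda>v. v \<noteq> i) (u @ w) = u \<and> length u = 2 * l + 1 \<and> hd u = j"
      if "(l, j, u, w) \<in> S" for l j u w
    proof -
      have uw: "u \<in> tree_walks n l j" "w \<in> tree_walks n (k - l) i" "set u \<inter> set w = {}"
        using that by (auto simp: S_def D_def)
      then have "w \<noteq> []" "hd w = i" by (auto simp: tree_walks_def)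
      then obtain w0 where "w = i # w0" by (cases w) auto
      moreover have "i \<notin> set u" using uw(3) \<open>w = i # w0\<close> by auto
      ultimately show ?thesis using uw by (auto simp: tree_walks_def takeWhile_append)
    qed
    have "u @ w = u' @ w'" using eq by (simp add: p' q' f_def)
    moreover have "u = u'" using *[of l j u w] *[of l' j' u' w'] p q p' q' calculation by metis
    moreover have "l = l'" "j = j'"
      using *[of l j u w] *[of l' j' u' w'] p q p' q' \<open>u = u'\<close> by auto
    ultimately show "p = q" by (simp add: p' q')
  qed
  ultimately have "card (tree_walks n (Suc k) i) = card S" by (metis card_image)
  also have "\<dots> = (\<Sum>l\<le>k. \<Sum>j<n - i. card (D l j))"
    unfolding S_def using finD by (subst card_SigmaI) (auto intro!: sum.cong)
  finally show ?thesis unfolding D_def .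
qed

text \<open>
  Such a list is determined by a list of \<open>r\<close> values that includes those outside \<open>A\<close>, and for every
  entry by the position of its value among these values and the elements of \<open>A\<close>.
\<close>

lemma card_lists_few_values:
  fixes A :: "nat set"
  assumes A: "finite A" and n: "n > 0"
  shows "card {xs. length xs = L \<and> set xs \<subseteq> {..<n} \<and> card (set xs - A) \<le> r} \<le> (r + card A) ^ L * n ^ r"
proof -
  obtain as where as: "set as = A" "length as = card A"
    using finite_distinct_list[OF A] distinct_card by metis
  let ?X = "{ys. set ys \<subseteq> {..<n} \<and> length ys = r} \<times> {hs. set hs \<subseteq> {..<r + card A} \<and> length hs = L}"
  let ?f = "\<lambda>(ys, hs). map (\<lambda>t. (ys @ as) ! t) hs"
  have "{xs. length xs = L \<and> set xs \<subseteq> {..<n} \<and> card (set xs - A) \<le> r} \<subseteq> ?f ` ?X"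
  proof
    fix xs assume "xs \<in> {xs. length xs = L \<and> set xs \<subseteq> {..<n} \<and> card (set xs - A) \<le> r}"
    then have xs: "length xs = L" "set xs \<subseteq> {..<n}" "card (set xs - A) \<le> r" by auto
    obtain zs where zs: "set zs = set xs - A" "length zs = card (set xs - A)"
      using finite_distinct_list[of "set xs - A"] distinct_card by (metis List.finite_set finite_Diff)
    \<comment> \<open>Padding with the vertex 0, which exists because \<open>n > 0\<close>, makes the length exactly \<open>r\<close>.\<close>
  define ys where "ys = zs @ replicate (r - length zs) 0"
    have ys: "length ys = r" "set ys \<subseteq> {..<n}" using zs xs n by (auto simp: ys_def)
    have sub: "set xs \<subseteq> set (ys @ as)" using zs as by (auto simp: ys_def)
    have "\<forall>v\<in>set xs. \<exists>t<r + card A. (ys @ as) ! t = v"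
    proof
      fix v assume "v \<in> set xs"
      then have "v \<in> set (ys @ as)" using sub by blast
      then show "\<exists>t<r + card A. (ys @ as) ! t = v" unfolding in_set_conv_nth using ys as by auto
    qed
    then obtain h where h: "\<forall>v\<in>set xs. h v < r + card A \<and> (ys @ as) ! h v = v" by metis
    have "xs = ?f (ys, map h xs)" using h by (auto intro!: nth_equalityI)
    moreover have "(ys, map h xs) \<in> ?X" using ys h xs by auto
    ultimately show "xs \<in> ?f ` ?X" by blast
  qed
  then have "card {xs. length xs = L \<and> set xs \<subseteq> {..<n} \<and> card (set xs - A) \<le> r} \<le> card (?f ` ?X)"
    by (intro card_mono finite_imageI finite_cartesian_product finite_lists_length_eq) auto
  also have "\<dots> \<le> card ?X"
    by (intro card_image_le finite_cartesian_product finite_lists_length_eq) auto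
  also have "\<dots> = (r + card A) ^ L * n ^ r"
    by (simp add: card_cartesian_product card_lists_length_eq)
  finally show ?thesis .
qed

section \<open>The number of tree walks\<close>

lemma finite_few_values: "finite {xs. length xs = L \<and> set xs \<subseteq> {..<n::nat} \<and> P xs}"
  by (rule finite_subset[OF _ finite_lists_length_eq[of "{..<n}" L]]) auto

text \<open>
  Pairs with a common vertex have at most \<open>k + 1\<close> vertices together, one of which is the fixed vertex \<open>i\<close>. So there are
  \<open>O(n\<^sup>k)\<close> of them, one order less than there are pairs.
\<close>

lemma card_overlapping_pairs:
  assumes "i < n" "l \<le> k"
  shows "(\<Sum>j<n - i. card {(u, w). u \<in> tree_walks n l j \<and> w \<in> tree_walks n (k - l) i \<and> set u \<inter> set w \<noteq> {}})
    \<le> (k + 1) ^ (2 * k + 2) * n ^ k"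
proof -
  define B where "B j = {(u, w). u \<in> tree_walks n l j \<and> w \<in> tree_walks n (k - l) i \<and> set u \<inter> set w \<noteq> {}}"
    for j
  let ?L = "{xs. length xs = 2 * k + 2 \<and> set xs \<subseteq> {..<n} \<and> card (set xs - {i}) \<le> k}"
  have finB: "finite (B j)" for j
    by (rule finite_subset[of _ "tree_walks n l j \<times> tree_walks n (k - l) i"])
       (auto simp: B_def finite_tree_walks)
  have disj: "B j \<inter> B j' = {}" if "j \<noteq> j'" for j j'
    using that by (auto simp: B_def tree_walks_def)
  have "(\<Sum>j<n - i. card (B j)) = card (\<Union>j<n - i. B j)"
    by (rule card_UN_disjoint[symmetric]) (use finB disj in auto)
  also have "\<dots> = card ((\<lambda>(u, w). u @ w) ` (\<Union>j<n - i. B j))"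
  proof (rule card_image[symmetric], rule inj_onI)
    fix p q assume "p \<in> (\<Union>j<n - i. B j)" "q \<in> (\<Union>j<n - i. B j)" "(case p of (u, w) \<Rightarrow> u @ w) = (case q of (u, w) \<Rightarrow> u @ w)"
    then show "p = q" by (cases p; cases q) (auto simp: B_def tree_walks_def)
  qed
  also have "\<dots> \<le> card ?L"
  proof (rule card_mono)
    show "finite ?L" by (rule finite_few_values)
    show "(\<lambda>(u, w). u @ w) ` (\<Union>j<n - i. B j) \<subseteq> ?L"
    proof
      fix xs assume "xs \<in> (\<lambda>(u, w). u @ w) ` (\<Union>j<n - i. B j)"
      then obtain j u w where uw: "(u, w) \<in> B j" "xs = u @ w" by auto
      have w: "card (set u) = l + 1" "card (set w) = k - l + 1" "hd w = i" "length w = 2 * (k - l) + 1"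
          "length u = 2 * l + 1" "set u \<inter> set w \<noteq> {}"
        using uw by (auto simp: B_def tree_walks_def)
      then have "w \<noteq> []" by auto
      then have "i \<in> set w" using w(3) hd_in_set by metis
      have "card (set u \<union> set w) + card (set u \<inter> set w) = card (set u) + card (set w)"
        by (rule card_Un_Int[symmetric]) auto
      moreover have "card (set u \<inter> set w) \<ge> 1"
        using w(6) by (simp add: Suc_le_eq card_gt_0_iff)
      moreover have "card (set u \<union> set w - {i}) = card (set u \<union> set w) - 1"
        using \<open>i \<in> set w\<close> by (subst card_Diff_singleton) auto
      ultimately have "card (set xs - {i}) \<le> k" using w uw(2) assms(2) by simp
      then show "xs \<in> ?L" using uw w assms(2) by (auto simp: B_def tree_walks_def)
    qed
  qed
  also have "\<dots> \<le> (k + card {i}) ^ (2 * k + 2) * n ^ k"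
    by (rule card_lists_few_values) (use assms in auto)
  finally show ?thesis by (simp add: B_def)
qed

text \<open>
  Dropping the disjointness condition turns the exact recursion into one that involves only the numbers of
  tree walks; the error is the number of overlapping pairs.
\<close>

lemma card_tree_walks_recursion:
  assumes "i < n"
  shows "\<bar>real (card (tree_walks n (Suc k) i)) -
    (\<Sum>l\<le>k. (\<Sum>j<n - i. real (card (tree_walks n l j))) * real (card (tree_walks n (k - l) i)))\<bar>
    \<le> real (Suc k * (k + 1) ^ (2 * k + 2)) * real n ^ k"
proof -
  define D where "D l j = {(u, w). u \<in> tree_walks n l j \<and> w \<in> tree_walks n (k - l) i \<and> set u \<inter> set w = {}}"
    for l j
  define B where "B l j = {(u, w). u \<in> tree_walks n l j \<and> w \<in> tree_walks n (k - l) i \<and> set u \<inter> set w \<noteq> {}}"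
    for l j
  have "card (tree_walks n l j) * card (tree_walks n (k - l) i) = card (D l j) + card (B l j)" for l j
  proof -
    have fin: "finite (tree_walks n l j \<times> tree_walks n (k - l) i)" by (simp add: finite_tree_walks)
    have "tree_walks n l j \<times> tree_walks n (k - l) i = D l j \<union> B l j" by (auto simp: D_def B_def)
    moreover have "finite (D l j)" "finite (B l j)"
      using fin by (rule finite_subset[rotated], force simp: D_def B_def)+
    moreover have "D l j \<inter> B l j = {}" by (auto simp: D_def B_def)
    ultimately show ?thesis by (metis card_Un_disjoint card_cartesian_product)
  qed
  then have "(\<Sum>l\<le>k. (\<Sum>j<n - i. card (tree_walks n l j)) * card (tree_walks n (k - l) i)) =
     card (tree_walks n (Suc k) i) + (\<Sum>l\<le>k. \<Sum>j<n - i. card (B l j))"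
    unfolding card_tree_walks_Suc[OF assms] D_def[symmetric]
    by (simp add: sum_distrib_right sum.distrib)
  moreover have "(\<Sum>l\<le>k. \<Sum>j<n - i. card (B l j)) \<le> (\<Sum>l\<le>k. (k + 1) ^ (2 * k + 2) * n ^ k)"
    unfolding B_def by (intro sum_mono card_overlapping_pairs assms) auto
  moreover have "\<dots> = Suc k * (k + 1) ^ (2 * k + 2) * n ^ k"
    by (simp only: sum_constant card_atMost of_nat_id mult.assoc)
  ultimately have "card (tree_walks n (Suc k) i) \<le>
      (\<Sum>l\<le>k. (\<Sum>j<n - i. card (tree_walks n l j)) * card (tree_walks n (k - l) i))"
    and "(\<Sum>l\<le>k. (\<Sum>j<n - i. card (tree_walks n l j)) * card (tree_walks n (k - l) i))
      \<le> card (tree_walks n (Suc k) i) + Suc k * (k + 1) ^ (2 * k + 2) * n ^ k"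
    by linarith+
  then have "real (card (tree_walks n (Suc k) i)) \<le>
      real (\<Sum>l\<le>k. (\<Sum>j<n - i. card (tree_walks n l j)) * card (tree_walks n (k - l) i))"
    and "real (\<Sum>l\<le>k. (\<Sum>j<n - i. card (tree_walks n l j)) * card (tree_walks n (k - l) i))
      \<le> real (card (tree_walks n (Suc k) i) + Suc k * (k + 1) ^ (2 * k + 2) * n ^ k)"
    by (simp_all only: of_nat_le_iff)
  then show ?thesis by simp
qed

text \<open>
  In the recursion the sum over the neighbours \<open>j\<close> of \<open>i\<close>, divided by \<open>n\<close>, is a Riemann sum, so by induction the normalised
  numbers satisfy the recursion of the Abel polynomials up to errors of order \<open>1/n\<close>.
\<close>

theorem card_tree_walks_asymptotics:
  "uniformly_near (\<lambda>n i. real (card (tree_walks n k i)) / real n ^ k) (\<lambda>n i. abel_poly k (1 - real i / real n))"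
proof (induction k rule: less_induct)
  case (less k)
  show ?case
  proof (cases k)
    case 0
    then show ?thesis by (auto simp: uniformly_near_def tree_walks_0 intro!: exI[of _ 0])
  next
    case (Suc m)
    define g where "g l n i = real (card (tree_walks n l i)) / real n ^ l" for l n i
    define h where "h l n i = abel_poly l (1 - real i / real n)" for l n i :: nat
    define H where "H l n i = - abel_poly (Suc l) (- (real (n - i) / real n))" for l n i :: nat
    have unit: "\<bar>real i / real n\<bar> \<le> 1" "\<bar>1 - real i / real n\<bar> \<le> 1" "\<bar>- (real (n - i) / real n)\<bar> \<le> 1"
      if "i < n" for i n :: nat
      using that by (auto simp: field_simps)
    have gh: "uniformly_near (g l) (h l)" if "l \<le> m" for l
      using less.IH[of l] that Suc unfolding g_def h_def by simp
    have avg: "uniformly_near (\<lambda>n i. (\<Sum>j<n - i. g l n j) / real n) (H l)" if "l \<le> m" for l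
    proof (rule uniformly_near_trans[OF uniformly_near_average[OF gh[OF that]]])
      obtain D where D: "\<And>n J. 0 < n \<Longrightarrow> J \<le> n \<Longrightarrow>
         \<bar>(\<Sum>j<J. abel_poly l (1 - real j / real n)) / real n + abel_poly (Suc l) (- (real J / real n))\<bar>
         \<le> D / real n"
        using abel_poly_Riemann_sum by blast
      show "uniformly_near (\<lambda>n i. (\<Sum>j<n - i. h l n j) / real n) (H l)"
        unfolding uniformly_near_def h_def H_def
      proof (intro exI[of _ D] allI impI)
        fix n i :: nat assume "i < n"
        then show "\<bar>(\<Sum>j<n - i. abel_poly l (1 - real j / real n)) / real n
            - - abel_poly (Suc l) (- (real (n - i) / real n))\<bar> \<le> D / real n"
          using D[of n "n - i"] by simp
      qed
    qed
    have "\<forall>l. \<exists>K. \<forall>x. \<bar>x\<bar> \<le> 1 \<longrightarrow> \<bar>abel_poly l x\<bar> \<le> K"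
      using abel_poly_bounded by blast
    from choice[OF this] obtain K where K: "\<And>l x. \<bar>x\<bar> \<le> 1 \<Longrightarrow> \<bar>abel_poly l x\<bar> \<le> K l"
      by blast
    have prod: "uniformly_near (\<lambda>n i. (\<Sum>j<n - i. g l n j) / real n * g (m - l) n i) (\<lambda>n i. H l n i * h (m - l) n i)"
      if "l \<le> m" for l
    proof (rule uniformly_near_mult[OF avg[OF that] gh])
      show "\<bar>H l n i\<bar> \<le> K (Suc l)" if "i < n" for n i
        using K[OF unit(3)[OF that], of "Suc l"] by (simp add: H_def)
      show "\<bar>h (m - l) n i\<bar> \<le> K (m - l)" if "i < n" for n i
        using K[OF unit(2)[OF that], of "m - l"] by (simp add: h_def)
    qed simp
    have n2: "uniformly_near (\<lambda>n i. \<Sum>l\<le>m. (\<Sum>j<n - i. g l n j) / real n * g (m - l) n i)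
        (\<lambda>n i. \<Sum>l\<le>m. H l n i * h (m - l) n i)"
      by (intro uniformly_near_sum prod) auto
    have n3: "uniformly_near (\<lambda>n i. \<Sum>l\<le>m. H l n i * h (m - l) n i) (h k)"
    proof -
      have "(\<Sum>l\<le>m. H l n i * h (m - l) n i) = h k n i" if "i < n" for n i
      proof -
        have "real (n - i) / real n = 1 - real i / real n" using that by (simp add: of_nat_diff diff_divide_distrib)
        then show ?thesis unfolding H_def h_def Suc abel_poly_recursion[of m] by simp
      qed
      then show ?thesis unfolding uniformly_near_def by (intro exI[of _ 0]) auto
    qed
    have n1: "uniformly_near (g k) (\<lambda>n i. \<Sum>l\<le>m. (\<Sum>j<n - i. g l n j) / real n * g (m - l) n i)"
    proof -
      define C where "C = real (Suc m * (m + 1) ^ (2 * m + 2))"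
      have "\<bar>g k n i - (\<Sum>l\<le>m. (\<Sum>j<n - i. g l n j) / real n * g (m - l) n i)\<bar> \<le> C / real n"
        if i: "i < n" for n i
      proof -
        let ?t = "\<lambda>l i. real (card (tree_walks n l i))"
        have "(\<Sum>j<n - i. g l n j) / real n * g (m - l) n i = (\<Sum>j<n - i. ?t l j) * ?t (m - l) i / real n ^ k"
          if "l \<le> m" for l
        proof -
          have "real n ^ k = real n ^ l * real n * real n ^ (m - l)"
            using that Suc by (simp flip: power_Suc2 power_add)
          then show ?thesis by (simp add: g_def sum_divide_distrib[symmetric])
        qed
        then have "(\<Sum>l\<le>m. (\<Sum>j<n - i. g l n j) / real n * g (m - l) n i) =
            (\<Sum>l\<le>m. (\<Sum>j<n - i. ?t l j) * ?t (m - l) i) / real n ^ k"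
          by (simp add: sum_divide_distrib)
        then have "\<bar>g k n i - (\<Sum>l\<le>m. (\<Sum>j<n - i. g l n j) / real n * g (m - l) n i)\<bar> =
           \<bar>?t k i - (\<Sum>l\<le>m. (\<Sum>j<n - i. ?t l j) * ?t (m - l) i)\<bar> / real n ^ k"
          by (simp add: g_def diff_divide_distrib[symmetric])
        also have "\<dots> \<le> C * real n ^ m / real n ^ k"
          using card_tree_walks_recursion[OF i, of m] unfolding Suc C_def
          by (intro divide_right_mono) auto
        also have "\<dots> = C / real n" using i Suc by simp
        finally show ?thesis .
      qed
      then show ?thesis unfolding uniformly_near_def by blast
    qed
    have "uniformly_near (g k) (h k)" by (rule uniformly_near_trans[OF uniformly_near_trans[OF n1 n2] n3])
    then show ?thesis unfolding g_def h_def .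
  qed
qed

text \<open>
  The Riemann sum of \<open>A\<^sub>k(1 - i/n)\<close> over the whole unit interval tends to \<open>- A\<^sub>k\<^sub>+\<^sub>1(-1)\<close>.
\<close>

theorem card_tree_walks_limit:
  "(\<lambda>n. (\<Sum>i<n. real (card (tree_walks n k i))) / real n ^ (k + 1)) \<longlonglongrightarrow> real k ^ k / fact (k + 1)"
proof -
  obtain C where C: "\<And>n i. i < n \<Longrightarrow>
      \<bar>real (card (tree_walks n k i)) / real n ^ k - abel_poly k (1 - real i / real n)\<bar> \<le> C / real n"
    using card_tree_walks_asymptotics[of k] unfolding uniformly_near_def by blast
  obtain D where D: "\<And>n J. 0 < n \<Longrightarrow> J \<le> n \<Longrightarrow>
      \<bar>(\<Sum>j<J. abel_poly k (1 - real j / real n)) / real n + abel_poly (Suc k) (- (real J / real n))\<bar>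
       \<le> D / real n"
    using abel_poly_Riemann_sum by blast
  have "\<bar>(\<Sum>i<n. real (card (tree_walks n k i))) / real n ^ (k + 1) - real k ^ k / fact (k + 1)\<bar>
     \<le> (C + D) / real n" if n: "n > 0" for n
  proof -
    let ?g = "\<lambda>i. real (card (tree_walks n k i)) / real n ^ k" and ?h = "\<lambda>i. abel_poly k (1 - real i / real n)"
    have "\<bar>(\<Sum>i<n. ?g i) - (\<Sum>i<n. ?h i)\<bar> \<le> (\<Sum>i<n. \<bar>?g i - ?h i\<bar>)"
      by (simp add: sum_subtractf[symmetric])
    also have "\<dots> \<le> (\<Sum>i<n. C / real n)" by (intro sum_mono C) auto
    also have "\<dots> = C" using n by simp
    finally have "\<bar>(\<Sum>i<n. ?g i) - (\<Sum>i<n. ?h i)\<bar> / real n \<le> C / real n"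
      by (rule divide_right_mono) simp
    then have "\<bar>(\<Sum>i<n. ?g i) / real n - (\<Sum>i<n. ?h i) / real n\<bar> \<le> C / real n"
      by (simp add: diff_divide_distrib[symmetric])
    moreover have "\<bar>(\<Sum>i<n. ?h i) / real n - real k ^ k / fact (k + 1)\<bar> \<le> D / real n"
      using D[OF n, of n] abel_poly_at_minus_1[of k] n by simp
    moreover have "(\<Sum>i<n. ?g i) / real n = (\<Sum>i<n. real (card (tree_walks n k i))) / real n ^ (k + 1)"
      by (simp add: sum_divide_distrib[symmetric])
    ultimately show ?thesis by (simp add: add_divide_distrib)
  qed
  then have "eventually (\<lambda>n. norm ((\<Sum>i<n. real (card (tree_walks n k i))) / real n ^ (k + 1) - real k ^ k / fact (k + 1))
     \<le> (C + D) / real n) sequentially"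
    by (intro eventually_mono[OF eventually_gt_at_top[of 0]]) auto
  moreover have "(\<lambda>n. (C + D) / real n) \<longlonglongrightarrow> 0" by (rule lim_const_over_n)
  ultimately show ?thesis by (rule Lim_null_comparison[THEN LIM_zero_cancel])
qed

section \<open>Moments of sums over closed walks\<close>

lemma prod_list_eq_prod_count:
  fixes g :: "'a \<Rightarrow> 'b :: comm_monoid_mult"
  assumes "finite F" "set es \<subseteq> F"
  shows "(\<Prod>e\<leftarrow>es. g e) = (\<Prod>e\<in>F. g e ^ count_list es e)"
  using assms(2)
proof (induction es)
  case (Cons a es)
  have "(\<Prod>e\<in>F. g e ^ count_list (a # es) e) = (\<Prod>e\<in>F. g e ^ count_list es e * (if e = a then g e else 1))"
    by (intro prod.cong) (auto simp: mult.commute)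
  also have "\<dots> = (\<Prod>e\<in>F. g e ^ count_list es e) * g a"
    using Cons.prems assms(1) by (simp add: prod.distrib)
  finally show ?case using Cons by (simp add: mult.commute)
qed simp

text \<open>
  The expectation of \<open>\<Sum>n. (D n)\<^sup>2\<close> is finite, so the series converges almost surely and its terms tend to 0.
\<close>

lemma (in prob_space) AE_tendsto_0_of_square_summable:
  fixes D :: "nat \<Rightarrow> 'a \<Rightarrow> real"
  assumes D: "\<And>n. integrable M (\<lambda>\<omega>. (D n \<omega>)\<^sup>2)"
    and bound: "\<And>n. expectation (\<lambda>\<omega>. (D n \<omega>)\<^sup>2) \<le> b n" and b: "summable b"
  shows "AE \<omega> in M. (\<lambda>n. D n \<omega>) \<longlonglongrightarrow> 0"
proof -
  have meas: "(\<lambda>\<omega>. ennreal ((D n \<omega>)\<^sup>2)) \<in> borel_measurable M" for n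
    using borel_measurable_integrable[OF D] by simp
  have b0: "b n \<ge> 0" for n
  proof -
    have "0 \<le> expectation (\<lambda>\<omega>. (D n \<omega>)\<^sup>2)" by simp
    also have "\<dots> \<le> b n" by (rule bound)
    finally show ?thesis .
  qed
  have "(\<integral>\<^sup>+\<omega>. (\<Sum>n. ennreal ((D n \<omega>)\<^sup>2)) \<partial>M) = (\<Sum>n. \<integral>\<^sup>+\<omega>. ennreal ((D n \<omega>)\<^sup>2) \<partial>M)"
    by (rule nn_integral_suminf[OF meas])
  also have "\<dots> = (\<Sum>n. ennreal (expectation (\<lambda>\<omega>. (D n \<omega>)\<^sup>2)))"
    by (intro suminf_cong nn_integral_eq_integral D) auto
  also have "\<dots> \<le> (\<Sum>n. ennreal (b n))"
    by (intro suminf_le ennreal_leI bound summableI)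
  also have "\<dots> = ennreal (\<Sum>n. b n)" by (rule suminf_ennreal2[OF b0 b])
  also have "\<dots> < \<infinity>" by simp
  finally have fin: "(\<integral>\<^sup>+\<omega>. (\<Sum>n. ennreal ((D n \<omega>)\<^sup>2)) \<partial>M) \<noteq> \<infinity>" by simp
  have "AE \<omega> in M. (\<Sum>n. ennreal ((D n \<omega>)\<^sup>2)) \<noteq> \<infinity>"
    by (rule nn_integral_PInf_AE[OF _ fin]) (intro borel_measurable_suminf_order meas)
  then show ?thesis
  proof eventually_elim
    case (elim \<omega>)
    then have "summable (\<lambda>n. (D n \<omega>)\<^sup>2)" by (intro summable_suminf_not_top) auto
    then have "(\<lambda>n. (D n \<omega>)\<^sup>2) \<longlonglongrightarrow> 0" by (rule summable_LIMSEQ_zero)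
    then show ?case by (simp add: power_tendsto_0_iff)
  qed
qed

text \<open>
  Entries are indexed by the sorted pairs that occur in \<open>walk_edges\<close>, with both indices starting at 0.
\<close>

locale bounded_array = prob_space +
  fixes y :: "nat \<times> nat \<Rightarrow> 'a \<Rightarrow> real" and C :: real
  assumes indep: "indep_vars (\<lambda>_. borel) y {(a, b). a \<le> b}"
    and mean: "a \<le> b \<Longrightarrow> expectation (y (a, b)) = 0"
    and second_moment: "a \<le> b \<Longrightarrow> expectation (\<lambda>\<omega>. (y (a, b) \<omega>)\<^sup>2) = 1"
    and bounded: "a \<le> b \<Longrightarrow> AE \<omega> in M. \<bar>y (a, b) \<omega>\<bar> \<le> C"
    and C_ge_1: "1 \<le> C"
begin

abbreviation edges :: "(nat \<times> nat) set" where "edges \<equiv> {(a, b). a \<le> b}"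

definition word :: "(nat \<times> nat) list \<Rightarrow> 'a \<Rightarrow> real" where
  "word es \<omega> = (\<Prod>e\<leftarrow>es. y e \<omega>)"

lemma word_append: "word (es @ fs) \<omega> = word es \<omega> * word fs \<omega>"
  by (simp add: word_def)

lemma set_walk_edges_edges: "set (walk_edges xs) \<subseteq> edges"
  using walk_edges_le by auto

lemma entry_measurable: "e \<in> edges \<Longrightarrow> y e \<in> borel_measurable M"
  using indep unfolding indep_vars_def by auto

lemma entry_power:
  assumes e: "e \<in> edges"
  shows "integrable M (\<lambda>\<omega>. y e \<omega> ^ m)" and "\<bar>expectation (\<lambda>\<omega>. y e \<omega> ^ m)\<bar> \<le> C ^ m"
proof -
  have "AE \<omega> in M. \<bar>y e \<omega>\<bar> \<le> C" using bounded[of "fst e" "snd e"] e by auto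
  then have AE: "AE \<omega> in M. norm (y e \<omega> ^ m) \<le> C ^ m"
    by eventually_elim (simp add: power_abs power_mono)
  show int: "integrable M (\<lambda>\<omega>. y e \<omega> ^ m)"
    by (rule integrable_const_bound[OF AE]) (use entry_measurable[OF e] in measurable)
  have "\<bar>expectation (\<lambda>\<omega>. y e \<omega> ^ m)\<bar> \<le> expectation (\<lambda>\<omega>. \<bar>y e \<omega> ^ m\<bar>)" by (rule integral_abs_bound)
  also have "\<dots> \<le> expectation (\<lambda>\<omega>. C ^ m)"
    using AE int by (intro integral_mono_AE) auto
  finally show "\<bar>expectation (\<lambda>\<omega>. y e \<omega> ^ m)\<bar> \<le> C ^ m" by (simp add: prob_space)
qed

text \<open>
  Grouping equal entries turns the product into a product of powers of distinct, hence independent, entries.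
  The finite set \<open>F\<close> may be larger than the set of entries that occur, so that several words can be compared.
\<close>

lemma word_expectation:
  assumes F: "finite F" "set es \<subseteq> F" "F \<subseteq> edges"
  shows "integrable M (word es)"
    and "expectation (word es) = (\<Prod>e\<in>F. expectation (\<lambda>\<omega>. y e \<omega> ^ count_list es e))"
proof -
  have eq: "word es = (\<lambda>\<omega>. \<Prod>e\<in>F. y e \<omega> ^ count_list es e)"
    by (rule ext) (simp add: word_def prod_list_eq_prod_count[OF F(1,2)])
  have ind: "indep_vars (\<lambda>_. borel) (\<lambda>e \<omega>. y e \<omega> ^ count_list es e) F"
    by (rule indep_vars_compose2[OF indep_vars_subset[OF indep F(3)]]) auto
  have int: "integrable M (\<lambda>\<omega>. y e \<omega> ^ count_list es e)" if "e \<in> F" for e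
    using entry_power F(3) that by blast
  show "integrable M (word es)" unfolding eq by (rule indep_vars_integrable[OF F(1) ind int])
  show "expectation (word es) = (\<Prod>e\<in>F. expectation (\<lambda>\<omega>. y e \<omega> ^ count_list es e))"
    unfolding eq by (rule indep_vars_lebesgue_integral[OF F(1) ind int])
qed

lemma word_integrable: "set es \<subseteq> edges \<Longrightarrow> integrable M (word es)"
  using word_expectation(1)[of "set es" es] by simp

lemma word_expectation_bound:
  assumes "set es \<subseteq> edges" shows "\<bar>expectation (word es)\<bar> \<le> C ^ length es"
proof -
  have "\<bar>expectation (word es)\<bar> = (\<Prod>e\<in>set es. \<bar>expectation (\<lambda>\<omega>. y e \<omega> ^ count_list es e)\<bar>)"
    using word_expectation(2)[of "set es" es] assms by (simp add: abs_prod)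
  also have "\<dots> \<le> (\<Prod>e\<in>set es. C ^ count_list es e)"
    using assms by (intro prod_mono) (auto intro!: entry_power)
  also have "\<dots> = C ^ length es" by (simp add: power_sum[symmetric] sum_count_list)
  finally show ?thesis .
qed

lemma word_expectation_single:
  assumes "set es \<subseteq> edges" "e \<in> set es" "count_list es e = 1"
  shows "expectation (word es) = 0"
proof -
  have "expectation (\<lambda>\<omega>. y e \<omega> ^ count_list es e) = 0"
    using mean[of "fst e" "snd e"] assms by auto
  then have "(\<Prod>e\<in>set es. expectation (\<lambda>\<omega>. y e \<omega> ^ count_list es e)) = 0"
    using assms(2) by (intro prod_zero bexI[of _ e]) auto
  then show ?thesis using word_expectation(2)[of "set es" es] assms by simp
qed

lemma word_expectation_pairs:
  assumes "set es \<subseteq> edges" "\<forall>e\<in>set es. count_list es e = 2"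
  shows "expectation (word es) = 1"
proof -
  have "(\<Prod>e\<in>set es. expectation (\<lambda>\<omega>. y e \<omega> ^ count_list es e)) = 1"
  proof (intro prod.neutral ballI)
    fix e assume "e \<in> set es"
    then show "expectation (\<lambda>\<omega>. y e \<omega> ^ count_list es e) = 1"
      using assms second_moment[of "fst e" "snd e"] by auto
  qed
  then show ?thesis using word_expectation(2)[of "set es" es] assms by simp
qed

lemma word_covariance_disjoint:
  assumes "set es \<subseteq> edges" "set fs \<subseteq> edges" "set es \<inter> set fs = {}"
  shows "expectation (word (es @ fs)) = expectation (word es) * expectation (word fs)"
proof -
  have "expectation (word (es @ fs)) = (\<Prod>e\<in>set es \<union> set fs. expectation (\<lambda>\<omega>. y e \<omega> ^ count_list (es @ fs) e))"
    using assms by (intro word_expectation(2)) auto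
  also have "\<dots> = (\<Prod>e\<in>set es. expectation (\<lambda>\<omega>. y e \<omega> ^ count_list (es @ fs) e))
      * (\<Prod>e\<in>set fs. expectation (\<lambda>\<omega>. y e \<omega> ^ count_list (es @ fs) e))"
    using assms by (intro prod.union_disjoint) auto
  also have "(\<Prod>e\<in>set es. expectation (\<lambda>\<omega>. y e \<omega> ^ count_list (es @ fs) e)) = expectation (word es)"
  proof (subst word_expectation(2)[of "set es"])
    show "(\<Prod>e\<in>set es. expectation (\<lambda>\<omega>. y e \<omega> ^ count_list (es @ fs) e)) =
       (\<Prod>e\<in>set es. expectation (\<lambda>\<omega>. y e \<omega> ^ count_list es e))"
    proof (intro prod.cong refl)
      fix e assume "e \<in> set es"
      then have "e \<notin> set fs" using assms(3) by blast
      then have "count_list fs e = 0" by (simp add: count_list_0_iff)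
      then show "expectation (\<lambda>\<omega>. y e \<omega> ^ count_list (es @ fs) e) = expectation (\<lambda>\<omega>. y e \<omega> ^ count_list es e)"
        by simp
    qed
  qed (use assms in auto)
  also have "(\<Prod>e\<in>set fs. expectation (\<lambda>\<omega>. y e \<omega> ^ count_list (es @ fs) e)) = expectation (word fs)"
  proof (subst word_expectation(2)[of "set fs"])
    show "(\<Prod>e\<in>set fs. expectation (\<lambda>\<omega>. y e \<omega> ^ count_list (es @ fs) e)) =
       (\<Prod>e\<in>set fs. expectation (\<lambda>\<omega>. y e \<omega> ^ count_list fs e))"
    proof (intro prod.cong refl)
      fix e assume "e \<in> set fs"
      then have "e \<notin> set es" using assms(3) by blast
      then have "count_list es e = 0" by (simp add: count_list_0_iff)
      then show "expectation (\<lambda>\<omega>. y e \<omega> ^ count_list (es @ fs) e) = expectation (\<lambda>\<omega>. y e \<omega> ^ count_list fs e)"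
        by simp
    qed
  qed (use assms in auto)
  finally show ?thesis .
qed

definition closed_walks :: "nat \<Rightarrow> nat \<Rightarrow> nat list set" where
  "closed_walks n m = {xs. length xs = Suc m \<and> hd xs = last xs \<and> set xs \<subseteq> {..<n} \<and>
     (\<forall>(a, b)\<in>set (walk_edges xs). a + b < n)}"

lemma finite_closed_walks: "finite (closed_walks n m)"
  by (rule finite_subset[OF _ finite_few_values[of "Suc m" n "\<lambda>_. True"]]) (auto simp: closed_walks_def)

definition walk_sum :: "nat \<Rightarrow> nat \<Rightarrow> 'a \<Rightarrow> real" where
  "walk_sum n m \<omega> = (\<Sum>xs\<in>closed_walks n m. word (walk_edges xs) \<omega>)"

lemma integrable_word_walk_edges: "integrable M (word (walk_edges xs))"
  by (rule word_integrable[OF set_walk_edges_edges])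

lemma integrable_walk_sum: "integrable M (walk_sum n m)"
  unfolding walk_sum_def[abs_def] by (intro Bochner_Integration.integrable_sum integrable_word_walk_edges)

lemma expectation_walk_sum:
  "expectation (walk_sum n m) = (\<Sum>xs\<in>closed_walks n m. expectation (word (walk_edges xs)))"
  unfolding walk_sum_def[abs_def] by (intro Bochner_Integration.integral_sum integrable_word_walk_edges)

definition paired_walks :: "nat \<Rightarrow> nat \<Rightarrow> nat list set" where
  "paired_walks n m = {xs \<in> closed_walks n m. \<forall>e\<in>set (walk_edges xs). 2 \<le> count_list (walk_edges xs) e}"

lemma finite_paired_walks: "finite (paired_walks n m)"
  using finite_closed_walks by (simp add: paired_walks_def)

lemma expectation_walk_sum_paired:
  "expectation (walk_sum n m) = (\<Sum>xs\<in>paired_walks n m. expectation (word (walk_edges xs)))"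
  unfolding expectation_walk_sum
proof (rule sum.mono_neutral_right[OF finite_closed_walks])
  show "\<forall>xs\<in>closed_walks n m - paired_walks n m. expectation (word (walk_edges xs)) = 0"
  proof
    fix xs assume "xs \<in> closed_walks n m - paired_walks n m"
    then obtain e where e: "e \<in> set (walk_edges xs)" "\<not> 2 \<le> count_list (walk_edges xs) e"
      by (auto simp: paired_walks_def)
    moreover have "count_list (walk_edges xs) e \<noteq> 0" using e by (simp add: count_list_0_iff)
    ultimately show "expectation (word (walk_edges xs)) = 0"
      by (intro word_expectation_single[OF set_walk_edges_edges, of e]) auto
  qed
qed (auto simp: paired_walks_def)

lemma card_vertices_paired:
  assumes "xs \<in> paired_walks n m" shows "card (set xs) \<le> m div 2 + 1"
proof -
  have "length (walk_edges xs) = m" "xs \<noteq> []"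
    using assms by (auto simp: paired_walks_def closed_walks_def length_walk_edges)
  then show ?thesis
    using card_vertices_le[of xs] card_edges_le[of "walk_edges xs"] assms by (auto simp: paired_walks_def)
qed

text \<open>
  Each walk contributes at most \<open>C\<^sup>m\<close>, and there are \<open>O(n\<^sup>r)\<close> walks with at most \<open>r\<close> vertices.
\<close>

lemma sum_few_vertices_bound:
  assumes n: "n > 0" and S: "S \<subseteq> {xs \<in> closed_walks n m. card (set xs) \<le> r}"
  shows "\<bar>\<Sum>xs\<in>S. expectation (word (walk_edges xs))\<bar> \<le> C ^ m * real (r ^ Suc m) * real n ^ r"
proof -
  have "card S \<le> card {xs. length xs = Suc m \<and> set xs \<subseteq> {..<n} \<and> card (set xs - {}) \<le> r}"
    using S by (intro card_mono finite_few_values) (auto simp: closed_walks_def)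
  also have "\<dots> \<le> (r + card ({} :: nat set)) ^ Suc m * n ^ r" by (rule card_lists_few_values) (use n in auto)
  finally have "card S \<le> r ^ Suc m * n ^ r" by simp
  then have cS: "real (card S) \<le> real (r ^ Suc m * n ^ r)" by (rule of_nat_mono)
  have "\<bar>\<Sum>xs\<in>S. expectation (word (walk_edges xs))\<bar> \<le> (\<Sum>xs\<in>S. \<bar>expectation (word (walk_edges xs))\<bar>)"
    by (rule sum_abs)
  also have "\<dots> \<le> (\<Sum>xs\<in>S. C ^ m)"
  proof (rule sum_mono)
    fix xs assume "xs \<in> S"
    then have "length (walk_edges xs) = m" using S by (auto simp: closed_walks_def length_walk_edges)
    then show "\<bar>expectation (word (walk_edges xs))\<bar> \<le> C ^ m"
      using word_expectation_bound[OF set_walk_edges_edges, of xs] by simp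
  qed
  also have "\<dots> = C ^ m * real (card S)" by simp
  also have "\<dots> \<le> C ^ m * real (r ^ Suc m * n ^ r)"
    using cS C_ge_1 by (intro mult_left_mono) auto
  finally show ?thesis by (simp add: mult.assoc)
qed

lemma expectation_odd:
  assumes "n > 0"
  shows "\<bar>expectation (walk_sum n (2 * k + 1))\<bar> \<le> C ^ (2 * k + 1) * real ((k + 1) ^ (2 * k + 2)) * real n ^ (k + 1)"
proof -
  have "paired_walks n (2 * k + 1) \<subseteq> {xs \<in> closed_walks n (2 * k + 1). card (set xs) \<le> k + 1}"
    using card_vertices_paired[of _ n "2 * k + 1"] by (auto simp: paired_walks_def)
  from sum_few_vertices_bound[OF assms this] show ?thesis
    unfolding expectation_walk_sum_paired by simp
qed

text \<open>
  Among the walks that use every edge at least twice, those with the maximal number \<open>k + 1\<close> of vertices are the tree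
  walks, with expectation 1 each. The others have at most \<open>k\<close> vertices.
\<close>

lemma expectation_even:
  assumes "n > 0"
  shows "\<bar>expectation (walk_sum n (2 * k)) - (\<Sum>i<n. real (card (tree_walks n k i)))\<bar>
    \<le> C ^ (2 * k) * real (k ^ (2 * k + 1)) * real n ^ k"
proof -
  let ?T = "\<Union>i<n. tree_walks n k i"
  have T: "?T \<subseteq> paired_walks n (2 * k)"
    by (auto simp: tree_walks_def paired_walks_def closed_walks_def)
  have rest: "paired_walks n (2 * k) - ?T \<subseteq> {xs \<in> closed_walks n (2 * k). card (set xs) \<le> k}"
  proof
    fix xs assume xs: "xs \<in> paired_walks n (2 * k) - ?T"
    have "card (set xs) \<noteq> k + 1"
    proof
      assume "card (set xs) = k + 1"
      moreover have "hd xs \<in> {..<n}"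
      proof -
        have "xs \<noteq> []" "set xs \<subseteq> {..<n}" using xs by (auto simp: paired_walks_def closed_walks_def)
        then show ?thesis using hd_in_set[of xs] by blast
      qed
      ultimately have "xs \<in> tree_walks n k (hd xs)" "hd xs < n"
        using xs by (auto simp: paired_walks_def closed_walks_def tree_walks_def)
      then show False using xs by auto
    qed
    then show "xs \<in> {xs \<in> closed_walks n (2 * k). card (set xs) \<le> k}"
      using xs card_vertices_paired[of xs n "2 * k"] by (auto simp: paired_walks_def)
  qed
  have "(\<Sum>xs\<in>?T. expectation (word (walk_edges xs))) = (\<Sum>xs\<in>?T. 1)"
  proof (rule sum.cong[OF refl])
    fix xs assume "xs \<in> ?T"
    then obtain i where "xs \<in> tree_walks n k i" by auto
    then show "expectation (word (walk_edges xs)) = 1"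
      using tree_walk_counts(2)[of xs k]
      by (intro word_expectation_pairs[OF set_walk_edges_edges]) (auto simp: tree_walks_def)
  qed
  also have "\<dots> = real (card ?T)" by simp
  also have "card ?T = (\<Sum>i<n. card (tree_walks n k i))"
  proof (rule card_UN_disjoint)
    show "\<forall>i\<in>{..<n}. \<forall>j\<in>{..<n}. i \<noteq> j \<longrightarrow> tree_walks n k i \<inter> tree_walks n k j = {}"
      by (auto simp: tree_walks_def)
  qed (simp_all add: finite_tree_walks)
  finally have "(\<Sum>xs\<in>?T. expectation (word (walk_edges xs))) = (\<Sum>i<n. real (card (tree_walks n k i)))" by simp
  moreover have "expectation (walk_sum n (2 * k)) = (\<Sum>xs\<in>paired_walks n (2 * k) - ?T. expectation (word (walk_edges xs)))
      + (\<Sum>xs\<in>?T. expectation (word (walk_edges xs)))"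
    unfolding expectation_walk_sum_paired by (rule sum.subset_diff[OF T finite_paired_walks])
  ultimately show ?thesis
    using sum_few_vertices_bound[OF assms rest] by simp
qed

definition walk_cov :: "nat list \<Rightarrow> nat list \<Rightarrow> real" where
  "walk_cov xs ys = expectation (word (walk_edges xs @ walk_edges ys)) - expectation (word (walk_edges xs)) * expectation (word (walk_edges ys))"

text \<open>
  Walks without a common edge contribute independent products. With a common edge, the two walks can have more than \<open>m\<close> vertices
  only if some edge is used once in total, and then both terms of the covariance vanish.
\<close>

lemma walk_cov_eq_0:
  assumes xs: "xs \<in> closed_walks n m" and ys: "ys \<in> closed_walks n m"
    and many: "card (set xs \<union> set ys) > m"
  shows "walk_cov xs ys = 0"
proof (cases "set (walk_edges xs) \<inter> set (walk_edges ys) = {}")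
  case True
  then show ?thesis using word_covariance_disjoint[OF set_walk_edges_edges set_walk_edges_edges, of xs ys]
    by (simp add: walk_cov_def)
next
  case False
  then obtain e where e: "e \<in> set (walk_edges xs)" "e \<in> set (walk_edges ys)" by auto
  let ?es = "walk_edges xs @ walk_edges ys"
  have "\<not> (\<forall>f\<in>set ?es. 2 \<le> count_list ?es f)"
    using card_vertices_two_closed_walks[of xs ys m e] xs ys e many by (auto simp: closed_walks_def)
  then obtain f where f: "f \<in> set ?es" "\<not> 2 \<le> count_list ?es f" by blast
  have "count_list ?es f \<noteq> 0" using f(1) by (simp only: count_list_0_iff not_not)
  with f(2) have one: "count_list ?es f = 1" by linarith
  have E: "set ?es \<subseteq> edges" using set_walk_edges_edges[of xs] set_walk_edges_edges[of ys] by auto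
  have "expectation (word ?es) = 0" by (rule word_expectation_single[OF E f(1) one])
  moreover have "expectation (word (walk_edges xs)) * expectation (word (walk_edges ys)) = 0"
  proof (cases "f \<in> set (walk_edges xs)")
    case True
    then have "count_list (walk_edges xs) f \<noteq> 0" by (simp add: count_list_0_iff)
    with one have "count_list (walk_edges xs) f = 1" by simp
    then show ?thesis using word_expectation_single[OF set_walk_edges_edges True] by simp
  next
    case False
    then have "f \<in> set (walk_edges ys)" "count_list (walk_edges xs) f = 0" using f by (auto simp: count_list_0_iff)
    with one show ?thesis using word_expectation_single[OF set_walk_edges_edges, of f ys] by simp
  qed
  ultimately show ?thesis by (simp add: walk_cov_def)
qed

lemma walk_cov_bound:
  assumes "xs \<in> closed_walks n m" "ys \<in> closed_walks n m"
  shows "\<bar>walk_cov xs ys\<bar> \<le> 2 * C ^ (2 * m)"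
proof -
  have l: "length (walk_edges xs) = m" "length (walk_edges ys) = m"
    using assms by (auto simp: closed_walks_def length_walk_edges)
  have E: "set (walk_edges xs @ walk_edges ys) \<subseteq> edges" using set_walk_edges_edges[of xs] set_walk_edges_edges[of ys] by auto
  have "\<bar>expectation (word (walk_edges xs @ walk_edges ys))\<bar> \<le> C ^ (2 * m)"
    using word_expectation_bound[OF E] l by (simp add: mult_2)
  moreover have "\<bar>expectation (word (walk_edges xs)) * expectation (word (walk_edges ys))\<bar> \<le> C ^ m * C ^ m"
    unfolding abs_mult
    using word_expectation_bound[OF set_walk_edges_edges, of xs] word_expectation_bound[OF set_walk_edges_edges, of ys] l C_ge_1
    by (intro mult_mono) auto
  moreover have "C ^ (2 * m) = C ^ m * C ^ m" by (simp add: mult_2 power_add)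
  ultimately show ?thesis unfolding walk_cov_def by linarith
qed

lemma square_walk_sum:
  "(walk_sum n m \<omega> - c)\<^sup>2 = (\<Sum>xs\<in>closed_walks n m. \<Sum>ys\<in>closed_walks n m. word (walk_edges xs @ walk_edges ys) \<omega>)
      - 2 * c * walk_sum n m \<omega> + c\<^sup>2"
proof -
  have "walk_sum n m \<omega> * walk_sum n m \<omega> =
      (\<Sum>xs\<in>closed_walks n m. \<Sum>ys\<in>closed_walks n m. word (walk_edges xs @ walk_edges ys) \<omega>)"
    unfolding walk_sum_def word_append by (rule sum_product)
  moreover have "(w - c)\<^sup>2 = w * w - 2 * c * w + c\<^sup>2" for w :: real
    by (simp add: power2_eq_square algebra_simps)
  ultimately show ?thesis by simp
qed

lemma integrable_square_walk_sum: "integrable M (\<lambda>\<omega>. (walk_sum n m \<omega> - c)\<^sup>2)"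
  unfolding square_walk_sum using set_walk_edges_edges
  by (intro Bochner_Integration.integrable_add Bochner_Integration.integrable_diff integrable_mult_right
      Bochner_Integration.integrable_sum integrable_walk_sum word_integrable integrable_const) auto

lemma variance_walk_sum:
  assumes n: "n > 0"
  shows "variance (walk_sum n m) \<le> 2 * C ^ (2 * m) * real (m ^ (2 * m + 2)) * real n ^ m"
proof -
  let ?W = "closed_walks n m"
  have int2: "integrable M (\<lambda>\<omega>. \<Sum>xs\<in>?W. \<Sum>ys\<in>?W. word (walk_edges xs @ walk_edges ys) \<omega>)"
    using set_walk_edges_edges by (intro Bochner_Integration.integrable_sum word_integrable) auto
  define c where "c = expectation (walk_sum n m)"
  have "variance (walk_sum n m) = expectation (\<lambda>\<omega>. \<Sum>xs\<in>?W. \<Sum>ys\<in>?W. word (walk_edges xs @ walk_edges ys) \<omega>) - 2 * c * c + c\<^sup>2"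
    unfolding c_def[symmetric] square_walk_sum
    using int2 integrable_walk_sum[of n m] by (simp add: prob_space c_def)
  also have "\<dots> = expectation (\<lambda>\<omega>. \<Sum>xs\<in>?W. \<Sum>ys\<in>?W. word (walk_edges xs @ walk_edges ys) \<omega>) - c * c"
    by (simp add: power2_eq_square)
  also have "expectation (\<lambda>\<omega>. \<Sum>xs\<in>?W. \<Sum>ys\<in>?W. word (walk_edges xs @ walk_edges ys) \<omega>) =
      (\<Sum>xs\<in>?W. \<Sum>ys\<in>?W. expectation (word (walk_edges xs @ walk_edges ys)))"
  proof -
    have int: "integrable M (word (walk_edges xs @ walk_edges ys))" for xs ys
      using set_walk_edges_edges by (intro word_integrable) auto
    show ?thesis
      by (subst Bochner_Integration.integral_sum)
         (intro Bochner_Integration.integrable_sum int,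
          intro sum.cong refl Bochner_Integration.integral_sum int)
  qed
  also have "c * c = (\<Sum>xs\<in>?W. \<Sum>ys\<in>?W. expectation (word (walk_edges xs)) * expectation (word (walk_edges ys)))"
    unfolding c_def expectation_walk_sum by (rule sum_product)
  also have "(\<Sum>xs\<in>?W. \<Sum>ys\<in>?W. expectation (word (walk_edges xs @ walk_edges ys))) - \<dots> = (\<Sum>xs\<in>?W. \<Sum>ys\<in>?W. walk_cov xs ys)"
    unfolding walk_cov_def by (simp add: sum_subtractf)
  also have "\<dots> = (\<Sum>(xs, ys)\<in>?W \<times> ?W. walk_cov xs ys)" by (rule sum.cartesian_product)
  also have "\<dots> = (\<Sum>(xs, ys)\<in>{(xs, ys). xs \<in> ?W \<and> ys \<in> ?W \<and> card (set xs \<union> set ys) \<le> m}. walk_cov xs ys)"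
  proof (rule sum.mono_neutral_right)
    show "\<forall>p\<in>?W \<times> ?W - {(xs, ys). xs \<in> ?W \<and> ys \<in> ?W \<and> card (set xs \<union> set ys) \<le> m}.
        (case p of (xs, ys) \<Rightarrow> walk_cov xs ys) = 0"
    proof
      fix p assume p: "p \<in> ?W \<times> ?W - {(xs, ys). xs \<in> ?W \<and> ys \<in> ?W \<and> card (set xs \<union> set ys) \<le> m}"
      obtain a b where ab: "p = (a, b)" by (rule prod.exhaust)
      have "a \<in> ?W" "b \<in> ?W" "m < card (set a \<union> set b)" using p ab by auto
      then show "(case p of (xs, ys) \<Rightarrow> walk_cov xs ys) = 0" using walk_cov_eq_0 ab by simp
    qed
  qed (auto simp: finite_closed_walks)
  also have "\<dots> \<le> (\<Sum>(xs, ys)\<in>{(xs, ys). xs \<in> ?W \<and> ys \<in> ?W \<and> card (set xs \<union> set ys) \<le> m}. 2 * C ^ (2 * m))"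
  proof (rule sum_mono)
    fix p assume "p \<in> {(xs, ys). xs \<in> ?W \<and> ys \<in> ?W \<and> card (set xs \<union> set ys) \<le> m}"
    then have "walk_cov (fst p) (snd p) \<le> 2 * C ^ (2 * m)"
      using order_trans[OF abs_ge_self walk_cov_bound[of "fst p" n m "snd p"]] by auto
    then show "(case p of (xs, ys) \<Rightarrow> walk_cov xs ys) \<le> (case p of (xs, ys) \<Rightarrow> 2 * C ^ (2 * m))"
      by (simp add: case_prod_unfold)
  qed
  also have "\<dots> = 2 * C ^ (2 * m) * real (card {(xs, ys). xs \<in> ?W \<and> ys \<in> ?W \<and> card (set xs \<union> set ys) \<le> m})"
    by (simp add: case_prod_unfold)
  also have "\<dots> \<le> 2 * C ^ (2 * m) * real (m ^ (2 * m + 2) * n ^ m)"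
  proof (intro mult_left_mono of_nat_mono)
    let ?P = "{(xs, ys). xs \<in> ?W \<and> ys \<in> ?W \<and> card (set xs \<union> set ys) \<le> m}"
    have "card ?P = card ((\<lambda>(xs, ys). xs @ ys) ` ?P)"
      by (rule card_image[symmetric], rule inj_onI) (auto simp: closed_walks_def)
    also have "\<dots> \<le> card {zs. length zs = 2 * m + 2 \<and> set zs \<subseteq> {..<n} \<and> card (set zs - {}) \<le> m}"
      by (intro card_mono finite_few_values) (auto simp: closed_walks_def)
    also have "\<dots> \<le> (m + card ({} :: nat set)) ^ (2 * m + 2) * n ^ m" by (rule card_lists_few_values) (use n in auto)
    finally show "card ?P \<le> m ^ (2 * m + 2) * n ^ m" by simp
  qed (use C_ge_1 in auto)
  finally show ?thesis by (simp add: mult.assoc)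
qed

text \<open>
  For \<open>m = 0\<close> the value is 1, by the convention \<open>0 ^ 0 = 1\<close>.
\<close>

definition moment_limit :: "nat \<Rightarrow> real" where
  "moment_limit m = (if even m then real (m div 2) ^ (m div 2) / fact (m div 2 + 1) else 0)"

lemma expectation_limit:
  "(\<lambda>n. expectation (walk_sum n m) / (real n * sqrt (real n) ^ m)) \<longlonglongrightarrow> moment_limit m"
proof (cases "even m")
  case True
  then obtain k where m: "m = 2 * k" by (rule evenE)
  define K where "K = C ^ (2 * k) * real (k ^ (2 * k + 1))"
  have sq: "real n * sqrt (real n) ^ m = real n ^ (k + 1)" for n by (simp add: m power_mult)
  have "eventually (\<lambda>n. norm (expectation (walk_sum n m) / real n ^ (k + 1)
      - (\<Sum>i<n. real (card (tree_walks n k i))) / real n ^ (k + 1)) \<le> K / real n) sequentially"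
    using eventually_gt_at_top[of 0]
  proof eventually_elim
    case (elim n)
    have "norm (expectation (walk_sum n m) / real n ^ (k + 1) - (\<Sum>i<n. real (card (tree_walks n k i))) / real n ^ (k + 1))
       = \<bar>expectation (walk_sum n m) - (\<Sum>i<n. real (card (tree_walks n k i)))\<bar> / real n ^ (k + 1)"
      by (simp flip: diff_divide_distrib)
    also have "\<dots> \<le> K * real n ^ k / real n ^ (k + 1)"
      unfolding K_def m by (intro divide_right_mono expectation_even elim) auto
    also have "\<dots> = K / real n" using elim by simp
    finally show ?case .
  qed
  moreover have "(\<lambda>n. K / real n) \<longlonglongrightarrow> 0" by (rule lim_const_over_n)
  ultimately have "(\<lambda>n. expectation (walk_sum n m) / real n ^ (k + 1) - (\<Sum>i<n. real (card (tree_walks n k i))) / real n ^ (k + 1)) \<longlonglongrightarrow> 0"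
    by (rule Lim_null_comparison)
  from tendsto_add[OF this card_tree_walks_limit[of k]]
  have "(\<lambda>n. expectation (walk_sum n m) / real n ^ (k + 1)) \<longlonglongrightarrow> real k ^ k / fact (k + 1)" by simp
  then show ?thesis unfolding sq using True by (simp add: moment_limit_def m)
next
  case False
  then obtain k where m: "m = 2 * k + 1" by (rule oddE)
  define K where "K = C ^ (2 * k + 1) * real ((k + 1) ^ (2 * k + 2))"
  have sq: "real n * sqrt (real n) ^ m = real n ^ (k + 1) * sqrt (real n)" for n by (simp add: m power_mult)
  have "eventually (\<lambda>n. norm (expectation (walk_sum n m) / (real n ^ (k + 1) * sqrt (real n))) \<le> K * inverse (sqrt (real n))) sequentially"
    using eventually_gt_at_top[of 0]
  proof eventually_elim
    case (elim n)
    have "norm (expectation (walk_sum n m) / (real n ^ (k + 1) * sqrt (real n)))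
        = \<bar>expectation (walk_sum n m)\<bar> / (real n ^ (k + 1) * sqrt (real n))" by (simp add: abs_mult)
    also have "\<dots> \<le> K * real n ^ (k + 1) / (real n ^ (k + 1) * sqrt (real n))"
      unfolding K_def m by (intro divide_right_mono expectation_odd elim) auto
    also have "\<dots> = K * inverse (sqrt (real n))" using elim by (simp add: field_simps)
    finally show ?case .
  qed
  moreover have "(\<lambda>n. K * inverse (sqrt (real n))) \<longlonglongrightarrow> 0"
    by (intro tendsto_mult_right_zero tendsto_inverse_0_at_top filterlim_compose[OF sqrt_at_top filterlim_real_sequentially])
  ultimately have "(\<lambda>n. expectation (walk_sum n m) / (real n ^ (k + 1) * sqrt (real n))) \<longlonglongrightarrow> 0"
    by (rule Lim_null_comparison)
  then show ?thesis unfolding sq using False by (simp add: moment_limit_def)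
qed

text \<open>
  The normalised sums have variance \<open>O(n\<^sup>-\<^sup>2)\<close>, which is summable. So they approach their expectations almost surely.
\<close>

theorem walk_sum_limit:
  "AE \<omega> in M. (\<lambda>n. walk_sum n m \<omega> / (real n * sqrt (real n) ^ m)) \<longlonglongrightarrow> moment_limit m"
proof -
  define s where "s n = real n * sqrt (real n) ^ m" for n
  define K where "K = 2 * C ^ (2 * m) * real (m ^ (2 * m + 2))"
  have "AE \<omega> in M. (\<lambda>n. (walk_sum (Suc n) m \<omega> - expectation (walk_sum (Suc n) m)) / s (Suc n)) \<longlonglongrightarrow> 0"
  proof (rule AE_tendsto_0_of_square_summable)
    show "integrable M (\<lambda>\<omega>. ((walk_sum (Suc n) m \<omega> - expectation (walk_sum (Suc n) m)) / s (Suc n))\<^sup>2)" for n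
      unfolding power_divide by (intro integrable_divide integrable_square_walk_sum)
    show "expectation (\<lambda>\<omega>. ((walk_sum (Suc n) m \<omega> - expectation (walk_sum (Suc n) m)) / s (Suc n))\<^sup>2)
        \<le> K * inverse (real (Suc n) ^ 2)" for n
    proof -
      have s2: "(s (Suc n))\<^sup>2 = real (Suc n) ^ 2 * real (Suc n) ^ m"
        unfolding s_def power_mult_distrib by (simp flip: power_mult add: mult.commute[of _ 2] power_mult del: of_nat_Suc)
      have "expectation (\<lambda>\<omega>. ((walk_sum (Suc n) m \<omega> - expectation (walk_sum (Suc n) m)) / s (Suc n))\<^sup>2)
          = variance (walk_sum (Suc n) m) / (s (Suc n))\<^sup>2"
        by (simp add: power_divide)
      also have "\<dots> \<le> K * real (Suc n) ^ m / (s (Suc n))\<^sup>2"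
        unfolding K_def by (intro divide_right_mono variance_walk_sum) auto
      also have "\<dots> = K * inverse (real (Suc n) ^ 2)" unfolding s2 by (simp add: divide_inverse del: of_nat_Suc)
      finally show ?thesis .
    qed
    show "summable (\<lambda>n. K * inverse (real (Suc n) ^ 2))"
      using inverse_power_summable[of 2, where ?'a = real] by (intro summable_mult) (subst summable_Suc_iff, simp)
  qed
  then show ?thesis
  proof eventually_elim
    case (elim \<omega>)
    then have "(\<lambda>n. (walk_sum n m \<omega> - expectation (walk_sum n m)) / s n) \<longlonglongrightarrow> 0"
      by (rule LIMSEQ_imp_Suc)
    from tendsto_add[OF this expectation_limit[of m, folded s_def]]
    show ?case by (simp add: s_def flip: add_divide_distrib)
  qed
qed

end

section \<open>Traces of powers as sums over walks\<close>

fun path_weight :: "(nat \<Rightarrow> nat \<Rightarrow> 'b :: comm_semiring_1) \<Rightarrow> nat list \<Rightarrow> 'b" where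
  "path_weight f (a # b # xs) = f a b * path_weight f (b # xs)"
| "path_weight f _ = 1"

lemma path_weight_snoc:
  "xs \<noteq> [] \<Longrightarrow> path_weight f (xs @ [b]) = path_weight f xs * f (last xs) b"
proof (induction xs)
  case (Cons a xs) then show ?case by (cases xs) (auto simp: mult.assoc)
qed simp

definition paths :: "nat \<Rightarrow> nat \<Rightarrow> nat \<Rightarrow> nat \<Rightarrow> nat list set" where
  "paths n m i j = {xs. length xs = Suc m \<and> hd xs = i \<and> last xs = j \<and> set xs \<subseteq> {..<n}}"

lemma finite_paths: "finite (paths n m i j)"
  by (rule finite_subset[OF _ finite_few_values[of "Suc m" n "\<lambda>_. True"]]) (auto simp: paths_def)

lemma paths_Suc:
  assumes "j < n"
  shows "paths n (Suc m) i j = (\<lambda>xs. xs @ [j]) ` (\<Union>l<n. paths n m i l)"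
proof
  show "paths n (Suc m) i j \<subseteq> (\<lambda>xs. xs @ [j]) ` (\<Union>l<n. paths n m i l)"
  proof
    fix xs assume xs: "xs \<in> paths n (Suc m) i j"
    then have "length xs = Suc (Suc m)" by (simp add: paths_def)
    then obtain zs where zs: "xs = zs @ [j]" "length zs = Suc m"
      using xs by (cases xs rule: rev_cases) (auto simp: paths_def)
    then have ne: "zs \<noteq> []" by auto
    then have "zs \<in> paths n m i (last zs)" using xs zs by (auto simp: paths_def)
    moreover have "last zs < n" using xs zs last_in_set[OF ne] by (auto simp: paths_def)
    ultimately show "xs \<in> (\<lambda>xs. xs @ [j]) ` (\<Union>l<n. paths n m i l)" using zs by auto
  qed
  show "(\<lambda>xs. xs @ [j]) ` (\<Union>l<n. paths n m i l) \<subseteq> paths n (Suc m) i j"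
  proof
    fix xs assume "xs \<in> (\<lambda>xs. xs @ [j]) ` (\<Union>l<n. paths n m i l)"
    then obtain l zs where zs: "zs \<in> paths n m i l" "xs = zs @ [j]" by auto
    then have "zs \<noteq> []" by (auto simp: paths_def)
    then show "xs \<in> paths n (Suc m) i j" using zs assms by (auto simp: paths_def)
  qed
qed

theorem pow_mat_eq_sum_paths:
  fixes A :: "'b :: comm_semiring_1 mat"
  assumes A: "A \<in> carrier_mat n n" and i: "i < n" and j: "j < n"
  shows "(A ^\<^sub>m m) $$ (i, j) = (\<Sum>xs\<in>paths n m i j. path_weight (\<lambda>a b. A $$ (a, b)) xs)"
  using j
proof (induction m arbitrary: j)
  case 0
  have "paths n 0 i j = (if i = j then {[i]} else {})"
    using i by (auto simp: paths_def length_Suc_conv)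
  then show ?case using 0 i A by auto
next
  case (Suc m)
  let ?w = "path_weight (\<lambda>a b. A $$ (a, b))"
  have pA: "A ^\<^sub>m m \<in> carrier_mat n n" using A by simp
  have "(A ^\<^sub>m Suc m) $$ (i, j) = (\<Sum>l<n. (A ^\<^sub>m m) $$ (i, l) * A $$ (l, j))"
    using i Suc.prems A pA by (auto simp: scalar_prod_def lessThan_atLeast0 intro!: sum.cong)
  also have "\<dots> = (\<Sum>l<n. \<Sum>xs\<in>paths n m i l. ?w (xs @ [j]))"
  proof (rule sum.cong[OF refl])
    fix l assume "l \<in> {..<n}"
    then have "(A ^\<^sub>m m) $$ (i, l) = (\<Sum>xs\<in>paths n m i l. ?w xs)" by (intro Suc.IH) simp
    then have "(A ^\<^sub>m m) $$ (i, l) * A $$ (l, j) = (\<Sum>xs\<in>paths n m i l. ?w xs * A $$ (l, j))"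
      by (simp add: sum_distrib_right)
    also have "\<dots> = (\<Sum>xs\<in>paths n m i l. ?w (xs @ [j]))"
    proof (rule sum.cong[OF refl])
      fix xs assume "xs \<in> paths n m i l"
      then have "xs \<noteq> []" "last xs = l" by (auto simp: paths_def)
      then show "?w xs * A $$ (l, j) = ?w (xs @ [j])" by (simp add: path_weight_snoc)
    qed
    finally show "(A ^\<^sub>m m) $$ (i, l) * A $$ (l, j) = (\<Sum>xs\<in>paths n m i l. ?w (xs @ [j]))" .
  qed
  also have "\<dots> = (\<Sum>xs\<in>(\<Union>l<n. paths n m i l). ?w (xs @ [j]))"
    by (rule sum.UNION_disjoint[symmetric]) (simp_all add: finite_paths, auto simp: paths_def)
  also have "\<dots> = (\<Sum>xs\<in>(\<lambda>xs. xs @ [j]) ` (\<Union>l<n. paths n m i l). ?w xs)"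
    by (subst sum.reindex) (auto simp: inj_on_def)
  finally show ?case unfolding paths_Suc[OF Suc.prems] .
qed

text \<open>
  The matrix entry depends only on the sorted pair of its indices, so the weight of a walk can be read off from the
  list of its undirected edges.
\<close>

lemma path_weight_triangular:
  fixes c :: real and n :: nat
  shows "path_weight (\<lambda>a b. c * (if a + b < n then g (min a b, max a b) else 0)) xs =
     (if \<forall>(a, b)\<in>set (walk_edges xs). a + b < n then c ^ (length xs - 1) * (\<Prod>e\<leftarrow>walk_edges xs. g e) else 0)"
proof (induction xs rule: induct_list012)
  case (3 a b xs)
  have "min a b + max a b = a + b" by (simp add: min_def max_def)
  then show ?case using 3(2) by simp
qed auto

context bounded_array
begin

lemma trace_pow_triangular:
  assumes W: "W \<in> carrier_mat n n"
    and ent: "\<And>a b. a < n \<Longrightarrow> b < n \<Longrightarrow> W $$ (a, b) = c * (if a + b < n then y (min a b, max a b) \<omega> else 0)"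
  shows "mat_trace (W ^\<^sub>m m) = c ^ m * walk_sum n m \<omega>"
proof -
  let ?f = "\<lambda>a b. c * (if a + b < n then y (min a b, max a b) \<omega> else 0)"
  let ?ok = "\<lambda>xs. \<forall>(a, b)\<in>set (walk_edges xs). a + b < n"
  have cong: "path_weight (\<lambda>a b. W $$ (a, b)) xs = path_weight ?f xs" if "set xs \<subseteq> {..<n}" for xs
    using that by (induction xs rule: induct_list012) (auto simp: ent)
  have "mat_trace (W ^\<^sub>m m) = (\<Sum>i<n. (W ^\<^sub>m m) $$ (i, i))"
    using W by (simp add: mat_trace_def)
  also have "\<dots> = (\<Sum>i<n. \<Sum>xs\<in>paths n m i i. path_weight (\<lambda>a b. W $$ (a, b)) xs)"
    by (intro sum.cong refl pow_mat_eq_sum_paths W) auto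
  also have "\<dots> = (\<Sum>i<n. \<Sum>xs\<in>paths n m i i. path_weight ?f xs)"
    by (intro sum.cong refl cong) (auto simp: paths_def)
  also have "\<dots> = (\<Sum>xs\<in>(\<Union>i<n. paths n m i i). path_weight ?f xs)"
    by (rule sum.UNION_disjoint[symmetric]) (simp_all add: finite_paths, auto simp: paths_def)
  also have "\<dots> = (\<Sum>xs\<in>closed_walks n m. path_weight ?f xs)"
  proof (rule sum.mono_neutral_right)
    show "finite (\<Union>i<n. paths n m i i)" by (simp add: finite_paths)
    show "closed_walks n m \<subseteq> (\<Union>i<n. paths n m i i)"
    proof
      fix xs assume xs: "xs \<in> closed_walks n m"
      then have "xs \<noteq> []" "set xs \<subseteq> {..<n}" by (auto simp: closed_walks_def)
      then have "hd xs < n" using hd_in_set[of xs] by blast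
      then show "xs \<in> (\<Union>i<n. paths n m i i)" using xs by (auto simp: closed_walks_def paths_def)
    qed
    show "\<forall>xs\<in>(\<Union>i<n. paths n m i i) - closed_walks n m. path_weight ?f xs = 0"
    proof
      fix xs assume "xs \<in> (\<Union>i<n. paths n m i i) - closed_walks n m"
      then have "\<not> ?ok xs" by (auto simp: closed_walks_def paths_def)
      then show "path_weight ?f xs = 0" unfolding path_weight_triangular[of c n "\<lambda>e. y e \<omega>"] by (simp only: if_False)
    qed
  qed
  also have "\<dots> = (\<Sum>xs\<in>closed_walks n m. c ^ m * word (walk_edges xs) \<omega>)"
  proof (rule sum.cong[OF refl])
    fix xs assume "xs \<in> closed_walks n m"
    then have "?ok xs" "length xs - 1 = m" by (auto simp: closed_walks_def)
    then show "path_weight ?f xs = c ^ m * word (walk_edges xs) \<omega>"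
      unfolding path_weight_triangular[of c n "\<lambda>e. y e \<omega>"] word_def by simp
  qed
  finally show ?thesis by (simp add: walk_sum_def sum_distrib_left)
qed

end

lemma triangular_wigner_carrier: "triangular_wigner n X \<in> carrier_mat n n"
  by (simp add: triangular_wigner_def)

lemma triangular_wigner_entry:
  "a < n \<Longrightarrow> b < n \<Longrightarrow> triangular_wigner n X $$ (a, b) = (if a + b < n then X (Suc (min a b)) (Suc (max a b)) else 0)"
  by (auto simp: triangular_wigner_def)

section \<open>Spectral distributions of symmetric matrices\<close>

definition symmetric_mat :: "'a mat \<Rightarrow> bool" where
  "symmetric_mat A \<longleftrightarrow> (\<forall>i<dim_row A. \<forall>j<dim_row A. A $$ (i, j) = A $$ (j, i))"

text \<open>
  For an eigenvector \<open>v\<close>, the form \<open>S = \<Sum>i j. cnj v\<^sub>i A\<^sub>i\<^sub>j v\<^sub>j\<close> is real by symmetry, and it equals \<open>z\<close> times the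
  squared norm of \<open>v\<close>.
\<close>

lemma symmetric_mat_eigenvalue_real:
  fixes A :: "real mat"
  assumes A: "A \<in> carrier_mat n n" and sym: "symmetric_mat A"
    and ev: "eigenvalue (map_mat complex_of_real A) z"
  shows "z \<in> \<real>"
proof -
  let ?B = "map_mat complex_of_real A"
  obtain v where v: "v \<in> carrier_vec n" "v \<noteq> 0\<^sub>v n" "?B *\<^sub>v v = z \<cdot>\<^sub>v v"
    using ev A unfolding eigenvalue_def eigenvector_def by auto
  have comp: "(\<Sum>j<n. of_real (A $$ (i, j)) * v $ j) = z * v $ i" if i: "i < n" for i
  proof -
    have "(?B *\<^sub>v v) $ i = (\<Sum>j<n. of_real (A $$ (i, j)) * v $ j)"
      using i A v(1) by (auto simp: scalar_prod_def lessThan_atLeast0 intro!: sum.cong)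
    then show ?thesis using v i by simp
  qed
  define N where "N = (\<Sum>i<n. (cmod (v $ i))\<^sup>2)"
  define S where "S = (\<Sum>i<n. \<Sum>j<n. cnj (v $ i) * (of_real (A $$ (i, j)) * v $ j))"
  have "S = (\<Sum>i<n. cnj (v $ i) * (z * v $ i))"
    unfolding S_def by (intro sum.cong) (simp_all add: comp sum_distrib_left[symmetric])
  also have "\<dots> = (\<Sum>i<n. z * of_real ((cmod (v $ i))\<^sup>2))"
    by (intro sum.cong) (simp_all add: complex_norm_square mult_ac del: of_real_power)
  finally have S1: "S = z * of_real N" by (simp add: N_def sum_distrib_left)
  have "cnj S = (\<Sum>i<n. \<Sum>j<n. cnj (v $ j) * (of_real (A $$ (j, i)) * v $ i))"
    using sym A unfolding S_def symmetric_mat_def by (auto simp: mult_ac intro!: sum.cong)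
  also have "\<dots> = S" unfolding S_def by (rule sum.swap)
  finally have "cnj z * of_real N = z * of_real N" unfolding S1 by simp
  moreover have "N \<noteq> 0"
  proof
    assume "N = 0"
    then have "\<forall>i<n. v $ i = 0" unfolding N_def by (subst (asm) sum_nonneg_eq_0_iff) auto
    then show False using v(1,2) by (auto intro: eq_vecI)
  qed
  ultimately have "cnj z = z" by simp
  then show ?thesis by (simp add: Reals_cnj_iff)
qed

text \<open>
  The characteristic polynomial splits over the complex numbers, with real roots. As the embedding of real
  polynomials is injective, the same factorisation holds over the reals.
\<close>

lemma symmetric_mat_char_poly_splits:
  fixes A :: "real mat"
  assumes A: "A \<in> carrier_mat n n" and sym: "symmetric_mat A"
  obtains es where "char_poly A = (\<Prod>e\<leftarrow>es. [:- e, 1:])" "length es = n"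
proof -
  interpret of_real_poly_hom: map_poly_inj_idom_hom complex_of_real ..
  let ?B = "map_mat complex_of_real A"
  have B: "?B \<in> carrier_mat n n" using A by simp
  obtain as where as: "char_poly ?B = (\<Prod>a\<leftarrow>as. [:- a, 1:])" "length as = n"
    using char_poly_factorized[OF B] by blast
  have real: "of_real (Re a) = a" if "a \<in> set as" for a
  proof -
    have "poly (char_poly ?B) a = 0"
      using that unfolding as(1) by (auto simp: poly_prod_list prod_list_zero_iff o_def image_iff)
    then have "eigenvalue ?B a" using eigenvalue_root_char_poly[OF B] by simp
    then show ?thesis using symmetric_mat_eigenvalue_real[OF A sym] by simp
  qed
  have "map_poly complex_of_real (char_poly A) = char_poly ?B"
    by (rule of_real_hom.char_poly_hom[OF A, symmetric])
  also have "\<dots> = (\<Prod>a\<leftarrow>as. map_poly complex_of_real [:- Re a, 1:])"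
    unfolding as(1) by (rule arg_cong[of _ _ prod_list], rule map_cong) (auto simp: real)
  also have "\<dots> = map_poly complex_of_real (\<Prod>e\<leftarrow>map Re as. [:- e, 1:])"
    by (simp add: of_real_poly_hom.hom_prod_list o_def)
  finally have "char_poly A = (\<Prod>e\<leftarrow>map Re as. [:- e, 1:])" by simp
  from that[OF this] show thesis using as(2) by simp
qed

lemma mat_trace_commute:
  fixes A B :: "'a :: comm_semiring_0 mat"
  assumes "A \<in> carrier_mat n n" "B \<in> carrier_mat n n"
  shows "mat_trace (A * B) = mat_trace (B * A)"
proof -
  have "mat_trace (A * B) = (\<Sum>i<n. \<Sum>j<n. A $$ (i, j) * B $$ (j, i))"
    using assms by (auto simp: mat_trace_def scalar_prod_def lessThan_atLeast0 intro!: sum.cong)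
  also have "\<dots> = (\<Sum>j<n. \<Sum>i<n. B $$ (j, i) * A $$ (i, j))"
    by (subst sum.swap) (simp add: mult.commute)
  also have "\<dots> = mat_trace (B * A)"
    using assms by (auto simp: mat_trace_def scalar_prod_def lessThan_atLeast0 intro!: sum.cong)
  finally show ?thesis .
qed

lemma upper_triangular_pow:
  fixes B :: "'a :: comm_semiring_1 mat"
  assumes B: "B \<in> carrier_mat n n" and up: "upper_triangular B"
  shows "i < n \<Longrightarrow> j < i \<Longrightarrow> (B ^\<^sub>m k) $$ (i, j) = 0"
    and "i < n \<Longrightarrow> (B ^\<^sub>m k) $$ (i, i) = (B $$ (i, i)) ^ k"
proof (induction k arbitrary: i j)
  case (Suc k)
  have pB: "B ^\<^sub>m k \<in> carrier_mat n n" using B by simp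
  have ent: "(B ^\<^sub>m Suc k) $$ (i, j) = (\<Sum>l<n. (B ^\<^sub>m k) $$ (i, l) * B $$ (l, j))"
    if "i < n" "j < n" for i j
    using that B pB by (auto simp: scalar_prod_def lessThan_atLeast0 intro!: sum.cong)
  {
    case 1
    have "(B ^\<^sub>m k) $$ (i, l) * B $$ (l, j) = 0" if "l < n" for l
      using Suc.IH(1)[of i l] 1 that upper_triangularD[OF up, of j l] B by (cases "l < i") auto
    then show ?case using 1 by (subst ent) auto
  next
    case 2
    have "(\<Sum>l<n. (B ^\<^sub>m k) $$ (i, l) * B $$ (l, i)) = (\<Sum>l\<in>{i}. (B ^\<^sub>m k) $$ (i, l) * B $$ (l, i))"
    proof (rule sum.mono_neutral_right)
      show "\<forall>l\<in>{..<n} - {i}. (B ^\<^sub>m k) $$ (i, l) * B $$ (l, i) = 0"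
      proof
        fix l assume "l \<in> {..<n} - {i}"
        then show "(B ^\<^sub>m k) $$ (i, l) * B $$ (l, i) = 0"
          using Suc.IH(1)[of i l] 2 upper_triangularD[OF up, of i l] B by (cases "l < i") auto
      qed
    qed (use 2 in auto)
    then show ?case using 2 Suc.IH(2)[of i] by (subst ent) (auto simp: mult.commute)
  }
qed (use B in auto)

text \<open>
  By Schur decomposition the matrix is similar to an upper triangular one with the roots on the diagonal.
  The trace is invariant under similarity, and powers of triangular matrices have the powers of the
  diagonal entries on the diagonal.
\<close>

lemma trace_pow_eq_sum_eigenvalues:
  fixes A :: "real mat"
  assumes A: "A \<in> carrier_mat n n" and cp: "char_poly A = (\<Prod>e\<leftarrow>es. [:- e, 1:])"
  shows "mat_trace (A ^\<^sub>m k) = (\<Sum>e\<leftarrow>es. e ^ k)"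
proof -
  obtain B P Q where BPQ: "schur_decomposition A es = (B, P, Q)" by (metis prod_cases3)
  from schur_decomposition[OF A cp this]
  have wit: "similar_mat_wit A B P Q" and up: "upper_triangular B" and diag: "diag_mat B = es" by auto
  from similar_mat_witD2[OF A wit]
  have c: "B \<in> carrier_mat n n" "P \<in> carrier_mat n n" "Q \<in> carrier_mat n n" and QP: "Q * P = 1\<^sub>m n" by auto
  have pB: "B ^\<^sub>m k \<in> carrier_mat n n" using c by simp
  have "mat_trace (A ^\<^sub>m k) = mat_trace (P * (B ^\<^sub>m k * Q))"
    using similar_mat_wit_pow_id[OF wit, of k] c pB by (simp add: assoc_mult_mat[of _ n n _ n _ n])
  also have "\<dots> = mat_trace (B ^\<^sub>m k * Q * P)"
    by (rule mat_trace_commute[of _ n]) (use c pB in auto)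
  also have "B ^\<^sub>m k * Q * P = B ^\<^sub>m k"
    using c pB QP by (simp add: assoc_mult_mat[of _ n n _ n _ n])
  also have "mat_trace (B ^\<^sub>m k) = (\<Sum>i<n. (B $$ (i, i)) ^ k)"
    using c upper_triangular_pow(2)[OF c(1) up] by (simp add: mat_trace_def)
  also have "\<dots> = (\<Sum>e\<leftarrow>es. e ^ k)"
    unfolding diag[symmetric] diag_mat_def using c
    by (simp add: o_def sum_list_sum_nth lessThan_atLeast0)
  finally show ?thesis .
qed

lemma sum_count_mset:
  fixes f :: "'a \<Rightarrow> real"
  assumes "finite F" "set xs \<subseteq> F"
  shows "(\<Sum>a\<in>F. f a * real (count (mset xs) a)) = (\<Sum>x\<leftarrow>xs. f x)"
  using assms(2)
proof (induction xs)
  case (Cons x xs)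
  have "(\<Sum>a\<in>F. f a * real (count (mset (x # xs)) a)) =
      (\<Sum>a\<in>F. f a * real (count (mset xs) a)) + (\<Sum>a\<in>F. if a = x then f a else 0)"
    unfolding sum.distrib[symmetric] by (intro sum.cong) (auto simp: algebra_simps)
  then show ?case using Cons assms(1) by simp
qed simp

theorem esd_moment:
  fixes A :: "real mat"
  assumes A: "A \<in> carrier_mat n n" and n: "n > 0" and sym: "symmetric_mat A"
  shows "integrable (esd A) (\<lambda>x. x ^ k)" and "(\<integral>x. x ^ k \<partial>esd A) = mat_trace (A ^\<^sub>m k) / real n"
proof -
  obtain es where es: "char_poly A = (\<Prod>e\<leftarrow>es. [:- e, 1:])" "length es = n"
    using symmetric_mat_char_poly_splits[OF A sym] .
  have pr: "proots (char_poly A) = mset es"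
  proof -
    have "proots (\<Prod>e\<leftarrow>es. [:- e, 1:]) = mset es"
    proof (induction es)
      case (Cons e es)
      have "(\<Prod>e\<leftarrow>es. [:- e, 1:]) \<noteq> 0" by (auto simp: prod_list_zero_iff)
      then show ?case using Cons by (simp add: proots_mult del: mult_pCons_left)
    qed simp
    then show ?thesis using es(1) by simp
  qed
  have ne: "mset es \<noteq> {#}" using es n by auto
  let ?p = "pmf_of_multiset (mset es)"
  have fin: "finite (set_pmf ?p)" using ne by simp
  have esd: "esd A = distr (measure_pmf ?p) borel (\<lambda>x. x)" unfolding esd_def pr ..
  show "integrable (esd A) (\<lambda>x. x ^ k)"
    unfolding esd by (subst integrable_distr_eq) (auto intro: integrable_measure_pmf_finite[OF fin])
  have "(\<integral>x. x ^ k \<partial>esd A) = measure_pmf.expectation ?p (\<lambda>x. x ^ k)"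
    unfolding esd by (subst integral_distr) auto
  also have "\<dots> = (\<Sum>a\<in>set es. a ^ k * pmf ?p a)"
    using ne by (intro integral_measure_pmf_real) auto
  also have "\<dots> = (\<Sum>a\<in>set es. a ^ k * real (count (mset es) a)) / real n"
    using ne es(2) by (simp add: sum_divide_distrib)
  also have "\<dots> = (\<Sum>e\<leftarrow>es. e ^ k) / real n" by (subst sum_count_mset) auto
  finally show "(\<integral>x. x ^ k \<partial>esd A) = mat_trace (A ^\<^sub>m k) / real n"
    by (simp add: trace_pow_eq_sum_eigenvalues[OF A es(1)])
qed

lemma real_distribution_esd: "real_distribution (esd A)"
  unfolding esd_def by (intro prob_space.real_distribution_distr prob_space_measure_pmf) simp

section \<open>A primitive without residue\<close>

text \<open>
  The coefficients of the primitive of the power series of \<open>exp (k z) / z\<^sup>k\<^sup>+\<^sup>1\<close> with its terms of negative degree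
  removed. The value 0 for \<open>n = 0\<close> fixes the constant of integration.
\<close>

definition tail_coeff :: "nat \<Rightarrow> nat \<Rightarrow> real" where
  "tail_coeff k n = (if n = 0 then 0 else real k ^ (n + k) / (fact (n + k) * real n))"

lemma summable_tail_coeff: "summable (\<lambda>n. complex_of_real (tail_coeff k n) * y ^ n)"
proof (rule summable_comparison_test')
  show "summable (\<lambda>n. real k ^ k * (norm (of_nat k * y) ^ n /\<^sub>R fact n))"
    by (intro summable_mult summable_exp_generic)
  show "norm (complex_of_real (tail_coeff k n) * y ^ n) \<le> real k ^ k * (norm (of_nat k * y) ^ n /\<^sub>R fact n)"
    if "n \<ge> 0" for n
  proof (cases "n = 0")
    case False
    have "fact n * 1 \<le> fact (n + k) * real n"
      using False by (intro mult_mono fact_mono) auto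
    then have "real k ^ (n + k) / (fact (n + k) * real n) \<le> real k ^ (n + k) / fact n"
      by (intro divide_left_mono) (use False in auto)
    then have "real k ^ (n + k) / (fact (n + k) * real n) * norm y ^ n \<le> real k ^ (n + k) / fact n * norm y ^ n"
      by (rule mult_right_mono) simp
    also have "\<dots> = real k ^ k * (norm (of_nat k * y) ^ n /\<^sub>R fact n)"
      by (simp add: norm_mult power_mult_distrib power_add divide_inverse mult_ac)
    finally have "tail_coeff k n * norm y ^ n \<le> real k ^ k * (norm (of_nat k * y) ^ n /\<^sub>R fact n)"
      using False by (simp add: tail_coeff_def)
    moreover have "tail_coeff k n \<ge> 0" by (simp add: tail_coeff_def)
    ultimately show ?thesis by (simp only: norm_mult norm_power norm_of_real abs_of_nonneg)
  qed (simp add: tail_coeff_def)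
qed

definition tail_prim :: "nat \<Rightarrow> complex \<Rightarrow> complex" where
  "tail_prim k z = (\<Sum>n. of_real (tail_coeff k n) * z ^ n)"

lemma DERIV_tail_prim:
  assumes "z \<noteq> 0"
  shows "(tail_prim k has_field_derivative
    (exp (of_nat k * z) - (\<Sum>j\<le>k. (of_nat k * z) ^ j / fact j)) / z ^ (k + 1)) (at z)"
proof -
  define a :: "nat \<Rightarrow> complex" where "a n = of_real (tail_coeff k n)" for n
  have summ: "summable (\<lambda>n. a n * y ^ n)" for y
    unfolding a_def by (rule summable_tail_coeff)
  have "((\<lambda>x. \<Sum>n. a n * x ^ n) has_field_derivative (\<Sum>n. diffs a n * z ^ n)) (at z)"
    by (rule termdiffs_strong_converges_everywhere[OF summ])
  also have "(\<lambda>x. \<Sum>n. a n * x ^ n) = tail_prim k"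
    by (rule ext) (simp add: tail_prim_def a_def)
  also have "(\<Sum>n. diffs a n * z ^ n) = (exp (of_nat k * z) - (\<Sum>j\<le>k. (of_nat k * z) ^ j / fact j)) / z ^ (k + 1)"
  proof -
    let ?e = "\<lambda>n. (of_nat k * z) ^ n /\<^sub>R fact n"
    have s: "summable ?e" by (rule summable_exp_generic)
    have eq: "diffs a n * z ^ n = ?e (n + (k + 1)) / z ^ (k + 1)" for n
    proof -
      have "diffs a n = of_real (real k ^ (n + k + 1) / fact (n + k + 1))"
        by (simp add: diffs_def a_def tail_coeff_def del: fact_Suc of_nat_Suc of_real_power)
      moreover have "?e (n + (k + 1)) = of_real (real k ^ (n + k + 1) / fact (n + k + 1)) * z ^ n * z ^ (k + 1)"
        by (simp add: scaleR_conv_of_real power_mult_distrib power_add divide_inverse mult_ac del: fact_Suc)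
      ultimately show ?thesis using assms by simp
    qed
    have "(\<Sum>n. diffs a n * z ^ n) = (\<Sum>n. ?e (n + (k + 1))) / z ^ (k + 1)"
      unfolding eq by (rule suminf_divide) (rule summable_ignore_initial_segment[OF s])
    also have "(\<Sum>n. ?e (n + (k + 1))) = exp (of_nat k * z) - (\<Sum>j<k + 1. ?e j)"
      unfolding exp_def by (rule suminf_minus_initial_segment[OF s])
    also have "(\<Sum>j<k + 1. ?e j) = (\<Sum>j\<le>k. (of_nat k * z) ^ j / fact j)"
      by (intro sum.cong) (auto simp: scaleR_conv_of_real divide_inverse mult_ac)
    finally show ?thesis .
  qed
  finally show ?thesis .
qed

text \<open>
  The sum integrates the terms \<open>k\<^sup>j / j! z\<^sup>j\<^sup>-\<^sup>k\<^sup>-\<^sup>1\<close> with \<open>j < k\<close>. The term with \<open>j = k\<close>, a multiple of \<open>1/z\<close>, has no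
  single-valued primitive and is left out.
\<close>

definition residue_free_prim :: "nat \<Rightarrow> complex \<Rightarrow> complex" where
  "residue_free_prim k z = tail_prim k z
     - (\<Sum>j<k. of_real (real k ^ j / (fact j * real (k - j))) * inverse z ^ (k - j))"

lemma DERIV_residue_free_prim:
  assumes z: "z \<noteq> 0"
  shows "(residue_free_prim k has_field_derivative
     (exp (of_nat k * z) / z ^ k - of_real (real k ^ k / fact k)) / z) (at z)"
proof -
  let ?S = "\<Sum>j<k. (of_nat k * z) ^ j / fact j"
  have d: "((\<lambda>z. inverse z ^ (k - j)) has_field_derivative
      - (of_nat (k - j) * inverse z ^ (k - j + 1))) (at z)" if "j < k" for j
  proof -
    have "((\<lambda>z. inverse z ^ (k - j)) has_field_derivative
       of_nat (k - j) * (- (inverse z * 1 * inverse z) * inverse z ^ (k - j - Suc 0))) (at z)"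
      by (rule DERIV_power[OF DERIV_inverse'[OF DERIV_ident z]])
    also have "of_nat (k - j) * (- (inverse z * 1 * inverse z) * inverse z ^ (k - j - Suc 0)) =
       - (of_nat (k - j) * inverse z ^ (k - j + 1))"
      using that by (cases "k - j") auto
    finally show ?thesis .
  qed
  have "(residue_free_prim k has_field_derivative
      (exp (of_nat k * z) - (\<Sum>j\<le>k. (of_nat k * z) ^ j / fact j)) / z ^ (k + 1)
      - (\<Sum>j<k. of_real (real k ^ j / (fact j * real (k - j))) * - (of_nat (k - j) * inverse z ^ (k - j + 1)))) (at z)"
    unfolding residue_free_prim_def[abs_def]
    by (intro DERIV_diff DERIV_tail_prim z DERIV_sum DERIV_cmult d) auto
  also have "(\<Sum>j<k. of_real (real k ^ j / (fact j * real (k - j))) * - (of_nat (k - j) * inverse z ^ (k - j + 1)))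
     = - (?S / z ^ (k + 1))"
    unfolding sum_divide_distrib sum_negf[symmetric]
  proof (intro sum.cong refl)
    fix j assume "j \<in> {..<k}"
    then have j: "j < k" by simp
    have "z ^ (k + 1) = z ^ (k - j + 1) * z ^ j" using j by (simp flip: power_add)
    then have "(of_nat k * z) ^ j / fact j / z ^ (k + 1) = of_nat k ^ j / fact j * inverse z ^ (k - j + 1)"
      using z by (simp add: power_mult_distrib divide_inverse power_inverse)
    then show "of_real (real k ^ j / (fact j * real (k - j))) * - (of_nat (k - j) * inverse z ^ (k - j + 1)) =
       - ((of_nat k * z) ^ j / fact j / z ^ (k + 1))"
      using j by simp
  qed
  also have "(exp (of_nat k * z) - (\<Sum>j\<le>k. (of_nat k * z) ^ j / fact j)) / z ^ (k + 1) - - (?S / z ^ (k + 1))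
     = (exp (of_nat k * z) / z ^ k - of_real (real k ^ k / fact k)) / z"
  proof -
    have "(\<Sum>j\<le>k. (of_nat k * z) ^ j / fact j) = ?S + (of_nat k * z) ^ k / fact k"
      by (simp flip: lessThan_Suc_atMost)
    then have "(exp (of_nat k * z) - (\<Sum>j\<le>k. (of_nat k * z) ^ j / fact j)) / z ^ (k + 1) - - (?S / z ^ (k + 1))
      = (exp (of_nat k * z) - (of_nat k * z) ^ k / fact k) / z ^ k / z"
      by (simp add: diff_divide_distrib add_divide_distrib mult.commute)
    also have "\<dots> = (exp (of_nat k * z) / z ^ k - of_real (real k ^ k / fact k)) / z"
      using z by (simp add: diff_divide_distrib power_mult_distrib)
    finally show ?thesis .
  qed
  finally show ?thesis .
qed

text \<open>
  All coefficients are real.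
\<close>

lemma Im_residue_free_prim_of_real: "Im (residue_free_prim k (of_real x)) = 0"
proof -
  have "Im (tail_prim k (of_real x)) = (\<Sum>n. Im (of_real (tail_coeff k n) * of_real x ^ n))"
    unfolding tail_prim_def by (rule bounded_linear.suminf[OF bounded_linear_Im summable_tail_coeff])
  also have "\<dots> = 0" by (simp flip: of_real_power of_real_mult)
  finally have "Im (tail_prim k (of_real x)) = 0" .
  moreover have "(\<Sum>j<k. of_real (real k ^ j / (fact j * real (k - j))) * inverse (complex_of_real x) ^ (k - j)) \<in> \<real>"
    by (intro sum_in_Reals Reals_mult Reals_power Reals_inverse Reals_of_real)
  ultimately show ?thesis unfolding residue_free_prim_def by (simp add: complex_is_Real_iff)
qed

text \<open>
  The function is real at \<open>x\<close>, so the imaginary part at \<open>x + \<i> y\<close> is at most the length \<open>y\<close> of the vertical segment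
  times a bound for the derivative on it. Since \<open>\<bar>exp (k z)\<bar> \<le> 1\<close> in the left half plane, that bound is of order \<open>1 / \<bar>x\<bar>\<close>.
\<close>

lemma residue_free_prim_left_bound:
  assumes x: "x \<le> -1" and y: "0 \<le> y"
  shows "\<bar>Im (residue_free_prim k (Complex x y))\<bar> \<le> (1 + real k ^ k / fact k) / \<bar>x\<bar> * y"
proof -
  let ?B = "(1 + real k ^ k / fact k) / \<bar>x\<bar>"
  let ?S = "closed_segment (of_real x) (Complex x y)"
  have seg: "Re z = x" if "z \<in> ?S" for z
    using that by (auto simp: closed_segment_def left_diff_distrib)
  have "norm (residue_free_prim k (Complex x y) - residue_free_prim k (of_real x)) \<le> ?B * norm (Complex x y - of_real x)"
  proof (rule field_differentiable_bound[of ?S _ "\<lambda>z. (exp (of_nat k * z) / z ^ k - of_real (real k ^ k / fact k)) / z"])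
    fix z assume z: "z \<in> ?S"
    then have Re: "Re z = x" by (rule seg)
    then have "z \<noteq> 0" using x by auto
    then show "(residue_free_prim k has_field_derivative
        (exp (of_nat k * z) / z ^ k - of_real (real k ^ k / fact k)) / z) (at z within ?S)"
      by (intro DERIV_subset[OF DERIV_residue_free_prim]) auto
    have nz: "norm z \<ge> \<bar>x\<bar>" using abs_Re_le_cmod[of z] Re by simp
    have "norm (exp (of_nat k * z) / z ^ k) \<le> 1 / 1"
      unfolding norm_divide
    proof (rule frac_le)
      show "norm (exp (of_nat k * z)) \<le> 1" using Re x by (simp add: mult_nonneg_nonpos)
      show "1 \<le> norm (z ^ k)" using nz x by (simp add: norm_power one_le_power)
    qed auto
    then have "norm (exp (of_nat k * z) / z ^ k - of_real (real k ^ k / fact k)) \<le> 1 + real k ^ k / fact k"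
      by (intro order_trans[OF norm_triangle_ineq4] add_mono) (auto simp: norm_divide norm_power)
    then show "norm ((exp (of_nat k * z) / z ^ k - of_real (real k ^ k / fact k)) / z) \<le> ?B"
      unfolding norm_divide using nz x by (intro frac_le) auto
  qed auto
  moreover have "norm (Complex x y - of_real x) = y" using y by (simp add: cmod_def)
  moreover have "\<bar>Im (residue_free_prim k (Complex x y))\<bar> \<le> norm (residue_free_prim k (Complex x y) - residue_free_prim k (of_real x))"
    using abs_Im_le_cmod[of "residue_free_prim k (Complex x y) - residue_free_prim k (of_real x)"]
    by (simp add: Im_residue_free_prim_of_real)
  ultimately show ?thesis by simp
qed

section \<open>The parametrisation of the limiting density\<close>

text \<open>
  The graph of \<open>\<psi>\<close> consists of the points \<open>(s(v), q(v))\<close> with \<open>s = psi_arg\<close> and \<open>q = psi_val\<close>.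
\<close>

definition psi_arg :: "real \<Rightarrow> real" where "psi_arg v = sin v / v * exp (v * cot v)"
definition psi_val :: "real \<Rightarrow> real" where "psi_val v = 1 / pi * sin v * exp (- (v * cot v))"
definition psi_arg_deriv :: "real \<Rightarrow> real" where
  "psi_arg_deriv v = - (psi_arg v * ((sin v)\<^sup>2 - 2 * v * sin v * cos v + v\<^sup>2) / (v * (sin v)\<^sup>2))"

lemma psi_arg_pos: "0 < v \<Longrightarrow> v < pi \<Longrightarrow> 0 < psi_arg v"
  by (simp add: psi_arg_def sin_gt_zero)

lemma psi_val_pos: "0 < v \<Longrightarrow> v < pi \<Longrightarrow> 0 < psi_val v"
  by (simp add: psi_val_def sin_gt_zero)

lemma DERIV_v_cot: 
  assumes "sin v \<noteq> 0" shows "((\<lambda>v. v * cot v) has_real_derivative cot v - v / (sin v)\<^sup>2) (at v)"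
  using DERIV_mult[OF DERIV_ident DERIV_cot[OF assms]] by (simp add: divide_inverse algebra_simps)

lemma DERIV_psi_arg:
  assumes "0 < v" "v < pi" shows "(psi_arg has_real_derivative psi_arg_deriv v) (at v)"
proof -
  have s: "sin v > 0" using assms by (simp add: sin_gt_zero)
  have "((\<lambda>v. sin v / v * exp (v * cot v)) has_real_derivative
     (cos v * v - sin v * 1) / (v * v) * exp (v * cot v) + exp (v * cot v) * (cot v - v / (sin v)\<^sup>2) * (sin v / v)) (at v)"
    using s assms by (intro DERIV_mult DERIV_divide DERIV_sin DERIV_ident DERIV_v_cot DERIV_fun_exp) auto
  also have "(cos v * v - sin v * 1) / (v * v) * exp (v * cot v) + exp (v * cot v) * (cot v - v / (sin v)\<^sup>2) * (sin v / v) = psi_arg_deriv v"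
    using s assms unfolding psi_arg_deriv_def psi_arg_def cot_def by (simp add: field_simps power2_eq_square)
  finally show ?thesis unfolding psi_arg_def[abs_def] .
qed

text \<open>
  This simple derivative is what makes integration by parts work: multiplying by \<open>s\<^sup>k\<^sup>+\<^sup>1\<close> gives \<open>s\<^sup>k / \<pi>\<close>.
\<close>

lemma DERIV_psi_val:
  assumes "0 < v" "v < pi" shows "(psi_val has_real_derivative 1 / (pi * psi_arg v)) (at v)"
proof -
  have s: "sin v > 0" using assms by (simp add: sin_gt_zero)
  have "((\<lambda>v. 1 / pi * (sin v * exp (- (v * cot v)))) has_real_derivative
     1 / pi * (cos v * exp (- (v * cot v)) + exp (- (v * cot v)) * - (cot v - v / (sin v)\<^sup>2) * sin v)) (at v)"
    using s by (intro DERIV_cmult DERIV_mult DERIV_sin DERIV_v_cot DERIV_minus DERIV_fun_exp) auto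
  also have "1 / pi * (cos v * exp (- (v * cot v)) + exp (- (v * cot v)) * - (cot v - v / (sin v)\<^sup>2) * sin v) = 1 / (pi * psi_arg v)"
    using s assms unfolding psi_arg_def cot_def by (simp add: field_simps power2_eq_square exp_minus)
  finally show ?thesis unfolding psi_val_def[abs_def] by (simp add: mult.assoc)
qed

text \<open>
  The expression is a sum of two squares, \<open>(v - sin v cos v)\<^sup>2 + sin\<^sup>4 v\<close>; if \<open>sin v = 0\<close> it equals \<open>v\<^sup>2\<close>.
\<close>

lemma psi_arg_deriv_numerator_pos: 
  assumes "0 < (v::real)" shows "0 < (sin v)\<^sup>2 - 2 * v * sin v * cos v + v\<^sup>2"
proof -
  have "(v - a * b)\<^sup>2 + a\<^sup>2 * a\<^sup>2 = a\<^sup>2 * (b\<^sup>2 + a\<^sup>2) - 2 * v * a * b + v\<^sup>2" for a b :: real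
    by (simp add: power2_eq_square algebra_simps)
  from this[of "sin v" "cos v"]
  have eq: "(sin v)\<^sup>2 - 2 * v * sin v * cos v + v\<^sup>2 = (v - sin v * cos v)\<^sup>2 + (sin v)\<^sup>2 * (sin v)\<^sup>2"
    by simp
  show ?thesis
  proof (cases "sin v = 0")
    case True then show ?thesis using assms by simp
  next
    case False
    then have "(sin v)\<^sup>2 * (sin v)\<^sup>2 > 0" by simp
    then show ?thesis unfolding eq by (intro add_nonneg_pos) auto
  qed
qed

lemma psi_arg_deriv_neg: "0 < v \<Longrightarrow> v < pi \<Longrightarrow> psi_arg_deriv v < 0"
  unfolding psi_arg_deriv_def using psi_arg_pos[of v] psi_arg_deriv_numerator_pos[of v] sin_gt_zero[of v] by simp

lemma v_cot_at_0: "((\<lambda>v::real. v * cot v) \<longlongrightarrow> 1) (at_right 0)"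
proof -
  have "((\<lambda>x::real. sin x / x) \<longlongrightarrow> 1) (at 0)"
    using DERIV_sin[of 0] by (simp add: has_field_derivative_iff)
  then have "((\<lambda>x::real. cos x / (sin x / x)) \<longlongrightarrow> cos 0 / 1) (at 0)"
    by (intro tendsto_intros) auto
  then have "((\<lambda>x::real. x * cot x) \<longlongrightarrow> 1) (at 0)" by (simp add: cot_def mult.commute)
  then show ?thesis by (rule tendsto_within_subset) simp
qed

lemma sin_at_left_pi: "eventually (\<lambda>v. 0 < sin v) (at_left pi)"
  by (rule eventually_mono[OF eventually_at_left_real[of 0 pi]]) (auto simp: sin_gt_zero)

lemma v_cot_at_pi: "filterlim (\<lambda>v::real. v * cot v) at_bot (at_left pi)"
proof -
  have "(sin \<longlongrightarrow> sin pi) (at_left pi)" by (intro tendsto_intros)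
  then have "filterlim (\<lambda>v. inverse (sin v)) at_top (at_left pi)"
    by (intro filterlim_inverse_at_top sin_at_left_pi) simp
  moreover have "((\<lambda>v. v * cos v) \<longlongrightarrow> pi * cos pi) (at_left pi)" by (intro tendsto_intros)
  ultimately have "filterlim (\<lambda>v. v * cos v * inverse (sin v)) at_bot (at_left pi)"
    by (intro filterlim_tendsto_neg_mult_at_bot[of _ "pi * cos pi"]) auto
  then show ?thesis by (simp add: cot_def divide_inverse mult.assoc)
qed

lemma psi_arg_at_0: "(psi_arg \<longlongrightarrow> exp 1) (at_right 0)"
proof -
  have "((\<lambda>x::real. sin x / x) \<longlongrightarrow> 1) (at 0)"
    using DERIV_sin[of 0] by (simp add: has_field_derivative_iff)
  then have "((\<lambda>x::real. sin x / x) \<longlongrightarrow> 1) (at_right 0)"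
    by (rule tendsto_within_subset) simp
  then have "((\<lambda>v::real. sin v / v * exp (v * cot v)) \<longlongrightarrow> 1 * exp 1) (at_right 0)"
    by (intro tendsto_intros v_cot_at_0)
  then show ?thesis by (simp add: psi_arg_def[abs_def])
qed

lemma psi_arg_at_pi: "(psi_arg \<longlongrightarrow> 0) (at_left pi)"
proof -
  have "((\<lambda>v. sin v / v) \<longlongrightarrow> sin pi / pi) (at_left pi)" by (intro tendsto_intros) auto
  moreover have "((\<lambda>v. exp (v * cot v)) \<longlongrightarrow> 0) (at_left pi)"
    by (rule filterlim_compose[OF exp_at_bot v_cot_at_pi])
  ultimately have "((\<lambda>v. sin v / v * exp (v * cot v)) \<longlongrightarrow> sin pi / pi * 0) (at_left pi)"
    by (rule tendsto_mult)
  then show ?thesis by (simp add: psi_arg_def[abs_def])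
qed

lemma psi_val_at_0: "(psi_val \<longlongrightarrow> 0) (at_right 0)"
proof -
  have "((\<lambda>v. 1 / pi * sin v * exp (- (v * cot v))) \<longlongrightarrow> 1 / pi * sin 0 * exp (- 1)) (at_right 0)"
    by (intro tendsto_intros v_cot_at_0)
  then show ?thesis by (simp add: psi_val_def[abs_def])
qed

section \<open>Integrals along the parametrisation\<close>

text \<open>
  The linear term has derivative \<open>k\<^sup>k / k!\<close> and puts back the residue term omitted from the complex primitive, because
  the argument of \<open>\<zeta>(v) = v cot v + \<i> v\<close> is \<open>v\<close>.
\<close>

definition nuttall_prim :: "nat \<Rightarrow> real \<Rightarrow> real" where
  "nuttall_prim k v = Im (residue_free_prim k (Complex (v * cot v) v)) + real k ^ k / fact k * v"

text \<open>
  With \<open>\<zeta>(v) = v / sin v * exp (\<i> v)\<close> one has \<open>exp \<zeta> / \<zeta> = s(v)\<close>, a real number, and \<open>Im (\<zeta>' / \<zeta>) = 1\<close>, the derivative of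
  the argument. Hence the derivative of the complex part is \<open>s\<^sup>k - k\<^sup>k / k!\<close>.
\<close>

lemma DERIV_nuttall_prim:
  assumes v: "0 < v" "v < pi"
  shows "(nuttall_prim k has_real_derivative psi_arg v ^ k) (at v)"
proof -
  have s: "sin v > 0" using v by (simp add: sin_gt_zero)
  define z where "z = Complex (v * cot v) v"
  define c where "c = real k ^ k / fact k"
  define A where "A = cot v - v / (sin v)\<^sup>2"
  define z' where "z' = Complex A 1"
  have z0: "z \<noteq> 0" using v by (simp add: z_def complex_eq_iff)
  have "((\<lambda>v. Complex (v * cot v) v) has_vector_derivative z') (at v)"
    unfolding z'_def A_def using s
    by (auto simp: has_vector_derivative_complex_iff intro!: DERIV_v_cot)
  from field_vector_diff_chain_at[OF this, of "residue_free_prim k"] DERIV_residue_free_prim[OF z0, of k]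
  have "((residue_free_prim k \<circ> (\<lambda>v. Complex (v * cot v) v)) has_vector_derivative
      z' * ((exp (of_nat k * z) / z ^ k - of_real c) / z)) (at v)"
    unfolding z_def c_def by blast
  from bounded_linear.has_vector_derivative[OF bounded_linear_Im this]
  have "((\<lambda>v. Im (residue_free_prim k (Complex (v * cot v) v))) has_real_derivative
      Im (z' * ((exp (of_nat k * z) / z ^ k - of_real c) / z))) (at v)"
    by (simp add: has_real_derivative_iff_has_vector_derivative o_def)
  moreover have "Im (z' * ((exp (of_nat k * z) / z ^ k - of_real c) / z)) = psi_arg v ^ k - c"
  proof -
    have zc: "z = of_real (v / sin v) * cis v"
      using s by (simp add: z_def complex_eq_iff cot_def)
    have "exp z = of_real (exp (v * cot v)) * cis v"
      by (simp add: z_def exp_eq_polar)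
    then have "exp z / z = of_real (psi_arg v)"
      using s v by (simp add: zc psi_arg_def field_simps)
    then have 1: "exp (of_nat k * z) / z ^ k = of_real (psi_arg v ^ k)"
      by (simp add: exp_of_nat_mult power_divide[symmetric])
    have "1 / z = of_real (sin v / v) * cis (- v)"
      using s v by (simp add: zc field_simps cis_mult)
    then have "z' / z = z' * (of_real (sin v / v) * cis (- v))" by (metis times_divide_eq_right mult.right_neutral)
    then have "Im (z' / z) = sin v / v * (cos v - sin v * A)"
      by (simp add: z'_def algebra_simps add_divide_distrib diff_divide_distrib)
    also have "\<dots> = 1" using s v by (simp add: A_def cot_def field_simps power2_eq_square)
    finally have "Im (z' / z) = 1" .
    moreover have "Im (w * of_real r) = Im w * r" for w r by simp
    ultimately have "Im (z' / z * of_real (psi_arg v ^ k - c)) = psi_arg v ^ k - c" by (metis mult_1)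
    moreover have eq: "z' * ((exp (of_nat k * z) / z ^ k - of_real c) / z) = z' / z * of_real (psi_arg v ^ k - c)"
      unfolding 1 by simp
    ultimately show ?thesis unfolding eq by (simp only:)
  qed
  ultimately have "((\<lambda>v. Im (residue_free_prim k (Complex (v * cot v) v))) has_real_derivative psi_arg v ^ k - c) (at v)"
    by simp
  from DERIV_add[OF this DERIV_cmult[OF DERIV_ident, of c]] show ?thesis
    unfolding nuttall_prim_def[abs_def] c_def by simp
qed

lemma nuttall_prim_at_0: "(nuttall_prim k \<longlongrightarrow> 0) (at_right 0)"
proof -
  have "((\<lambda>v. Complex (v * cot v) v) \<longlongrightarrow> Complex 1 0) (at_right 0)"
    by (intro tendsto_Complex v_cot_at_0 tendsto_ident_at)
  moreover have "isCont (residue_free_prim k) (Complex 1 0)"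
    by (rule DERIV_isCont[OF DERIV_residue_free_prim]) (simp add: complex_eq_iff)
  ultimately have "((\<lambda>v. residue_free_prim k (Complex (v * cot v) v)) \<longlongrightarrow> residue_free_prim k (Complex 1 0)) (at_right 0)"
    by (rule isCont_tendsto_compose[rotated])
  then have "((\<lambda>v. Im (residue_free_prim k (Complex (v * cot v) v)) + real k ^ k / fact k * v)
     \<longlongrightarrow> Im (residue_free_prim k (Complex 1 0)) + real k ^ k / fact k * 0) (at_right 0)"
    by (intro tendsto_intros)
  moreover have "Im (residue_free_prim k (Complex 1 0)) = 0"
    using Im_residue_free_prim_of_real[of k 1] by (simp add: Complex_eq)
  ultimately show ?thesis by (simp add: nuttall_prim_def[abs_def])
qed

text \<open>
  Here \<open>\<zeta>(v)\<close> tends to infinity to the left at bounded height, where the imaginary part of the complex primitive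
  vanishes in the limit. So the integral of \<open>s\<^sup>k\<close> over \<open>(0, \<pi>)\<close> is \<open>\<pi> k\<^sup>k / k!\<close>.
\<close>

lemma nuttall_prim_at_pi: "(nuttall_prim k \<longlongrightarrow> pi * (real k ^ k / fact k)) (at_left pi)"
proof -
  define C where "C = 1 + real k ^ k / fact k"
  have "filterlim (\<lambda>v. - (v * cot v)) at_top (at_left pi)"
    using v_cot_at_pi by (simp add: filterlim_uminus_at_bot)
  then have "((\<lambda>v. C / (- (v * cot v)) * v) \<longlongrightarrow> 0 * pi) (at_left pi)"
    by (intro tendsto_mult tendsto_ident_at tendsto_divide_0[OF tendsto_const] filterlim_at_top_imp_at_infinity)
  then have lim: "((\<lambda>v. C / (- (v * cot v)) * v) \<longlongrightarrow> 0) (at_left pi)" by simp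
  have "eventually (\<lambda>v. v * cot v \<le> -1) (at_left pi)"
    using v_cot_at_pi by (simp add: filterlim_at_bot)
  moreover have "eventually (\<lambda>v. v \<in> {0<..<pi}) (at_left pi)" by (rule eventually_at_left_real) simp
  ultimately have "eventually (\<lambda>v. norm (Im (residue_free_prim k (Complex (v * cot v) v))) \<le> C / (- (v * cot v)) * v) (at_left pi)"
  proof eventually_elim
    case (elim v)
    then show ?case using residue_free_prim_left_bound[of "v * cot v" v k]
      by (simp add: C_def abs_of_neg)
  qed
  from Lim_null_comparison[OF this lim]
  have "((\<lambda>v. Im (residue_free_prim k (Complex (v * cot v) v)) + real k ^ k / fact k * v)
     \<longlongrightarrow> 0 + real k ^ k / fact k * pi) (at_left pi)"
    by (intro tendsto_intros)
  then show ?thesis by (simp add: nuttall_prim_def[abs_def] mult.commute)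
qed

text \<open>
  Integration by parts of \<open>s\<^sup>k s' q\<close>, with \<open>s\<^sup>k\<^sup>+\<^sup>1 q' = s\<^sup>k / \<pi>\<close>.
\<close>

definition moment_prim :: "nat \<Rightarrow> real \<Rightarrow> real" where
  "moment_prim k v = (psi_arg v ^ Suc k * psi_val v - nuttall_prim k v / pi) / real (Suc k)"

lemma DERIV_moment_prim:
  assumes v: "0 < v" "v < pi"
  shows "(moment_prim k has_real_derivative psi_arg v ^ k * psi_arg_deriv v * psi_val v) (at v)"
proof -
  note s = psi_arg_pos[OF v]
  have "((\<lambda>v. psi_arg v ^ Suc k) has_real_derivative real (Suc k) * (psi_arg_deriv v * psi_arg v ^ (Suc k - Suc 0))) (at v)"
    using DERIV_power[OF DERIV_psi_arg[OF v], of "Suc k"] by simp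
  from DERIV_cdivide[OF DERIV_diff[OF DERIV_mult[OF this DERIV_psi_val[OF v]] DERIV_cdivide[OF DERIV_nuttall_prim[OF v, of k], of pi]], of "real (Suc k)"]
  have "(moment_prim k has_real_derivative
     (real (Suc k) * (psi_arg_deriv v * psi_arg v ^ k) * psi_val v + 1 / (pi * psi_arg v) * psi_arg v ^ Suc k - psi_arg v ^ k / pi) / real (Suc k)) (at v)"
    unfolding moment_prim_def[abs_def] by simp
  moreover have "(real (Suc k) * (psi_arg_deriv v * psi_arg v ^ k) * psi_val v + 1 / (pi * psi_arg v) * psi_arg v ^ Suc k - psi_arg v ^ k / pi) / real (Suc k)
     = psi_arg v ^ k * psi_arg_deriv v * psi_val v"
  proof -
    have "1 / (pi * psi_arg v) * psi_arg v ^ Suc k = psi_arg v ^ k / pi" using s by simp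
    then show ?thesis by (simp del: of_nat_Suc)
  qed
  ultimately show ?thesis by simp
qed

lemma moment_prim_at_0: "(moment_prim k \<longlongrightarrow> 0) (at_right 0)"
proof -
  have "((\<lambda>v. (psi_arg v ^ Suc k * psi_val v - nuttall_prim k v / pi) / real (Suc k)) \<longlongrightarrow>
     (exp 1 ^ Suc k * 0 - 0 / pi) / real (Suc k)) (at_right 0)"
    by (intro tendsto_intros psi_arg_at_0 psi_val_at_0 nuttall_prim_at_0) auto
  then show ?thesis by (simp add: moment_prim_def[abs_def])
qed

lemma moment_prim_at_pi: "(moment_prim k \<longlongrightarrow> - (real k ^ k / fact (k + 1))) (at_left pi)"
proof -
  have eq: "psi_arg v * psi_val v = 1 / pi * (sin v)\<^sup>2 / v" for v
  proof -
    have "exp (v * cot v) * exp (- (v * cot v)) = 1" by (simp flip: exp_add)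
    moreover have "psi_arg v * psi_val v = 1 / pi * (sin v)\<^sup>2 / v * (exp (v * cot v) * exp (- (v * cot v)))"
      by (simp add: psi_arg_def psi_val_def power2_eq_square mult_ac)
    ultimately show ?thesis by simp
  qed
  have "((\<lambda>v. 1 / pi * (sin v)\<^sup>2 / v) \<longlongrightarrow> 1 / pi * (sin pi)\<^sup>2 / pi) (at_left pi)"
    by (intro tendsto_intros) auto
  then have sq: "((\<lambda>v. psi_arg v * psi_val v) \<longlongrightarrow> 0) (at_left pi)" by (simp add: eq)
  have "((\<lambda>v. (psi_arg v ^ k * (psi_arg v * psi_val v) - nuttall_prim k v / pi) / real (Suc k)) \<longlongrightarrow>
     (0 ^ k * 0 - pi * (real k ^ k / fact k) / pi) / real (Suc k)) (at_left pi)"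
    by (intro tendsto_intros psi_arg_at_pi sq nuttall_prim_at_pi) auto
  then show ?thesis by (simp add: moment_prim_def[abs_def] mult_ac)
qed

section \<open>The function psi and the limiting density\<close>

lemma psi_arg_decreasing: "0 < u \<Longrightarrow> u < v \<Longrightarrow> v < pi \<Longrightarrow> psi_arg v < psi_arg u"
  by (rule DERIV_neg_imp_decreasing[of u v psi_arg])
     (auto intro!: exI[of _ "psi_arg_deriv _"] DERIV_psi_arg psi_arg_deriv_neg)

lemma psi_arg_less_e:
  assumes "0 < v" "v < pi" shows "psi_arg v < exp 1"
proof -
  have "eventually (\<lambda>u. psi_arg (v / 2) \<le> psi_arg u) (at_right 0)"
    using eventually_at_right_real[of 0 "v / 2"] assms
    by (auto elim!: eventually_mono intro!: less_imp_le psi_arg_decreasing)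
  then have "psi_arg (v / 2) \<le> exp 1"
    by (intro tendsto_lowerbound[OF psi_arg_at_0]) auto
  moreover have "psi_arg v < psi_arg (v / 2)" using assms by (intro psi_arg_decreasing) auto
  ultimately show ?thesis by simp
qed

lemma isCont_psi_arg: "0 < v \<Longrightarrow> v < pi \<Longrightarrow> isCont psi_arg v"
  using DERIV_psi_arg DERIV_isCont by blast

lemma bij_betw_psi_arg: "bij_betw psi_arg {0<..<pi} {0<..<exp 1}"
proof (rule bij_betw_imageI)
  show "inj_on psi_arg {0<..<pi}"
    by (rule linorder_inj_onI) (use psi_arg_decreasing in force)+
  show "psi_arg ` {0<..<pi} = {0<..<exp 1}"
  proof
    show "psi_arg ` {0<..<pi} \<subseteq> {0<..<exp 1}" using psi_arg_pos psi_arg_less_e by auto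
    show "{0<..<exp 1} \<subseteq> psi_arg ` {0<..<pi}"
    proof
      fix y :: real assume y: "y \<in> {0<..<exp 1}"
      have "eventually (\<lambda>u. y < psi_arg u \<and> u \<in> {0<..<pi / 2}) (at_right 0)"
        using y by (intro eventually_conj order_tendstoD(1)[OF psi_arg_at_0] eventually_at_right_real) auto
      then obtain a where a: "y < psi_arg a" "0 < a" "a < pi / 2"
        using eventually_happens'[of "at_right (0::real)"] by auto
      have "eventually (\<lambda>u. psi_arg u < y \<and> u \<in> {pi / 2<..<pi}) (at_left pi)"
        using y by (intro eventually_conj order_tendstoD(2)[OF psi_arg_at_pi] eventually_at_left_real) auto
      then obtain b where b: "psi_arg b < y" "pi / 2 < b" "b < pi"
        using eventually_happens'[of "at_left (pi::real)"] by auto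
      have "\<exists>x. a \<le> x \<and> x \<le> b \<and> psi_arg x = y"
        using a b by (intro IVT2) (auto intro!: isCont_psi_arg)
      then show "y \<in> psi_arg ` {0<..<pi}" using a b by force
    qed
  qed
qed

text \<open>
  The inverse of the decreasing bijection \<open>psi_arg\<close> from \<open>(0, \<pi>)\<close> onto \<open>(0, e)\<close>.
\<close>

definition psi_param :: "real \<Rightarrow> real" where "psi_param = the_inv_into {0<..<pi} psi_arg"

lemma psi_param_psi_arg: "0 < v \<Longrightarrow> v < pi \<Longrightarrow> psi_param (psi_arg v) = v"
  unfolding psi_param_def using bij_betw_psi_arg by (intro the_inv_into_f_f) (auto simp: bij_betw_def)

lemma psi_arg_psi_param:
  assumes "0 < y" "y < exp 1" shows "0 < psi_param y" "psi_param y < pi" "psi_arg (psi_param y) = y"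
proof -
  have "y \<in> psi_arg ` {0<..<pi}" using assms bij_betw_psi_arg by (simp add: bij_betw_def)
  then obtain v where "0 < v" "v < pi" "y = psi_arg v" by auto
  then show "0 < psi_param y" "psi_param y < pi" "psi_arg (psi_param y) = y" by (auto simp: psi_param_psi_arg)
qed

lemma isCont_psi_param: "0 < v \<Longrightarrow> v < pi \<Longrightarrow> isCont psi_param (psi_arg v)"
  by (rule isCont_inverse_function2[of "v / 2" v "(v + pi) / 2"])
     (auto intro!: psi_param_psi_arg isCont_psi_arg simp: field_simps)

text \<open>
  The defining equation prescribes the value at every point of \<open>(0, e)\<close>, since \<open>psi_arg\<close> maps \<open>(0, \<pi>)\<close> onto it.
  The equation is consistent because \<open>psi_arg\<close> is injective.
\<close>

lemma triangular_psi_iff: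
  "triangular_psi \<psi> \<longleftrightarrow> \<psi> = (\<lambda>y. if y \<in> {0<..<exp 1} then psi_val (psi_param y) else undefined)"
proof
  assume psi: "triangular_psi \<psi>"
  show "\<psi> = (\<lambda>y. if y \<in> {0<..<exp 1} then psi_val (psi_param y) else undefined)"
  proof
    fix y
    show "\<psi> y = (if y \<in> {0<..<exp 1} then psi_val (psi_param y) else undefined)"
    proof (cases "y \<in> {0<..<exp 1}")
      case True
      then have "\<psi> (psi_arg (psi_param y)) = psi_val (psi_param y)"
        using psi psi_arg_psi_param[of y] unfolding triangular_psi_def psi_arg_def[of "psi_param y"] psi_val_def by auto
      then show ?thesis using True psi_arg_psi_param[of y] by auto
    next
      case False then show ?thesis using psi unfolding triangular_psi_def by (auto simp: PiE_def extensional_def)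
    qed
  qed
next
  assume "\<psi> = (\<lambda>y. if y \<in> {0<..<exp 1} then psi_val (psi_param y) else undefined)"
  moreover have "psi_arg v = sin v / v * exp (v * cot v)" "psi_val v = 1 / pi * sin v * exp (- (v * cot v))" for v
    by (simp_all add: psi_arg_def psi_val_def)
  ultimately show "triangular_psi \<psi>"
    unfolding triangular_psi_def
    using psi_val_pos psi_arg_psi_param psi_param_psi_arg psi_arg_pos psi_arg_less_e
    by (auto simp flip: psi_arg_def simp: psi_val_def)
qed

lemma triangular_psi_ex1: "\<exists>!\<psi>. triangular_psi \<psi>"
  unfolding triangular_psi_iff by blast

text \<open>
  The density for the unique \<open>\<psi>\<close>, as a closed expression.
\<close>

definition lsd_dens :: "real \<Rightarrow> real" where
  "lsd_dens t = (if t\<^sup>2 \<in> {0<..<exp 1} then \<bar>t\<bar> * psi_val (psi_param (t\<^sup>2)) else 0)"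

lemma lsd_density_eq: "triangular_psi \<psi> \<Longrightarrow> lsd_density \<psi> = lsd_dens"
  unfolding triangular_psi_iff by (rule ext) (simp add: lsd_density_def lsd_dens_def)

lemma lsd_dens_nonneg: "0 \<le> lsd_dens t"
  by (auto simp: lsd_dens_def intro!: mult_nonneg_nonneg less_imp_le[OF psi_val_pos] psi_arg_psi_param)

lemma lsd_dens_minus: "lsd_dens (- t) = lsd_dens t"
  by (simp add: lsd_dens_def)

lemma square_less_e_iff: "t\<^sup>2 < exp 1 \<longleftrightarrow> \<bar>t\<bar> < sqrt (exp 1)"
  by (subst real_sqrt_less_iff[symmetric]) simp

lemma lsd_dens_0: "t \<notin> {-sqrt (exp 1)<..<sqrt (exp 1)} \<Longrightarrow> lsd_dens t = 0"
  using square_less_e_iff[of t] by (auto simp: lsd_dens_def abs_less_iff)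

lemma isCont_lsd_dens:
  assumes "t \<noteq> 0" "t\<^sup>2 < exp 1" shows "isCont lsd_dens t"
proof -
  have y: "0 < t\<^sup>2" using assms by simp
  note a = psi_arg_psi_param[OF y assms(2)]
  have "isCont psi_param (t\<^sup>2)" using isCont_psi_param[OF a(1,2)] a(3) by simp
  then have 1: "isCont (\<lambda>t. psi_param (t\<^sup>2)) t" by (intro isCont_o2[of t "\<lambda>t. t\<^sup>2" psi_param]) auto
  have "isCont psi_val (psi_param (t\<^sup>2))" using DERIV_psi_val[OF a(1,2)] DERIV_isCont by blast
  from isCont_o2[OF 1 this] have "isCont (\<lambda>t. psi_val (psi_param (t\<^sup>2))) t" .
  then have "isCont (\<lambda>t. \<bar>t\<bar> * psi_val (psi_param (t\<^sup>2))) t"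
    by (intro isCont_mult isCont_rabs continuous_ident)
  moreover have "eventually (\<lambda>t. lsd_dens t = \<bar>t\<bar> * psi_val (psi_param (t\<^sup>2))) (nhds t)"
  proof -
    have "open {t::real. 0 < t\<^sup>2 \<and> t\<^sup>2 < exp 1}"
      by (intro open_Collect_conj open_Collect_less continuous_intros)
    then show ?thesis
      using assms y by (auto simp: eventually_nhds lsd_dens_def intro!: exI[of _ "{t::real. 0 < t\<^sup>2 \<and> t\<^sup>2 < exp 1}"])
  qed
  ultimately show ?thesis by (subst isCont_cong)
qed

text \<open>
  The substitution \<open>t = sqrt (s(-w))\<close>, increasing for \<open>-\<pi> < w < 0\<close>, turns the integrand into
  \<open>- s\<^sup>k s' q / 2\<close>, whose primitive is \<open>moment_prim k (- w) / 2\<close>.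
\<close>

lemma half_moment:
  fixes k :: nat
  defines "f \<equiv> \<lambda>t. t ^ (2 * k) * lsd_dens t"
  shows "set_integrable lborel {0<..<sqrt (exp 1)} f"
    and "(LBINT t=0..sqrt (exp 1). f t) = real k ^ k / fact (k + 1) / 2"
proof -
  define g where "g w = sqrt (psi_arg (- w))" for w
  define g' where "g' w = - psi_arg_deriv (- w) / (2 * sqrt (psi_arg (- w)))" for w
  define h where "h w = psi_arg (- w) ^ k * psi_val (- w) * - psi_arg_deriv (- w) / 2" for w
  define G where "G w = moment_prim k (- w) / 2" for w
  have v: "0 < - w" "- w < pi" if "-pi < w" "w < 0" for w :: real using that by auto
  have fgh: "f (g w) * g' w = h w" if w: "-pi < w" "w < 0" for w
  proof -
    note s = psi_arg_pos[OF v[OF w]]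
    have g2: "(g w)\<^sup>2 = psi_arg (- w)" using s by (simp add: g_def)
    have "lsd_dens (g w) = \<bar>g w\<bar> * psi_val (- w)"
      unfolding lsd_dens_def g2 psi_param_psi_arg[OF v[OF w]] using s psi_arg_less_e[OF v[OF w]] by simp
    then have "lsd_dens (g w) = sqrt (psi_arg (- w)) * psi_val (- w)" using s by (simp add: g_def)
    moreover have "g w ^ (2 * k) = psi_arg (- w) ^ k" unfolding power_mult g2 ..
    ultimately show ?thesis using s by (simp add: f_def g'_def h_def)
  qed
  have cs': "isCont psi_arg_deriv u" if "0 < u" "u < pi" for u
    unfolding psi_arg_deriv_def[abs_def] using that sin_gt_zero[of u]
    by (intro continuous_intros isCont_psi_arg) auto
  have csw: "isCont (\<lambda>w. psi_arg_deriv (- w)) w" "isCont (\<lambda>w. psi_arg (- w)) w" "isCont (\<lambda>w. psi_val (- w)) w"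
    if w: "-pi < w" "w < 0" for w
  proof -
    have m: "isCont (\<lambda>w::real. - w) w" by (intro continuous_intros)
    show "isCont (\<lambda>w. psi_arg_deriv (- w)) w" by (rule isCont_o2[OF m cs'[OF v[OF w]]])
    show "isCont (\<lambda>w. psi_arg (- w)) w" by (rule isCont_o2[OF m isCont_psi_arg[OF v[OF w]]])
    show "isCont (\<lambda>w. psi_val (- w)) w"
      by (rule isCont_o2[OF m DERIV_psi_val[OF v[OF w], THEN DERIV_isCont]])
  qed
  have contg': "isCont g' w" if w: "-pi < w" "w < 0" for w
    unfolding g'_def[abs_def] using psi_arg_pos[OF v[OF w]] csw[OF w]
    by (intro continuous_intros) auto
  have conth: "isCont h w" if w: "-pi < w" "w < 0" for w
    unfolding h_def[abs_def] using csw[OF w] by (intro continuous_intros) auto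
  have hpos: "0 \<le> h w" if w: "-pi < w" "w < 0" for w
    unfolding h_def using psi_arg_pos[OF v[OF w]] psi_val_pos[OF v[OF w]] psi_arg_deriv_neg[OF v[OF w]]
    by (intro divide_nonneg_pos mult_nonneg_nonneg) auto
  have dminus: "(uminus has_real_derivative - 1) (at w)" for w :: real
    by (rule DERIV_minus[OF DERIV_ident])
  have dg: "(g has_real_derivative g' w) (at w)" if w: "-pi < w" "w < 0" for w
    using DERIV_chain2[OF DERIV_real_sqrt[OF psi_arg_pos[OF v[OF w]]] DERIV_chain2[OF DERIV_psi_arg[OF v[OF w]] dminus]]
    unfolding g_def[abs_def] g'_def by (simp add: field_simps)
  have dG: "(G has_real_derivative h w) (at w)" if w: "-pi < w" "w < 0" for w
    using DERIV_cdivide[OF DERIV_chain2[OF DERIV_moment_prim[OF v[OF w], of k] dminus], of 2]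
    unfolding G_def[abs_def] h_def by (simp add: mult_ac)
  have G_pi: "(G \<longlongrightarrow> - (real k ^ k / fact (k + 1)) / 2) (at_right (- pi))"
    unfolding G_def[abs_def]
    by (intro tendsto_divide tendsto_const
        filterlim_at_left_to_right[of "moment_prim k" _ pi, THEN iffD1, OF moment_prim_at_pi]) simp
  have at_left_0: "(F \<longlongrightarrow> l) (at_left 0)" if "((\<lambda>w. F (- w)) \<longlongrightarrow> l) (at_right 0)"
    for F :: "real \<Rightarrow> real" and l
    using that by (simp add: filterlim_at_left_to_right)
  have G_0: "(G \<longlongrightarrow> 0 / 2) (at_left 0)"
    unfolding G_def[abs_def]
    by (rule at_left_0, intro tendsto_divide tendsto_const) (simp_all add: moment_prim_at_0)
  have g_pi: "(g \<longlongrightarrow> sqrt 0) (at_right (- pi))"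
    unfolding g_def[abs_def]
    by (intro tendsto_real_sqrt filterlim_at_left_to_right[of psi_arg _ pi, THEN iffD1, OF psi_arg_at_pi])
  have g_0: "(g \<longlongrightarrow> sqrt (exp 1)) (at_left 0)"
    unfolding g_def[abs_def]
    by (rule at_left_0, rule tendsto_real_sqrt) (simp add: psi_arg_at_0)
  note ftc = interval_integral_FTC_nonneg[of "ereal (- pi)" "ereal 0" G h "- (real k ^ k / fact (k + 1)) / 2" "0 / 2"]
  have inth: "set_integrable lborel (einterval (ereal (- pi)) (ereal 0)) h"
    by (rule ftc(1)) (use dG conth hpos G_pi G_0 in \<open>auto simp: ereal_tendsto_simps\<close>)
  have valh: "(LBINT w=ereal (- pi)..ereal 0. h w) = 0 / 2 - (- (real k ^ k / fact (k + 1)) / 2)"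
    by (rule ftc(2)) (use dG conth hpos G_pi G_0 in \<open>auto simp: ereal_tendsto_simps\<close>)
  have fnonneg: "0 \<le> f (g w)" for w
    unfolding f_def by (intro mult_nonneg_nonneg lsd_dens_nonneg) auto
  have contf: "isCont f (g w)" if w: "-pi < w" "w < 0" for w
    unfolding f_def g_def using psi_arg_pos[OF v[OF w]] psi_arg_less_e[OF v[OF w]]
    by (intro continuous_intros isCont_lsd_dens) auto
  have g'pos: "0 \<le> g' w" if "-pi \<le> w" "w \<le> 0" for w
  proof (cases "w = 0 \<or> w = - pi")
    \<comment> \<open>At the end points the formula for \<open>g'\<close> divides by \<open>sin v = 0\<close> or by \<open>v = 0\<close> and therefore has the value 0.\<close>
    case True then show ?thesis by (auto simp: g'_def psi_arg_deriv_def)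
  next
    case False
    with that have w: "- pi < w" "w < 0" by auto
    show ?thesis unfolding g'_def using psi_arg_pos[OF v[OF w]] psi_arg_deriv_neg[OF v[OF w]] by (intro divide_nonneg_pos) auto
  qed
  have inth': "set_integrable lborel (einterval (ereal (- pi)) (ereal 0)) (\<lambda>w. f (g w) * g' w)"
    using inth by (rule set_integrable_cong[THEN iffD1, rotated 3]) (auto simp: fgh einterval_eq)
  note subst = interval_integral_substitution_nonneg[of "ereal (- pi)" "ereal 0" g g' f "ereal (sqrt 0)" "ereal (sqrt (exp 1))"]
  have sub1: "set_integrable lborel (einterval (ereal (sqrt 0)) (ereal (sqrt (exp 1)))) f"
    by (rule subst(1)) (use dg contf contg' fnonneg g'pos g_pi g_0 inth' in \<open>auto simp: ereal_tendsto_simps\<close>)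
  have sub2: "(LBINT t=ereal (sqrt 0)..ereal (sqrt (exp 1)). f t) = (LBINT w=ereal (- pi)..ereal 0. f (g w) * g' w)"
    by (rule subst(2)) (use dg contf contg' fnonneg g'pos g_pi g_0 inth' in \<open>auto simp: ereal_tendsto_simps\<close>)
  from sub1 show "set_integrable lborel {0<..<sqrt (exp 1)} f" by simp
  have "(LBINT w=ereal (- pi)..ereal 0. f (g w) * g' w) = (LBINT w=ereal (- pi)..ereal 0. h w)"
    by (rule interval_integral_cong) (auto simp: fgh einterval_eq)
  then show "(LBINT t=0..sqrt (exp 1). f t) = real k ^ k / fact (k + 1) / 2"
    using sub2 valh by (simp add: zero_ereal_def)
qed

section \<open>The limiting law and its moments\<close>

lemma half_moment_has_integral:
  "has_bochner_integral lborel (\<lambda>t. indicator {0<..<sqrt (exp 1)} t *\<^sub>R (t ^ (2 * k) * lsd_dens t))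
     (real k ^ k / fact (k + 1) / 2)"
proof -
  have "(LBINT t=ereal 0..ereal (sqrt (exp 1)). t ^ (2 * k) * lsd_dens t) =
      (LBINT t:{0<..<sqrt (exp 1)}. t ^ (2 * k) * lsd_dens t)"
    by (subst interval_integral_Ioo) auto
  then have "(LBINT t:{0<..<sqrt (exp 1)}. t ^ (2 * k) * lsd_dens t) = real k ^ k / fact (k + 1) / 2"
    using half_moment(2)[of k] by (simp add: zero_ereal_def)
  then show ?thesis
    using half_moment(1)[of k] unfolding set_integrable_def set_lebesgue_integral_def
    by (simp add: has_bochner_integral_iff)
qed

lemma has_bochner_integral_reflect:
  fixes f :: "real \<Rightarrow> real"
  assumes "has_bochner_integral lborel f I" shows "has_bochner_integral lborel (\<lambda>t. f (- t)) I"
  using lborel_has_bochner_integral_real_affine_iff[of "-1" f I 0] assms by simp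

text \<open>
  The density is even, so its integral against a power is made of the integral over the positive half line and
  its reflection. They add for even powers and cancel for odd ones.
\<close>

lemma lsd_dens_split:
  "t ^ m * lsd_dens t = indicator {0<..<sqrt (exp 1)} t *\<^sub>R (t ^ m * lsd_dens t)
     + (-1) ^ m * (indicator {0<..<sqrt (exp 1)} (- t) *\<^sub>R ((- t) ^ m * lsd_dens (- t)))"
proof (cases "t \<in> {- sqrt (exp 1)<..<sqrt (exp 1)} - {0}")
  case True
  have "(-1) ^ m * ((- t) ^ m * lsd_dens t) = t ^ m * lsd_dens t"
  proof -
    have "(-1) ^ m * (- t) ^ m = ((-1) * (- t)) ^ m" by (rule power_mult_distrib[symmetric])
    then show ?thesis by (simp flip: mult.assoc)
  qed
  then show ?thesis using True by (auto simp: lsd_dens_minus indicator_def)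
next
  case False
  then have "lsd_dens t = 0" using lsd_dens_0[of t] by (cases "t = 0") (auto simp: lsd_dens_def)
  then show ?thesis by (simp add: lsd_dens_minus)
qed

lemma lsd_even_moment:
  "has_bochner_integral lborel (\<lambda>t. t ^ (2 * k) * lsd_dens t) (real k ^ k / fact (k + 1))"
proof -
  have "has_bochner_integral lborel (\<lambda>t. indicator {0<..<sqrt (exp 1)} t *\<^sub>R (t ^ (2 * k) * lsd_dens t)
     + (-1) ^ (2 * k) * (indicator {0<..<sqrt (exp 1)} (- t) *\<^sub>R ((- t) ^ (2 * k) * lsd_dens (- t))))
     (real k ^ k / fact (k + 1) / 2 + (-1) ^ (2 * k) * (real k ^ k / fact (k + 1) / 2))"
    by (intro has_bochner_integral_add has_bochner_integral_mult_right half_moment_has_integral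
        has_bochner_integral_reflect[OF half_moment_has_integral])
  then show ?thesis unfolding lsd_dens_split[symmetric] by (simp add: mult.commute)
qed

lemma lsd_odd_moment:
  "has_bochner_integral lborel (\<lambda>t. t ^ (2 * k + 1) * lsd_dens t) 0"
proof -
  let ?P = "\<lambda>t. indicator {0<..<sqrt (exp 1)} t *\<^sub>R (t ^ (2 * k) * lsd_dens t) :: real"
  let ?Q = "\<lambda>t. indicator {0<..<sqrt (exp 1)} t *\<^sub>R (t ^ (2 * k + 1) * lsd_dens t) :: real"
  have P: "integrable lborel ?P" by (rule integrable.intros[OF half_moment_has_integral])
  have QP: "?Q t = t * ?P t" for t by simp
  have "integrable lborel ?Q"
  proof (rule Bochner_Integration.integrable_bound)
    show "integrable lborel (\<lambda>t. sqrt (exp 1) * ?P t)" using P by simp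
    show "?Q \<in> borel_measurable lborel" unfolding QP using P by (intro borel_measurable_times) auto
    show "AE t in lborel. norm (?Q t) \<le> norm (sqrt (exp 1) * ?P t)"
      unfolding QP by (intro AE_I2) (auto simp: abs_mult indicator_def intro!: mult_right_mono)
  qed
  then obtain I where I: "has_bochner_integral lborel ?Q I" using has_bochner_integral_integrable by blast
  have "has_bochner_integral lborel (\<lambda>t. ?Q t + (-1) ^ (2 * k + 1) * ?Q (- t)) (I + (-1) ^ (2 * k + 1) * I)"
    by (intro has_bochner_integral_add has_bochner_integral_mult_right I has_bochner_integral_reflect[OF I])
  then show ?thesis unfolding lsd_dens_split[symmetric] by simp
qed

definition lsd_measure :: "real measure" where
  "lsd_measure = density lborel (\<lambda>t. ennreal (lsd_dens t))"

lemma lsd_dens_measurable [measurable]: "lsd_dens \<in> borel_measurable borel"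
  using borel_measurable_integrable[OF integrable.intros[OF lsd_even_moment[of 0]]] by simp

lemma sets_lsd_measure [simp, measurable_cong]: "sets lsd_measure = sets borel"
  by (simp add: lsd_measure_def)

lemma real_distribution_lsd_measure: "real_distribution lsd_measure"
proof -
  have "prob_space lsd_measure"
  proof
    have "emeasure lsd_measure (space lsd_measure) = (\<integral>\<^sup>+t. ennreal (lsd_dens t) \<partial>lborel)"
      by (simp add: lsd_measure_def emeasure_density)
    also have "\<dots> = ennreal (\<integral>t. lsd_dens t \<partial>lborel)"
      using integrable.intros[OF lsd_even_moment[of 0]]
      by (intro nn_integral_eq_integral) (auto simp: lsd_dens_nonneg)
    also have "(\<integral>t. lsd_dens t \<partial>lborel) = 1"
      using has_bochner_integral_integral_eq[OF lsd_even_moment[of 0]] by simp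
    finally show "emeasure lsd_measure (space lsd_measure) = 1" by simp
  qed
  then show ?thesis by (simp add: real_distribution_def real_distribution_axioms_def)
qed

lemma lsd_measure_moment:
  "integrable lsd_measure (\<lambda>t. t ^ m)"
  "(\<integral>t. t ^ m \<partial>lsd_measure) = (if even m then real (m div 2) ^ (m div 2) / fact (m div 2 + 1) else 0)"
proof -
  have "has_bochner_integral lborel (\<lambda>t. t ^ m * lsd_dens t)
      (if even m then real (m div 2) ^ (m div 2) / fact (m div 2 + 1) else 0)"
  proof (cases "even m")
    case True
    then obtain k where "m = 2 * k" by (rule evenE)
    then show ?thesis using lsd_even_moment[of k] by simp
  next
    case False
    then obtain k where "m = 2 * k + 1" by (rule oddE)
    then show ?thesis using lsd_odd_moment[of k] by simp
  qed
  then have *: "has_bochner_integral lborel (\<lambda>t. lsd_dens t *\<^sub>R t ^ m)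
      (if even m then real (m div 2) ^ (m div 2) / fact (m div 2 + 1) else 0)"
    by (simp add: mult.commute)
  show "integrable lsd_measure (\<lambda>t. t ^ m)"
    unfolding lsd_measure_def
    using integrable.intros[OF *] by (subst integrable_density) (auto simp: lsd_dens_nonneg)
  show "(\<integral>t. t ^ m \<partial>lsd_measure) = (if even m then real (m div 2) ^ (m div 2) / fact (m div 2 + 1) else 0)"
    unfolding lsd_measure_def
    using has_bochner_integral_integral_eq[OF *] by (subst integral_density) (auto simp: lsd_dens_nonneg)
qed

lemma distributed_lsd_measure: "distributed lsd_measure lborel (\<lambda>t. t) lsd_dens"
proof -
  have "distr lsd_measure lborel (\<lambda>t. t) = lsd_measure"
    by (rule distr_id2) (simp add: lsd_measure_def)
  then show ?thesis by (simp add: distributed_def lsd_measure_def)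
qed

lemma support_lsd_measure: "measure_support lsd_measure \<subseteq> {- sqrt (exp 1)..sqrt (exp 1)}"
proof
  fix x assume x: "x \<in> measure_support lsd_measure"
  show "x \<in> {- sqrt (exp 1)..sqrt (exp 1)}"
  proof (rule ccontr)
    let ?U = "- {- sqrt (exp 1)..sqrt (exp 1)} :: real set"
    assume "x \<notin> {- sqrt (exp 1)..sqrt (exp 1)}"
    then have "emeasure lsd_measure ?U > 0"
      using x unfolding measure_support_def by (auto simp: open_Compl)
    moreover have "emeasure lsd_measure ?U = (\<integral>\<^sup>+t. ennreal (lsd_dens t) * indicator ?U t \<partial>lborel)"
      by (simp add: lsd_measure_def emeasure_density)
    moreover have "\<dots> = (\<integral>\<^sup>+(t::real). 0 \<partial>lborel)"
    proof (intro nn_integral_cong)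
      fix t show "ennreal (lsd_dens t) * indicator ?U t = 0"
        using lsd_dens_0[of t] by (cases "t \<in> ?U") auto
    qed
    ultimately show False by simp
  qed
qed

text \<open>
  From \<open>k! k\<^sup>k \<le> (2k)!\<close> the expression is at most \<open>2 (t\<^sup>2)\<^sup>k / k!\<close>.
\<close>

lemma lsd_measure_moment_growth:
  "(\<lambda>k. 2 * \<bar>t\<bar> ^ (2 * k) / fact (2 * k) * (\<integral>x. x ^ (2 * k) \<partial>lsd_measure)) \<longlonglongrightarrow> 0"
proof (rule Lim_null_comparison)
  show "(\<lambda>k. 2 * ((t\<^sup>2) ^ k /\<^sub>R fact k)) \<longlonglongrightarrow> 0"
    using summable_LIMSEQ_zero[OF summable_exp_generic[of "t\<^sup>2"]] tendsto_mult_right_zero by blast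
  have "norm (2 * \<bar>t\<bar> ^ (2 * k) / fact (2 * k) * (\<integral>x. x ^ (2 * k) \<partial>lsd_measure)) \<le> 2 * ((t\<^sup>2) ^ k /\<^sub>R fact k)" for k
  proof -
    have "fact k * k ^ k \<le> (fact (2 * k) :: nat)"
    proof -
      have "fact (k + j) \<ge> fact k * k ^ j" for j
      proof (induction j)
        case (Suc j)
        have "fact k * k ^ Suc j = k * (fact k * k ^ j)" by simp
        also have "\<dots> \<le> (k + j + 1) * fact (k + j)" by (intro mult_mono Suc) auto
        finally show ?case by simp
      qed simp
      from this[of k] show ?thesis by (simp add: mult_2)
    qed
    then have "fact k * real k ^ k \<le> fact (2 * k)"
      by (metis of_nat_fact of_nat_le_iff of_nat_mult of_nat_power)
    then have h: "real k ^ k / fact (2 * k) \<le> 1 / fact k" by (simp add: field_simps)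
    have "real k ^ k / fact (2 * k) / fact (k + 1) \<le> 1 / fact k / 1"
      by (rule frac_le[OF _ h _ fact_ge_1]) auto
    then have "2 * (t\<^sup>2) ^ k * (real k ^ k / fact (2 * k) / fact (k + 1)) \<le> 2 * (t\<^sup>2) ^ k * (1 / fact k / 1)"
      by (intro mult_left_mono) auto
    moreover have m: "(\<integral>x. x ^ (2 * k) \<partial>lsd_measure) = real k ^ k / fact (k + 1)"
      using lsd_measure_moment(2)[of "2 * k"] by simp
    have eq: "2 * \<bar>t\<bar> ^ (2 * k) / fact (2 * k) * (\<integral>x. x ^ (2 * k) \<partial>lsd_measure) =
        2 * (t\<^sup>2) ^ k * (real k ^ k / fact (2 * k) / fact (k + 1))"
      unfolding m power_mult[of "\<bar>t\<bar>" 2 k] by (simp del: fact_Suc)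
    moreover have "0 \<le> 2 * (t\<^sup>2) ^ k * (real k ^ k / fact (2 * k) / fact (k + 1))" by simp
    ultimately show ?thesis unfolding eq by (simp add: divide_inverse mult_ac del: fact_Suc)
  qed
  then show "\<forall>\<^sub>F k in sequentially. norm (2 * \<bar>t\<bar> ^ (2 * k) / fact (2 * k) * (\<integral>x. x ^ (2 * k) \<partial>lsd_measure))
     \<le> 2 * ((t\<^sup>2) ^ k /\<^sub>R fact k)" by simp
qed

section \<open>The moment method\<close>

text \<open>
  The characteristic function differs from its Taylor polynomial of degree \<open>2k\<close> by at most a multiple of the moment
  of order \<open>2k\<close>. The growth condition makes this small for the limit law when \<open>k\<close> is large, hence eventually for
  the approximating laws, while the Taylor polynomials converge with the moments. Levy's continuity theorem
  concludes.
\<close>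

theorem weak_conv_from_moments:
  assumes M: "\<And>n. real_distribution (M n)" and M': "real_distribution M'"
    and int: "\<And>m. eventually (\<lambda>n. integrable (M n) (\<lambda>x. x ^ m)) sequentially"
    and int': "\<And>m. integrable M' (\<lambda>x. x ^ m)"
    and conv: "\<And>m. (\<lambda>n. \<integral>x. x ^ m \<partial>M n) \<longlonglongrightarrow> (\<integral>x. x ^ m \<partial>M')"
    and growth: "\<And>t. (\<lambda>k. 2 * \<bar>t\<bar> ^ (2 * k) / fact (2 * k) * (\<integral>x. x ^ (2 * k) \<partial>M')) \<longlonglongrightarrow> 0"
  shows "weak_conv_m M M'"
proof (rule levy_continuity[OF M M'])
  fix t :: real
  show "(\<lambda>n. char (M n) t) \<longlonglongrightarrow> char M' t"
  proof (rule tendstoI)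
    fix e :: real assume e: "e > 0"
    define c where "c m = 2 * \<bar>t\<bar> ^ m / fact m" for m
    have "eventually (\<lambda>k. c (2 * k) * (\<integral>x. x ^ (2 * k) \<partial>M') < e / 2) sequentially"
      unfolding c_def using e by (intro order_tendstoD(2)[OF growth]) simp
    then obtain k where k: "c (2 * k) * (\<integral>x. x ^ (2 * k) \<partial>M') < e / 2"
      by (auto simp: eventually_sequentially)
    \<comment> \<open>The expectation of the Taylor polynomial of degree \<open>2k\<close> of \<open>exp (\<i> t x)\<close>.\<close>
    define S where "S N = (\<Sum>j\<le>2 * k. ((\<i> * t) ^ j / fact j) * complex_of_real (\<integral>x. x ^ j \<partial>N))" for N
    have approx: "cmod (char N t - S N) \<le> c (2 * k) * (\<integral>x. x ^ (2 * k) \<partial>N)"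
      if N: "real_distribution N" and i: "\<And>j. j \<le> 2 * k \<Longrightarrow> integrable N (\<lambda>x. x ^ j)" for N
      using real_distribution.char_approx1[OF N i, of "2 * k" t] by (simp add: S_def c_def power_even_abs)
    have "(\<lambda>n. cmod (S (M n) - S M') + c (2 * k) * (\<integral>x. x ^ (2 * k) \<partial>M n) + c (2 * k) * (\<integral>x. x ^ (2 * k) \<partial>M'))
      \<longlonglongrightarrow> cmod (S M' - S M') + c (2 * k) * (\<integral>x. x ^ (2 * k) \<partial>M') + c (2 * k) * (\<integral>x. x ^ (2 * k) \<partial>M')"
      unfolding S_def by (intro tendsto_intros conv)
    moreover have "cmod (S M' - S M') + c (2 * k) * (\<integral>x. x ^ (2 * k) \<partial>M') + c (2 * k) * (\<integral>x. x ^ (2 * k) \<partial>M') < e"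
      using k by simp
    ultimately have "eventually (\<lambda>n. cmod (S (M n) - S M') + c (2 * k) * (\<integral>x. x ^ (2 * k) \<partial>M n)
       + c (2 * k) * (\<integral>x. x ^ (2 * k) \<partial>M') < e) sequentially"
      by (rule order_tendstoD(2))
    moreover have "eventually (\<lambda>n. \<forall>j\<in>{..2 * k}. integrable (M n) (\<lambda>x. x ^ j)) sequentially"
      by (rule eventually_ball_finite) (use int in auto)
    ultimately show "eventually (\<lambda>n. dist (char (M n) t) (char M' t) < e) sequentially"
    proof eventually_elim
      case (elim n)
      have "cmod (char (M n) t - S (M n)) \<le> c (2 * k) * (\<integral>x. x ^ (2 * k) \<partial>M n)"
        using elim by (intro approx M) auto
      moreover have "cmod (char M' t - S M') \<le> c (2 * k) * (\<integral>x. x ^ (2 * k) \<partial>M')"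
        by (intro approx M' int')
      moreover have "cmod (char (M n) t - char M' t)
          \<le> cmod (char (M n) t - S (M n)) + cmod (S (M n) - S M') + cmod (char M' t - S M')"
        using norm_triangle_ineq4[of "(char (M n) t - S (M n)) + (S (M n) - S M')" "char M' t - S M'"]
          norm_triangle_ineq[of "char (M n) t - S (M n)" "S (M n) - S M'"] by simp
      ultimately show ?case using elim(1) by (simp add: dist_norm)
    qed
  qed
qed

section \<open>The triangular Wigner matrix\<close>

lemma (in prob_space) indep_vars_reindex:
  assumes X: "indep_vars M' X I" and inj: "inj \<sigma>" and sub: "\<sigma> ` J \<subseteq> I"
  shows "indep_vars (\<lambda>j. M' (\<sigma> j)) (\<lambda>j. X (\<sigma> j)) J"
proof -
  let ?F = "\<lambda>i. {X i -` A \<inter> space M | A. A \<in> sets (M' i)}"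
  have rv: "\<And>i. i \<in> I \<Longrightarrow> random_variable (M' i) (X i)" and F: "indep_sets ?F I"
    using X unfolding indep_vars_def2 by auto
  have "indep_sets (\<lambda>j. ?F (\<sigma> j)) J"
  proof (rule indep_setsI)
    show "?F (\<sigma> j) \<subseteq> events" if "j \<in> J" for j
      using F that sub unfolding indep_sets_def by blast
    show "prob (\<Inter>j\<in>K. A j) = (\<Prod>j\<in>K. prob (A j))"
      if K: "K \<noteq> {}" "K \<subseteq> J" "finite K" "\<forall>j\<in>K. A j \<in> ?F (\<sigma> j)" for A K
    proof -
      define B where "B i = A (inv_into UNIV \<sigma> i)" for i
      have B: "B (\<sigma> j) = A j" for j by (simp add: B_def inj)
      have "prob (\<Inter>i\<in>\<sigma> ` K. B i) = (\<Prod>i\<in>\<sigma> ` K. prob (B i))"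
      proof (rule indep_setsD[OF F])
        show "\<sigma> ` K \<subseteq> I" using K(2) sub by blast
        show "\<forall>i\<in>\<sigma> ` K. B i \<in> ?F i" using K(4) by (simp add: B)
      qed (use K in auto)
      moreover have "(\<Prod>i\<in>\<sigma> ` K. prob (B i)) = (\<Prod>j\<in>K. prob (A j))"
        by (subst prod.reindex) (auto simp: B intro: inj_on_subset[OF inj])
      ultimately show ?thesis by (simp add: B)
    qed
  qed
  then show ?thesis unfolding indep_vars_def2 using rv sub by auto
qed

theorem theorem3p1:
  fixes M :: "'w measure" and x :: "nat \<Rightarrow> nat \<Rightarrow> 'w \<Rightarrow> real"
  assumes "prob_space M"
    and "prob_space.indep_vars M (\<lambda>_. borel) (\<lambda>(i, j). x i j) {(i, j). 1 \<le> i \<and> i \<le> j}"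
    and "\<And>i j. 1 \<le> i \<Longrightarrow> i \<le> j \<Longrightarrow> prob_space.expectation M (x i j) = 0"
    and "\<And>i j. 1 \<le> i \<Longrightarrow> i \<le> j \<Longrightarrow> prob_space.variance M (x i j) = 1"
    and "\<exists>C. \<forall>i j. 1 \<le> i \<longrightarrow> i \<le> j \<longrightarrow> (AE \<omega> in M. \<bar>x i j \<omega>\<bar> \<le> C)"
  defines "W \<equiv> (\<lambda>n \<omega>. triangular_wigner n (\<lambda>i j. x i j \<omega>))"
  shows "(AE \<omega> in M. \<forall>k\<ge>1.
            (\<lambda>n. 1 / real n * mat_trace ((1 / sqrt (real n) \<cdot>\<^sub>m W n \<omega>) ^\<^sub>m (2 * k)))
              \<longlonglongrightarrow> real k ^ k / fact (k + 1)) \<and>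
         (\<exists>!\<psi>. triangular_psi \<psi>) \<and>
         (\<exists>\<mu>. is_lsd M (\<lambda>n \<omega>. 1 / sqrt (real n) \<cdot>\<^sub>m W n \<omega>) \<mu> \<and>
              (\<forall>\<psi>. triangular_psi \<psi> \<longrightarrow> distributed \<mu> lborel (\<lambda>t. t) (lsd_density \<psi>)) \<and>
              measure_support \<mu> \<subseteq> {- sqrt (exp 1)..sqrt (exp 1)})"
proof -
  interpret prob_space M by fact
  obtain C0 where C0: "\<And>i j. 1 \<le> i \<Longrightarrow> i \<le> j \<Longrightarrow> AE \<omega> in M. \<bar>x i j \<omega>\<bar> \<le> C0"
    using assms(5) by blast
  \<comment> \<open>The entries of the array start at index 1, whereas vertices of walks start at 0.\<close>
  define y where "y e = x (Suc (fst e)) (Suc (snd e))" for e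
  interpret bounded_array M y "max 1 C0"
  proof
    have "indep_vars (\<lambda>_. borel) (\<lambda>e. case (Suc (fst e), Suc (snd e)) of (i, j) \<Rightarrow> x i j) {(a, b). a \<le> b}"
      by (rule indep_vars_reindex[OF assms(2), of "\<lambda>e. (Suc (fst e), Suc (snd e))"])
         (auto intro!: injI prod_eqI)
    then show "indep_vars (\<lambda>_. borel) y {(a, b). a \<le> b}" by (simp add: y_def[abs_def])
    fix a b :: nat assume ab: "a \<le> b"
    show m: "expectation (y (a, b)) = 0" using assms(3)[of "Suc a" "Suc b"] ab by (simp add: y_def)
    show "expectation (\<lambda>\<omega>. (y (a, b) \<omega>)\<^sup>2) = 1"
      using assms(4)[of "Suc a" "Suc b"] assms(3)[of "Suc a" "Suc b"] ab by (simp add: y_def)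
    show "AE \<omega> in M. \<bar>y (a, b) \<omega>\<bar> \<le> max 1 C0"
      using C0[of "Suc a" "Suc b"] ab by (auto simp: y_def elim!: eventually_mono)
  qed simp
  define N where "N n \<omega> = 1 / sqrt (real n) \<cdot>\<^sub>m W n \<omega>" for n \<omega>
  have N_carrier: "N n \<omega> \<in> carrier_mat n n" for n \<omega>
    using triangular_wigner_carrier by (simp add: N_def W_def)
  have N_entry: "N n \<omega> $$ (a, b) = 1 / sqrt (real n) * (if a + b < n then y (min a b, max a b) \<omega> else 0)"
    if "a < n" "b < n" for n \<omega> a b
    using that by (simp add: N_def W_def triangular_wigner_entry y_def carrier_matD[OF triangular_wigner_carrier])
  have N_sym: "symmetric_mat (N n \<omega>)" for n \<omega>
    using N_carrier[of n \<omega>] by (auto simp: symmetric_mat_def N_entry min.commute max.commute add.commute)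
  have trace: "1 / real n * mat_trace (N n \<omega> ^\<^sub>m m) = walk_sum n m \<omega> / (real n * sqrt (real n) ^ m)" for n m \<omega>
    by (subst trace_pow_triangular[OF N_carrier N_entry]) (simp_all add: power_divide)
  have "AE \<omega> in M. \<forall>m. (\<lambda>n. walk_sum n m \<omega> / (real n * sqrt (real n) ^ m)) \<longlonglongrightarrow> moment_limit m"
    using walk_sum_limit by (simp add: AE_all_countable)
  then have lim: "AE \<omega> in M. \<forall>m. (\<lambda>n. 1 / real n * mat_trace (N n \<omega> ^\<^sub>m m)) \<longlonglongrightarrow> moment_limit m"
    by (simp only: trace)
  have "AE \<omega> in M. \<forall>k\<ge>1. (\<lambda>n. 1 / real n * mat_trace (N n \<omega> ^\<^sub>m (2 * k))) \<longlonglongrightarrow> real k ^ k / fact (k + 1)"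
    using lim
  proof eventually_elim
    case (elim \<omega>)
    have "moment_limit (2 * k) = real k ^ k / fact (k + 1)" for k by (simp add: moment_limit_def)
    then show ?case using elim by metis
  qed
  moreover have "is_lsd M N lsd_measure"
  proof -
    have "AE \<omega> in M. weak_conv_m (\<lambda>n. esd (N n \<omega>)) lsd_measure"
      using lim
    proof eventually_elim
      case (elim \<omega>)
      show ?case
      proof (rule weak_conv_from_moments)
        show "eventually (\<lambda>n. integrable (esd (N n \<omega>)) (\<lambda>x. x ^ m)) sequentially" for m
          by (rule eventually_mono[OF eventually_gt_at_top[of 0]]) (rule esd_moment(1)[OF N_carrier _ N_sym])
        show "(\<lambda>n. \<integral>x. x ^ m \<partial>esd (N n \<omega>)) \<longlonglongrightarrow> (\<integral>x. x ^ m \<partial>lsd_measure)" for m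
        proof (rule Lim_transform_eventually)
          show "(\<lambda>n. 1 / real n * mat_trace (N n \<omega> ^\<^sub>m m)) \<longlonglongrightarrow> (\<integral>x. x ^ m \<partial>lsd_measure)"
            using elim by (simp only: lsd_measure_moment(2) moment_limit_def)
          show "eventually (\<lambda>n. 1 / real n * mat_trace (N n \<omega> ^\<^sub>m m) = (\<integral>x. x ^ m \<partial>esd (N n \<omega>))) sequentially"
            by (rule eventually_mono[OF eventually_gt_at_top[of 0]]) (simp add: esd_moment(2)[OF N_carrier _ N_sym])
        qed
      qed (rule real_distribution_esd real_distribution_lsd_measure lsd_measure_moment(1) lsd_measure_moment_growth)+
    qed
    then show ?thesis unfolding is_lsd_def using real_distribution_lsd_measure by blast
  qed
  moreover have "\<forall>\<psi>. triangular_psi \<psi> \<longrightarrow> distributed lsd_measure lborel (\<lambda>t. t) (lsd_density \<psi>)"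
    using distributed_lsd_measure lsd_density_eq by simp
  ultimately show ?thesis
    using triangular_psi_ex1 support_lsd_measure unfolding N_def[abs_def] by blast
qed

end
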